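(* Let $C_n$ be chosen uniformly at random from all paths with vertex set $\{1,\dots,n\}$, and let $G_n$ be chosen uniformly at random from all forests of paths (graphs every component of which is a path) with vertex set $\{1,\dots,n\}$. Then: (1) the MSO convergence law fails for $C_n$, i.e. there is an MSO sentence $\varphi$ such that $\Pr(C_n\models\varphi)$ does not converge; (2) the MSO convergence law holds for $G_n$, i.e. $\lim_{n\to\infty}\Pr(G_n\models\varphi)$ exists for every MSO sentence $\varphi$; (3) $\overline{\{\lim_{n\to\infty}\Pr(G_n\models\varphi):\varphi\text{ an MSO sentence}\}}=[0,1]$, the bar denoting topological closure.
   Context: MSO is monadic second-order logic of graphs: first-order logic (vertex variables, $=$, adjacency) enriched with quantification over sets of vertices and membership. *)

theory Defs
  imports "HOL-Probability.Probability"
begin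

section \<open>Graphs, paths and forests of paths\<close>

text \<open>A graph is a pair of a vertex set and a set of undirected edges, each a two-element set
  of vertices.\<close>

type_synonym 'a graph = "'a set \<times> 'a set set"

definition verts :: "'a graph \<Rightarrow> 'a set" where
  "verts G = fst G"

definition edges :: "'a graph \<Rightarrow> 'a set set" where
  "edges G = snd G"

definition simple_graph :: "'a graph \<Rightarrow> bool" where
  "simple_graph G \<longleftrightarrow> (\<forall>e\<in>edges G. e \<subseteq> verts G \<and> card e = 2)"

definition adjacent :: "'a graph \<Rightarrow> 'a \<Rightarrow> 'a \<Rightarrow> bool" where
  "adjacent G u v \<longleftrightarrow> {u, v} \<in> edges G"

definition induced_subgraph :: "'a graph \<Rightarrow> 'a set \<Rightarrow> 'a graph" where
  "induced_subgraph G W = (W, {e \<in> edges G. e \<subseteq> W})"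

definition reachability :: "'a graph \<Rightarrow> ('a \<times> 'a) set" where
  "reachability G = {(u, v). u \<in> verts G \<and> v \<in> verts G \<and> (adjacent G)\<^sup>*\<^sup>* u v}"

definition components :: "'a graph \<Rightarrow> 'a graph set" where
  "components G = induced_subgraph G ` (verts G // reachability G)"

text \<open>A single vertex is a path (of length zero); the graph without vertices is not.\<close>

definition is_path :: "'a graph \<Rightarrow> bool" where
  "is_path G \<longleftrightarrow> (\<exists>xs. xs \<noteq> [] \<and> distinct xs \<and> verts G = set xs \<and>
     edges G = {{xs ! i, xs ! Suc i} | i. Suc i < length xs})"

definition forest_of_paths :: "'a graph \<Rightarrow> bool" where
  "forest_of_paths G \<longleftrightarrow> simple_graph G \<and> (\<forall>H\<in>components G. is_path H)"

section \<open>Monadic second-order logic of graphs\<close>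

text \<open>Vertex variables and set variables are two separate sorts, each named by natural
  numbers: in \<open>Mem x X\<close> the number \<open>x\<close> names a vertex variable and \<open>X\<close> a set variable.
  The remaining connectives and the universal quantifiers are the usual abbreviations.\<close>

datatype mso =
    Eq nat nat
  | Adj nat nat
  | Mem nat nat
  | Neg mso
  | Conj mso mso
  | ExV nat mso
  | ExS nat mso

fun free_vertex_vars :: "mso \<Rightarrow> nat set" where
  "free_vertex_vars (Eq x y) = {x, y}"
| "free_vertex_vars (Adj x y) = {x, y}"
| "free_vertex_vars (Mem x X) = {x}"
| "free_vertex_vars (Neg \<phi>) = free_vertex_vars \<phi>"
| "free_vertex_vars (Conj \<phi> \<psi>) = free_vertex_vars \<phi> \<union> free_vertex_vars \<psi>"
| "free_vertex_vars (ExV x \<phi>) = free_vertex_vars \<phi> - {x}"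
| "free_vertex_vars (ExS X \<phi>) = free_vertex_vars \<phi>"

fun free_set_vars :: "mso \<Rightarrow> nat set" where
  "free_set_vars (Eq x y) = {}"
| "free_set_vars (Adj x y) = {}"
| "free_set_vars (Mem x X) = {X}"
| "free_set_vars (Neg \<phi>) = free_set_vars \<phi>"
| "free_set_vars (Conj \<phi> \<psi>) = free_set_vars \<phi> \<union> free_set_vars \<psi>"
| "free_set_vars (ExV x \<phi>) = free_set_vars \<phi>"
| "free_set_vars (ExS X \<phi>) = free_set_vars \<phi> - {X}"

definition mso_sentence :: "mso \<Rightarrow> bool" where
  "mso_sentence \<phi> \<longleftrightarrow> free_vertex_vars \<phi> = {} \<and> free_set_vars \<phi> = {}"

fun satisfies :: "'a graph \<Rightarrow> (nat \<Rightarrow> 'a) \<Rightarrow> (nat \<Rightarrow> 'a set) \<Rightarrow> mso \<Rightarrow> bool" where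
  "satisfies G s S (Eq x y) \<longleftrightarrow> s x = s y"
| "satisfies G s S (Adj x y) \<longleftrightarrow> adjacent G (s x) (s y)"
| "satisfies G s S (Mem x X) \<longleftrightarrow> s x \<in> S X"
| "satisfies G s S (Neg \<phi>) \<longleftrightarrow> \<not> satisfies G s S \<phi>"
| "satisfies G s S (Conj \<phi> \<psi>) \<longleftrightarrow> satisfies G s S \<phi> \<and> satisfies G s S \<psi>"
| "satisfies G s S (ExV x \<phi>) \<longleftrightarrow> (\<exists>v\<in>verts G. satisfies G (s(x := v)) S \<phi>)"
| "satisfies G s S (ExS X \<phi>) \<longleftrightarrow> (\<exists>W\<subseteq>verts G. satisfies G s (S(X := W)) \<phi>)"

lemma satisfies_cong:
  assumes "\<And>x. x \<in> free_vertex_vars \<phi> \<Longrightarrow> s x = s' x"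
    and "\<And>X. X \<in> free_set_vars \<phi> \<Longrightarrow> S X = S' X"
  shows "satisfies G s S \<phi> \<longleftrightarrow> satisfies G s' S' \<phi>"
  using assms
proof (induction \<phi> arbitrary: s s' S S')
  case (Neg \<phi>)
  have "satisfies G s S \<phi> \<longleftrightarrow> satisfies G s' S' \<phi>"
    by (rule Neg.IH) (use Neg.prems in auto)
  then show ?case by simp
next
  case (Conj \<phi> \<psi>)
  have "satisfies G s S \<phi> \<longleftrightarrow> satisfies G s' S' \<phi>"
    by (rule Conj.IH(1)) (use Conj.prems in auto)
  moreover have "satisfies G s S \<psi> \<longleftrightarrow> satisfies G s' S' \<psi>"
    by (rule Conj.IH(2)) (use Conj.prems in auto)
  ultimately show ?case by simp
next
  case (ExV x \<phi>)
  have "satisfies G (s(x := v)) S \<phi> \<longleftrightarrow> satisfies G (s'(x := v)) S' \<phi>" for v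
    by (rule ExV.IH) (use ExV.prems in auto)
  then show ?case by simp
next
  case (ExS X \<phi>)
  have "satisfies G s (S(X := W)) \<phi> \<longleftrightarrow> satisfies G s' (S'(X := W)) \<phi>" for W
    by (rule ExS.IH) (use ExS.prems in auto)
  then show ?case by simp
qed auto

text \<open>For sentences the assignments are immaterial, by the preceding lemma.\<close>

definition models :: "'a graph \<Rightarrow> mso \<Rightarrow> bool" where
  "models G \<phi> \<longleftrightarrow> (\<forall>s S. satisfies G s S \<phi>)"

section \<open>Random graphs and limit laws\<close>

definition paths_on :: "nat \<Rightarrow> nat graph set" where
  "paths_on n = {G. verts G = {1..n} \<and> is_path G}"

definition path_forests_on :: "nat \<Rightarrow> nat graph set" where
  "path_forests_on n = {G. verts G = {1..n} \<and> forest_of_paths G}"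

lemma finite_path_forests_on: "finite (path_forests_on n)"
proof (rule finite_subset)
  show "path_forests_on n \<subseteq> {{1..n}} \<times> Pow (Pow {1..n})"
    by (fastforce simp: path_forests_on_def forest_of_paths_def simple_graph_def verts_def edges_def)
qed simp

lemma finite_paths_on: "finite (paths_on n)"
proof (rule finite_subset)
  show "paths_on n \<subseteq> {{1..n}} \<times> Pow (Pow {1..n})"
    by (fastforce simp: paths_on_def is_path_def verts_def edges_def)
qed simp

lemma paths_on_nonempty: "n \<ge> 1 \<Longrightarrow> paths_on n \<noteq> {}"
proof -
  assume n: "n \<ge> 1"
  let ?xs = "[1..<Suc n]"
  have "distinct ?xs" "?xs \<noteq> []" "set ?xs = {1..n}"
    using n by (auto simp del: upt_Suc)
  then have "({1..n}, {{?xs ! i, ?xs ! Suc i} | i. Suc i < length ?xs}) \<in> paths_on n"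
    unfolding paths_on_def is_path_def verts_def edges_def mem_Collect_eq fst_conv snd_conv by blast
  then show ?thesis by blast
qed

lemma path_forests_on_nonempty: "path_forests_on n \<noteq> {}"
proof -
  let ?G = "({1..n}, {}) :: nat graph"
  have "(adjacent ?G)\<^sup>*\<^sup>* u v \<longleftrightarrow> u = v" for u v
    by (metis adjacent_def edges_def empty_iff rtranclp.cases rtranclp.rtrancl_refl snd_conv)
  then have "reachability ?G = Id_on {1..n}"
    by (auto simp: reachability_def verts_def)
  then have "components ?G = (\<lambda>v. ({v}, {})) ` {1..n}"
    by (auto simp: components_def quotient_def induced_subgraph_def verts_def edges_def)
  moreover have "is_path ({v}, {})" for v :: nat
    unfolding is_path_def by (intro exI[of _ "[v]"]) (simp add: verts_def edges_def)
  ultimately have "?G \<in> path_forests_on n"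
    by (auto simp: path_forests_on_def forest_of_paths_def simple_graph_def verts_def edges_def)
  then show ?thesis by blast
qed

text \<open>There is no path on zero vertices, so \<open>random_path 0\<close> is an unspecified distribution; it
  does not influence limits.\<close>

definition random_path :: "nat \<Rightarrow> nat graph pmf" where
  "random_path n = pmf_of_set (paths_on n)"

definition random_path_forest :: "nat \<Rightarrow> nat graph pmf" where
  "random_path_forest n = pmf_of_set (path_forests_on n)"

definition prob_models :: "'a graph pmf \<Rightarrow> mso \<Rightarrow> real" where
  "prob_models p \<phi> = measure_pmf.prob p {G. models G \<phi>}"

definition mso_convergence_law :: "(nat \<Rightarrow> 'a graph pmf) \<Rightarrow> bool" where
  "mso_convergence_law G \<longleftrightarrow>
     (\<forall>\<phi>. mso_sentence \<phi> \<longrightarrow> convergent (\<lambda>n. prob_models (G n) \<phi>))"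

end

theory Submission
  imports Defs "HOL-Real_Asymp.Real_Asymp"
begin

text \<open>A forest of paths is a disjoint union, so by induction on the formula the truth of a sentence
  only depends, up to a threshold, on how many components lie in each of finitely many classes of
  labelled paths: a set quantifier replaces the class of a component by the set of classes that its
  expansions can have, and a component class occurring often enough offers every choice often
  enough. For a sentence the class of a component is a function of its number of vertices.

  Let \<open>n! g\<^sub>n\<close> be the number of forests of paths on \<open>n\<close> vertices; the \<open>g\<^sub>n\<close> have generating function
  \<open>exp (z + z\<^sup>2 / (2 (1 - z)))\<close> and the ratios \<open>g\<^sub>n\<^sub>-\<^sub>1 / g\<^sub>n\<close> tend to \<open>1\<close>. Hence the numbers of components
  with \<open>1, 2, \<dots>, K\<close> vertices converge jointly to independent Poisson variables with means
  \<open>1, 1/2, \<dots>, 1/2\<close>. A class containing infinitely many sizes therefore gets arbitrarily many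
  components with high probability, and the remaining classes are settled by the limit law; this
  gives convergence. The sentences ``some component has exactly \<open>k\<close> vertices'' become independent
  events in the limit, whose atoms are small, so sums of atoms are dense in \<open>[0, 1]\<close>.

  On a single path, a set that alternates along the edges tells the two ends apart exactly if the
  number of vertices is even.\<close>

section \<open>Capped counts\<close>

text \<open>A set quantifier acts on all components at once, while only truncated class counts are
  known. If there are q labels and label counts must be matched up to T, it suffices to know the
  unlabelled counts up to T * q: below that bound components are matched one to one, above it some
  label is used at least T times and absorbs any surplus. Thresholds grow with each quantifier but
  stay finite, and classes may be arbitrary functions of finite range, so no automata enter. Parity,
  fatal for a single path, is harmless in forests: there are infinitely many sizes of either parity,
  so both kinds of component abound. Precise asymptotics of g_n are avoided; only its monotonicity
  and the ratio limit are used. Forbidding components with at most K vertices multiplies the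
  generating function by an entire function, and the coefficients of the product, divided by g_n,
  tend to the value of that function at 1. This value is the probability that all K Poisson
  variables vanish; an exact product formula for prescribed numbers of small components then yields
  every other atom.\<close>

lemma capped_shrink:
  fixes f :: "'x \<Rightarrow> 'q"
  assumes "finite A" "finite Q" "f ` A \<subseteq> Q" "T * card Q \<le> n" "n \<le> card A"
  shows "\<exists>A0\<subseteq>A. card A0 = n \<and>
    (\<forall>q. min T (card {x\<in>A. f x = q}) = min T (card {x\<in>A0. f x = q}))"
  using assms(1,3,5)
proof (induction "card A - n" arbitrary: A)
  case 0
  then show ?case by (intro exI[of _ A]) auto
next
  case (Suc k)
  \<comment> \<open>Pigeonhole: here \<open>n < card A\<close>, so \<open>A\<close> has more than
    \<open>T * card Q\<close> elements and some fibre exceeds \<open>T\<close>. Deleting one of its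
    elements leaves its truncated count at \<open>T\<close>.\<close>
  have "\<exists>q\<in>Q. card {x\<in>A. f x = q} > T"
  proof (rule ccontr)
    assume "\<not> (\<exists>q\<in>Q. card {x\<in>A. f x = q} > T)"
    then have "card {x\<in>A. f x = q} \<le> T" if "q \<in> Q" for q
      using that by force
    then have "(\<Sum>q\<in>Q. card {x\<in>A. f x = q}) \<le> (\<Sum>q\<in>Q. T)"
      by (intro sum_mono)
    moreover have "card A = (\<Sum>q\<in>Q. card {x\<in>A. f x = q})"
      using sum.group[OF Suc.prems(1) assms(2) Suc.prems(2), of "\<lambda>_. 1::nat"] by simp
    ultimately show False
      using assms(4) Suc.hyps(2) by (simp add: mult.commute)
  qed
  then obtain q where q: "card {x\<in>A. f x = q} > T" by blast
  then obtain a where a: "a \<in> A" "f a = q"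
    by (metis (mono_tags, lifting) Collect_empty_eq card.empty not_less0)
  have "k = card (A - {a}) - n" "n \<le> card (A - {a})"
    using a Suc.hyps(2) Suc.prems by auto
  then obtain A0 where A0: "A0 \<subseteq> A - {a}" "card A0 = n"
    "\<And>q. min T (card {x\<in>A - {a}. f x = q}) = min T (card {x\<in>A0. f x = q})"
    using Suc.hyps(1)[of "A - {a}"] Suc.prems by auto
  have "min T (card {x\<in>A. f x = p}) = min T (card {x\<in>A - {a}. f x = p})" for p
  proof (cases "p = q")
    case True
    have "{x\<in>A - {a}. f x = q} = {x\<in>A. f x = q} - {a}" by auto
    then show ?thesis
      using a q True Suc.prems(1) by (simp add: card_Diff_singleton_if)
  next
    case False
    then have "{x\<in>A - {a}. f x = p} = {x\<in>A. f x = p}" using a by auto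
    then show ?thesis by simp
  qed
  then show ?case using A0 by (intro exI[of _ A0]) auto
qed

text \<open>Pigeonhole gives a label \<open>q0\<close> that \<open>f\<close> uses at least
  \<open>T\<close> times. An injection copies \<open>f\<close> into \<open>B\<close>, and the
  surplus elements of \<open>B\<close> receive \<open>q0\<close>, whose truncated count cannot
  change.\<close>

lemma capped_extend:
  fixes f :: "'x \<Rightarrow> 'q" and B :: "'y set"
  assumes "finite A" "finite B" "finite Q" "Q \<noteq> {}" "f ` A \<subseteq> Q" "0 < T"
    "T * card Q \<le> card A" "card A \<le> card B"
  shows "\<exists>g. g ` B \<subseteq> f ` A \<and>
    (\<forall>q. min T (card {x\<in>A. f x = q}) = min T (card {y\<in>B. g y = q}))"
proof -
  have "\<exists>q\<in>Q. card {x\<in>A. f x = q} \<ge> T"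
  proof (rule ccontr)
    assume "\<not> (\<exists>q\<in>Q. card {x\<in>A. f x = q} \<ge> T)"
    then have "card {x\<in>A. f x = q} < T" if "q \<in> Q" for q
      using that by force
    then have "(\<Sum>q\<in>Q. card {x\<in>A. f x = q}) < (\<Sum>q\<in>Q. T)"
      using assms by (intro sum_strict_mono) auto
    moreover have "card A = (\<Sum>q\<in>Q. card {x\<in>A. f x = q})"
      using sum.group[OF assms(1,3,5), of "\<lambda>_. 1::nat"] by simp
    ultimately show False
      using assms by (simp add: mult.commute)
  qed
  then obtain q0 where q0: "card {x\<in>A. f x = q0} \<ge> T" by blast
  then obtain x0 where x0: "x0 \<in> A" "f x0 = q0"
    using \<open>0 < T\<close> by (metis (mono_tags, lifting) Collect_empty_eq card.empty not_less)
  obtain h where h: "h ` A \<subseteq> B" "inj_on h A"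
    using card_le_inj[OF assms(1,2,8)] by blast
  define g where "g y = (if y \<in> h ` A then f (the_inv_into A h y) else q0)" for y
  have gh: "g (h x) = f x" if "x \<in> A" for x
    using that h by (auto simp: g_def the_inv_into_f_f)
  have "min T (card {x\<in>A. f x = q}) = min T (card {y\<in>B. g y = q})" for q
  proof -
    have img: "card (h ` {x\<in>A. f x = q}) = card {x\<in>A. f x = q}"
      by (rule card_image) (use h in \<open>auto simp: inj_on_def\<close>)
    have sub: "h ` {x\<in>A. f x = q} \<subseteq> {y\<in>B. g y = q}"
      using h gh by auto
    show ?thesis
    proof (cases "q = q0")
      case True
      have "card {x\<in>A. f x = q} \<le> card {y\<in>B. g y = q}"
        using card_mono[OF _ sub] img assms(2) by simp
      then show ?thesis using True q0 by simp
    next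
      case False
      then have "{y\<in>B. g y = q} \<subseteq> h ` {x\<in>A. f x = q}"
        using gh by (auto simp: g_def split: if_splits)
      with sub have "{y\<in>B. g y = q} = h ` {x\<in>A. f x = q}" by blast
      then show ?thesis using img by simp
    qed
  qed
  moreover have "g ` B \<subseteq> f ` A"
    using gh x0 by (auto simp: g_def split: if_splits)
  ultimately show ?thesis by blast
qed

text \<open>The two sizes are equal or both at least \<open>T * card Q\<close>; in the second case
  \<open>A\<close> is cut down to the size of \<open>B\<close>, or \<open>f\<close> is extended to
  the larger \<open>B\<close>. Using only values of \<open>f\<close> guarantees later that a
  component can really carry the label assigned to it.\<close>

lemma capped_transfer:
  fixes f :: "'x \<Rightarrow> 'q" and B :: "'y set"
  assumes "finite A" "finite B" "finite Q" "Q \<noteq> {}" "f ` A \<subseteq> Q" "0 < T"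
    "min (T * card Q) (card A) = min (T * card Q) (card B)"
  shows "\<exists>g. g ` B \<subseteq> f ` A \<and>
    (\<forall>q. min T (card {x\<in>A. f x = q}) = min T (card {y\<in>B. g y = q}))"
proof (cases "card B \<le> card A")
  case True
  obtain A0 where A0: "A0 \<subseteq> A" "card A0 = card B"
    "\<And>q. min T (card {x\<in>A. f x = q}) = min T (card {x\<in>A0. f x = q})"
  proof (cases "card B = card A")
    case True
    then show ?thesis using that by auto
  next
    case False
    then have "T * card Q \<le> card B" using assms(7) True by linarith
    then show ?thesis using capped_shrink[of A Q f T "card B"] assms that True by blast
  qed
  obtain h where h: "bij_betw h B A0"
    using A0 assms finite_same_card_bij[of B A0] finite_subset by metis
  have "card {x\<in>A0. f x = q} = card {y\<in>B. (f \<circ> h) y = q}" for q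
  proof -
    have "{x\<in>A0. f x = q} = h ` {y\<in>B. (f \<circ> h) y = q}"
      using h by (auto simp: bij_betw_def)
    moreover have "inj_on h {y\<in>B. (f \<circ> h) y = q}"
      using h by (auto simp: bij_betw_def inj_on_def)
    ultimately show ?thesis by (simp add: card_image)
  qed
  moreover have "(f \<circ> h) ` B \<subseteq> f ` A"
    using h A0 by (auto simp: bij_betw_def)
  ultimately show ?thesis using A0 by (intro exI[of _ "f \<circ> h"]) simp
next
  case False
  then have "T * card Q \<le> card A" using assms(7) by linarith
  then show ?thesis using capped_extend[of A B Q f T] assms False by auto
qed

text \<open>Truncation is compatible with addition: \<open>min T (a + b)\<close> depends only on
  \<open>min T a\<close> and \<open>min T b\<close>.\<close>

lemma capped_sum_eq:
  fixes u v :: "'c \<Rightarrow> nat"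
  assumes "finite C" "\<And>c. c \<in> C \<Longrightarrow> min T (u c) = min T (v c)"
  shows "min T (sum u C) = min T (sum v C)"
  using assms
proof (induction C)
  case (insert c C)
  have "min T (u c) = min T (v c)" "min T (sum u C) = min T (sum v C)"
    using insert by auto
  then show ?case using insert.hyps by (auto simp: min_def split: if_splits)
qed simp

text \<open>The combinatorial content of a set quantifier: \<open>\<alpha>\<close> and
  \<open>\<beta>\<close> are the classes before, \<open>f\<close> the class after a set has been
  chosen. The transfer is made inside each class separately, so that \<open>y\<close> copies the
  label of some \<open>x\<close> of its own class, and the truncated label counts add up over the
  classes.\<close>

lemma capped_choice:
  fixes f :: "'x \<Rightarrow> 'q" and \<alpha> :: "'x \<Rightarrow> 'c" and \<beta> :: "'y \<Rightarrow> 'c"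
  assumes fin: "finite A" "finite B" and Q: "finite Q" "Q \<noteq> {}" "f ` A \<subseteq> Q" and T: "0 < T"
    and eq: "\<And>c. min (T * card Q) (card {x\<in>A. \<alpha> x = c}) = min (T * card Q) (card {y\<in>B. \<beta> y = c})"
  shows "\<exists>g. (\<forall>y\<in>B. \<exists>x\<in>A. \<alpha> x = \<beta> y \<and> g y = f x) \<and>
    (\<forall>q. min T (card {x\<in>A. f x = q}) = min T (card {y\<in>B. g y = q}))"
proof -
  define P where "P c g \<longleftrightarrow> g ` {y\<in>B. \<beta> y = c} \<subseteq> f ` {x\<in>A. \<alpha> x = c} \<and>
    (\<forall>q. min T (card {x\<in>{x\<in>A. \<alpha> x = c}. f x = q}) = min T (card {y\<in>{y\<in>B. \<beta> y = c}. g y = q}))"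
    for c and g :: "'y \<Rightarrow> 'q"
  have "\<exists>g. P c g" for c
    unfolding P_def by (rule capped_transfer[where Q = Q]) (use assms in auto)
  then obtain G where G: "\<And>c. P c (G c)" by metis
  define g where "g y = G (\<beta> y) y" for y
  have "\<exists>x\<in>A. \<alpha> x = \<beta> y \<and> g y = f x" if "y \<in> B" for y
    using G[of "\<beta> y"] that by (auto simp: P_def g_def)
  moreover have "min T (card {x\<in>A. f x = q}) = min T (card {y\<in>B. g y = q})" for q
  proof -
    let ?C = "\<alpha> ` A \<union> \<beta> ` B"
    have C: "finite ?C" using fin by simp
    have "card {x\<in>A. f x = q} = (\<Sum>c\<in>?C. card {x\<in>{x\<in>A. \<alpha> x = c}. f x = q})"
    proof -
      have "(\<Sum>c\<in>?C. card {x\<in>{x\<in>A. f x = q}. \<alpha> x = c}) = card {x\<in>A. f x = q}"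
        using sum.group[of "{x\<in>A. f x = q}" ?C \<alpha> "\<lambda>_. 1::nat"] fin C by auto
      moreover have "{x\<in>{x\<in>A. f x = q}. \<alpha> x = c} = {x\<in>{x\<in>A. \<alpha> x = c}. f x = q}" for c by auto
      ultimately show ?thesis by simp
    qed
    moreover have "card {y\<in>B. g y = q} = (\<Sum>c\<in>?C. card {y\<in>{y\<in>B. \<beta> y = c}. G c y = q})"
    proof -
      have "(\<Sum>c\<in>?C. card {y\<in>{y\<in>B. g y = q}. \<beta> y = c}) = card {y\<in>B. g y = q}"
        using sum.group[of "{y\<in>B. g y = q}" ?C \<beta> "\<lambda>_. 1::nat"] fin C by auto
      moreover have "{y\<in>{y\<in>B. g y = q}. \<beta> y = c} = {y\<in>{y\<in>B. \<beta> y = c}. G c y = q}" for c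
        by (auto simp: g_def)
      ultimately show ?thesis by simp
    qed
    moreover have "min T (\<Sum>c\<in>?C. card {x\<in>{x\<in>A. \<alpha> x = c}. f x = q}) =
        min T (\<Sum>c\<in>?C. card {y\<in>{y\<in>B. \<beta> y = c}. G c y = q})"
      by (rule capped_sum_eq[OF C]) (use G in \<open>auto simp: P_def\<close>)
    ultimately show ?thesis by simp
  qed
  ultimately show ?thesis by blast
qed

section \<open>Disjoint families of lists as forests of paths\<close>

definition path_edges :: "'a list \<Rightarrow> 'a set set" where
  "path_edges xs = {{xs ! i, xs ! Suc i} | i. Suc i < length xs}"

text \<open>Each component is kept as a list, in one of its two directions, so that a labelled
  component becomes a length with sets of positions and components on different vertices can be
  compared.\<close>

definition list_family :: "'a list set \<Rightarrow> bool" where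
  "list_family \<X> \<longleftrightarrow> finite \<X> \<and> (\<forall>xs\<in>\<X>. xs \<noteq> [] \<and> distinct xs) \<and>
     (\<forall>xs\<in>\<X>. \<forall>ys\<in>\<X>. xs \<noteq> ys \<longrightarrow> set xs \<inter> set ys = {})"

definition family_graph :: "'a list set \<Rightarrow> 'a graph" where
  "family_graph \<X> = (\<Union>(set ` \<X>), \<Union>(path_edges ` \<X>))"

lemma verts_family_graph [simp]: "verts (family_graph \<X>) = \<Union>(set ` \<X>)"
  by (simp add: verts_def family_graph_def)

lemma edges_family_graph [simp]: "edges (family_graph \<X>) = \<Union>(path_edges ` \<X>)"
  by (simp add: edges_def family_graph_def)

lemma adjacent_family_graph:
  "adjacent (family_graph \<X>) u v \<longleftrightarrow> (\<exists>xs\<in>\<X>. \<exists>i. Suc i < length xs \<and>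
     (xs ! i = u \<and> xs ! Suc i = v \<or> xs ! i = v \<and> xs ! Suc i = u))"
  unfolding adjacent_def edges_family_graph path_edges_def UN_iff mem_Collect_eq doubleton_eq_iff
  by (intro bex_cong refl iff_exI) auto

section \<open>Predicates decided by truncated class counts, and their closure properties\<close>

definition positions :: "'a list \<Rightarrow> (nat \<Rightarrow> 'a set) \<Rightarrow> nat \<Rightarrow> nat set" where
  "positions xs Z k = {i. i < length xs \<and> xs ! i \<in> Z k}"

definition class_count ::
    "(nat \<Rightarrow> (nat \<Rightarrow> nat set) \<Rightarrow> 'q) \<Rightarrow> 'a list set \<Rightarrow> (nat \<Rightarrow> 'a set) \<Rightarrow> 'q \<Rightarrow> nat" where
  "class_count h \<X> Z q = card {xs\<in>\<X>. h (length xs) (positions xs Z) = q}"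

text \<open>Finiteness of the range of \<open>h\<close> takes the place of a finite automaton. One
  implication suffices because the condition on the counts is symmetric in the two families.\<close>

definition recognized_by ::
    "(nat \<Rightarrow> (nat \<Rightarrow> nat set) \<Rightarrow> 'q) \<Rightarrow> nat \<Rightarrow> ('a list set \<Rightarrow> (nat \<Rightarrow> 'a set) \<Rightarrow> bool) \<Rightarrow> bool" where
  "recognized_by h T R \<longleftrightarrow> finite (range (case_prod h)) \<and>
     (\<forall>\<X> Z \<Y> Z'. list_family \<X> \<longrightarrow> list_family \<Y> \<longrightarrow>
        (\<forall>q. min T (class_count h \<X> Z q) = min T (class_count h \<Y> Z' q)) \<longrightarrow> R \<X> Z \<longrightarrow> R \<Y> Z')"

text \<open>Classes are named by natural numbers because their type cannot be quantified
  existentially.\<close>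

definition recognizable :: "('a list set \<Rightarrow> (nat \<Rightarrow> 'a set) \<Rightarrow> bool) \<Rightarrow> bool" where
  "recognizable R \<longleftrightarrow> (\<exists>h T. recognized_by (h :: _ \<Rightarrow> _ \<Rightarrow> nat) T R)"

lemma finite_class_sum:
  assumes "list_family \<X>" "finite C"
  shows "card {xs\<in>\<X>. h (length xs) (positions xs Z) \<in> C} = (\<Sum>q\<in>C. class_count h \<X> Z q)"
proof -
  have "card (\<Union>q\<in>C. {xs\<in>\<X>. h (length xs) (positions xs Z) = q}) = (\<Sum>q\<in>C. class_count h \<X> Z q)"
    unfolding class_count_def
    by (rule card_UN_disjoint) (use assms in \<open>auto simp: list_family_def\<close>)
  moreover have "(\<Union>q\<in>C. {xs\<in>\<X>. h (length xs) (positions xs Z) = q}) =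
      {xs\<in>\<X>. h (length xs) (positions xs Z) \<in> C}" by auto
  ultimately show ?thesis by simp
qed

text \<open>A class of \<open>h\<close> is a finite disjoint union of classes of the finer
  \<open>h'\<close>, so its truncated count is determined by theirs. Refining classes and raising
  thresholds lets two predicates share one classification.\<close>

lemma recognized_by_coarser:
  fixes h :: "nat \<Rightarrow> (nat \<Rightarrow> nat set) \<Rightarrow> 'q" and h' :: "nat \<Rightarrow> (nat \<Rightarrow> nat set) \<Rightarrow> 'r"
  assumes "recognized_by h T R" "finite (range (case_prod h'))" "T \<le> T'"
    and f: "\<And>n L. h n L = f (h' n L)"
  shows "recognized_by h' T' R"
proof -
  let ?Q = "range (case_prod h')"
  have sum: "class_count h \<X> Z q = (\<Sum>r\<in>{r\<in>?Q. f r = q}. class_count h' \<X> Z r)"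
    if "list_family \<X>" for \<X> :: "'a list set" and Z q
  proof -
    have "{xs\<in>\<X>. h (length xs) (positions xs Z) = q} =
        {xs\<in>\<X>. h' (length xs) (positions xs Z) \<in> {r\<in>?Q. f r = q}}"
      using f by (auto intro: range_eqI[of _ _ "(_, _)"])
    then show ?thesis
      using finite_class_sum[OF that, of "{r\<in>?Q. f r = q}" h' Z] assms(2)
      by (simp add: class_count_def)
  qed
  have "min T (class_count h \<X> Z q) = min T (class_count h \<Y> Z' q)"
    if "list_family \<X>" "list_family \<Y>"
      "\<forall>q. min T' (class_count h' \<X> Z q) = min T' (class_count h' \<Y> Z' q)"
    for \<X> \<Y> :: "'a list set" and Z Z' q
    unfolding sum[OF that(1)] sum[OF that(2)]
  proof (rule capped_sum_eq)
    show "min T (class_count h' \<X> Z c) = min T (class_count h' \<Y> Z' c)" for c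
      using that(3)[rule_format, of c] assms(3) by (auto simp: min_def split: if_splits)
  qed (use assms(2) in simp)
  then show ?thesis
    using assms(1,2) unfolding recognized_by_def by blast
qed

lemma recognized_by_recognizable:
  fixes h :: "nat \<Rightarrow> (nat \<Rightarrow> nat set) \<Rightarrow> 'q"
  assumes "recognized_by h T R"
  shows "recognizable R"
proof -
  let ?Q = "range (case_prod h)"
  have "finite ?Q" using assms by (simp add: recognized_by_def)
  then obtain e :: "'q \<Rightarrow> nat" where e: "inj_on e ?Q"
    using finite_imp_inj_to_nat_seg by metis
  have "range (case_prod (\<lambda>n L. e (h n L))) = e ` ?Q" by auto
  then have "recognized_by (\<lambda>n L. e (h n L)) T R"
    using e \<open>finite ?Q\<close>
  proof (intro recognized_by_coarser[OF assms, where f = "the_inv_into ?Q e"])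
    fix n L
    have "h n L \<in> ?Q" by (auto intro: range_eqI[of _ _ "(n, L)"])
    then show "h n L = the_inv_into ?Q e (e (h n L))"
      using e by (simp only: the_inv_into_f_f)
  qed auto
  then show ?thesis unfolding recognizable_def by blast
qed

lemma recognizable_conj:
  assumes "recognizable R" "recognizable R'"
  shows "recognizable (\<lambda>\<X> Z. R \<X> Z \<and> R' \<X> Z)"
proof -
  obtain h h' :: "nat \<Rightarrow> (nat \<Rightarrow> nat set) \<Rightarrow> nat" and T T'
    where h: "recognized_by h T R" "recognized_by h' T' R'"
    using assms unfolding recognizable_def by blast
  let ?h = "\<lambda>n L. (h n L, h' n L)"
  have "range (case_prod ?h) \<subseteq> range (case_prod h) \<times> range (case_prod h')"
    by (auto intro: range_eqI[of _ _ "(_, _)"])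
  then have fin: "finite (range (case_prod ?h))"
    using h by (meson finite_SigmaI finite_subset recognized_by_def)
  have "recognized_by ?h (max T T') R"
    by (rule recognized_by_coarser[OF h(1) fin, where f = fst]) auto
  moreover have "recognized_by ?h (max T T') R'"
    by (rule recognized_by_coarser[OF h(2) fin, where f = snd]) auto
  ultimately have "recognized_by ?h (max T T') (\<lambda>\<X> Z. R \<X> Z \<and> R' \<X> Z)"
    unfolding recognized_by_def by blast
  then show ?thesis by (rule recognized_by_recognizable)
qed

lemma recognizable_neg:
  assumes "recognizable R"
  shows "recognizable (\<lambda>\<X> Z. \<not> R \<X> Z)"
proof -
  obtain h :: "nat \<Rightarrow> (nat \<Rightarrow> nat set) \<Rightarrow> nat" and T where h: "recognized_by h T R"
    using assms unfolding recognizable_def by blast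
  have "recognized_by h T (\<lambda>\<X> Z. \<not> R \<X> Z)"
    unfolding recognized_by_def
  proof (intro conjI allI impI notI)
    show "finite (range (case_prod h))" using h by (simp add: recognized_by_def)
  next
    fix \<X> \<Y> :: "'a list set" and Z Z'
    assume *: "list_family \<X>" "list_family \<Y>"
      "\<forall>q. min T (class_count h \<X> Z q) = min T (class_count h \<Y> Z' q)" "\<not> R \<X> Z" "R \<Y> Z'"
    have "\<forall>q. min T (class_count h \<Y> Z' q) = min T (class_count h \<X> Z q)" using *(3) by simp
    with h *(1,2,5) have "R \<X> Z" unfolding recognized_by_def by blast
    with *(4) show False ..
  qed
  then show ?thesis unfolding recognizable_def by blast
qed

text \<open>The truth value of \<open>P\<close> serves as the class; threshold 1 detects whether the
  class \<open>True\<close> is inhabited.\<close>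

lemma recognizable_some_list:
  "recognizable (\<lambda>(\<X> :: 'a list set) Z. \<exists>xs\<in>\<X>. P (length xs) (positions xs Z))"
proof (rule recognized_by_recognizable[where h = P and T = 1])
  have pos: "(\<exists>xs\<in>\<X>. P (length xs) (positions xs Z)) \<longleftrightarrow> min 1 (class_count P \<X> Z True) = 1"
    if "list_family \<X>" for \<X> :: "'a list set" and Z
  proof -
    have "finite {xs\<in>\<X>. P (length xs) (positions xs Z) = True}"
      using that by (simp add: list_family_def)
    then have "(\<exists>xs\<in>\<X>. P (length xs) (positions xs Z)) \<longleftrightarrow> class_count P \<X> Z True \<noteq> 0"
      by (auto simp: class_count_def)
    then show ?thesis by (simp add: min_def)
  qed
  show "recognized_by P 1 (\<lambda>(\<X> :: 'a list set) Z. \<exists>xs\<in>\<X>. P (length xs) (positions xs Z))"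
    unfolding recognized_by_def
  proof (intro conjI allI impI)
    fix \<X> \<Y> :: "'a list set" and Z Z'
    assume "list_family \<X>" "list_family \<Y>"
      "\<forall>q. min 1 (class_count P \<X> Z q) = min 1 (class_count P \<Y> Z' q)"
      "\<exists>xs\<in>\<X>. P (length xs) (positions xs Z)"
    then show "\<exists>xs\<in>\<Y>. P (length xs) (positions xs Z')"
      by (simp only: pos)
  qed simp
qed

text \<open>The number of marked vertices on a list is recorded as 0, 1 or at least 2. Exactly one
  vertex is marked overall if and only if one list has class 1 and none has class 2, which threshold
  2 decides. This turns vertex quantifiers into set quantifiers.\<close>

lemma recognizable_singleton:
  "recognizable (\<lambda>(\<X> :: 'a list set) Z. card (Z k \<inter> \<Union>(set ` \<X>)) = 1)"
proof (rule recognized_by_recognizable[where h = "\<lambda>n L. min 2 (card (L k))" and T = 2])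
  let ?h = "\<lambda>n L. min 2 (card (L k))"
  have fin: "range (case_prod (\<lambda>(n::nat) L. min 2 (card ((L :: nat \<Rightarrow> nat set) k)))) \<subseteq> {..2}" by auto
  have count: "card (Z k \<inter> \<Union>(set ` \<X>)) = (\<Sum>xs\<in>\<X>. card (positions xs Z k))"
    if "list_family \<X>" for \<X> :: "'a list set" and Z
  proof -
    have "card (\<Union>xs\<in>\<X>. Z k \<inter> set xs) = (\<Sum>xs\<in>\<X>. card (Z k \<inter> set xs))"
      by (rule card_UN_disjoint) (use that in \<open>auto simp: list_family_def\<close>)
    moreover have "(\<Union>xs\<in>\<X>. Z k \<inter> set xs) = Z k \<inter> \<Union>(set ` \<X>)" by blast
    ultimately have "card (Z k \<inter> \<Union>(set ` \<X>)) = (\<Sum>xs\<in>\<X>. card (Z k \<inter> set xs))" by simp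
    also have "\<dots> = (\<Sum>xs\<in>\<X>. card (positions xs Z k))"
    proof (rule sum.cong)
      fix xs assume "xs \<in> \<X>"
      then have "distinct xs" using that by (simp add: list_family_def)
      then have "inj_on ((!) xs) (positions xs Z k)"
        by (auto simp: inj_on_def positions_def nth_eq_iff_index_eq)
      moreover have "(!) xs ` positions xs Z k = Z k \<inter> set xs"
        by (auto simp: positions_def in_set_conv_nth)
      ultimately show "card (Z k \<inter> set xs) = card (positions xs Z k)"
        by (metis card_image)
    qed simp
    finally show ?thesis .
  qed
  have one: "card (Z k \<inter> \<Union>(set ` \<X>)) = 1 \<longleftrightarrow>
      min 2 (class_count ?h \<X> Z 1) = 1 \<and> min 2 (class_count ?h \<X> Z 2) = 0"
    if "list_family \<X>" for \<X> :: "'a list set" and Z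
  proof -
    have finX: "finite \<X>" using that by (simp add: list_family_def)
    have c2: "class_count ?h \<X> Z 2 = 0 \<longleftrightarrow> (\<forall>xs\<in>\<X>. card (positions xs Z k) \<le> 1)"
    proof -
      have "min 2 m = 2 \<longleftrightarrow> \<not> m \<le> 1" for m :: nat by auto
      then show ?thesis using finX by (auto simp: class_count_def)
    qed
    have "class_count ?h \<X> Z 1 = card (Z k \<inter> \<Union>(set ` \<X>))"
      if le: "\<forall>xs\<in>\<X>. card (positions xs Z k) \<le> 1"
    proof -
      have "(\<Sum>xs\<in>\<X>. card (positions xs Z k)) = (\<Sum>xs\<in>\<X>. if min 2 (card (positions xs Z k)) = 1 then 1 else 0)"
        by (rule sum.cong) (use le in \<open>force simp: min_def\<close>)+
      also have "\<dots> = class_count ?h \<X> Z 1"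
        using finX by (simp add: class_count_def flip: sum.inter_filter)
      finally show ?thesis by (simp only: count[OF \<open>list_family \<X>\<close>])
    qed
    moreover have "\<forall>xs\<in>\<X>. card (positions xs Z k) \<le> 1" if "card (Z k \<inter> \<Union>(set ` \<X>)) = 1"
    proof
      fix xs assume "xs \<in> \<X>"
      then have "card (positions xs Z k) \<le> (\<Sum>xs\<in>\<X>. card (positions xs Z k))"
        using finX by (intro member_le_sum) auto
      moreover have "(\<Sum>xs\<in>\<X>. card (positions xs Z k)) = 1"
        by (rule trans[OF count[OF \<open>list_family \<X>\<close>, of Z, symmetric] that])
      ultimately show "card (positions xs Z k) \<le> 1" by (rule ord_le_eq_trans)
    qed
    ultimately show ?thesis using c2 by (auto simp: min_def)
  qed
  show "recognized_by ?h 2 (\<lambda>(\<X> :: 'a list set) Z. card (Z k \<inter> \<Union>(set ` \<X>)) = 1)"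
    unfolding recognized_by_def
  proof (intro conjI allI impI)
    fix \<X> \<Y> :: "'a list set" and Z Z'
    assume *: "list_family \<X>" "list_family \<Y>"
      "\<forall>q. min 2 (class_count ?h \<X> Z q) = min 2 (class_count ?h \<Y> Z' q)"
      "card (Z k \<inter> \<Union>(set ` \<X>)) = 1"
    have "min 2 (class_count ?h \<X> Z 1) = 1" "min 2 (class_count ?h \<X> Z 2) = 0"
      using one[OF *(1), of Z] *(4) by blast+
    then have "min 2 (class_count ?h \<Y> Z' 1) = 1" "min 2 (class_count ?h \<Y> Z' 2) = 0"
      using *(3) by metis+
    then show "card (Z' k \<inter> \<Union>(set ` \<Y>)) = 1" using one[OF *(2), of Z'] by blast
  qed (use finite_subset[OF fin] in auto)
qed

text \<open>A subset construction: the new class of a list is the set of old classes attainable by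
  choosing a set of its positions. \<open>capped_choice\<close>, with the old class as label,
  carries a witness \<open>W\<close> on one family to attainable labels on the other; the position
  sets attaining them are glued to a witness there. The threshold is multiplied by the number of old
  classes.\<close>

lemma recognizable_ex_set:
  assumes "recognizable R"
  shows "recognizable (\<lambda>\<X> Z. \<exists>W\<subseteq>\<Union>(set ` \<X>). R \<X> (Z(k := W)))"
proof -
  obtain h0 :: "nat \<Rightarrow> (nat \<Rightarrow> nat set) \<Rightarrow> nat" and T0 where h0: "recognized_by h0 T0 R"
    using assms unfolding recognizable_def by blast
  define h where "h = h0"
  \<comment> \<open>The successor makes the threshold positive, as \<open>capped_choice\<close>
    requires.\<close>
  define T where "T = Suc T0"
  have h: "recognized_by h T R"
    unfolding h_def T_def
    by (rule recognized_by_coarser[OF h0, where f = id])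
      (use h0 in \<open>auto simp: recognized_by_def\<close>)
  define Q where "Q = range (case_prod h)"
  have Q: "finite Q" "Q \<noteq> {}" using h by (auto simp: Q_def recognized_by_def)
  have hQ: "h n L \<in> Q" for n L
    unfolding Q_def by (rule range_eqI[of _ _ "(n, L)"]) simp
  define h' where "h' n L = (\<lambda>V. h n (L(k := V))) ` Pow {..<n}" for n L
  have "range (case_prod h') \<subseteq> Pow Q"
    using hQ by (auto simp: h'_def)
  then have fin: "finite (range (case_prod h'))"
    using Q(1) by (simp add: finite_subset)
  have "recognized_by h' (T * card Q) (\<lambda>\<X> Z. \<exists>W\<subseteq>\<Union>(set ` \<X>). R \<X> (Z(k := W)))"
    unfolding recognized_by_def
  proof (intro conjI allI impI)
    fix \<X> \<Y> :: "'a list set" and Z Z'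
    assume fam: "list_family \<X>" "list_family \<Y>"
      and eq: "\<forall>q. min (T * card Q) (class_count h' \<X> Z q) = min (T * card Q) (class_count h' \<Y> Z' q)"
      and "\<exists>W\<subseteq>\<Union>(set ` \<X>). R \<X> (Z(k := W))"
    then obtain W where W: "W \<subseteq> \<Union>(set ` \<X>)" "R \<X> (Z(k := W))" by blast
    define f where "f xs = h (length xs) (positions xs (Z(k := W)))" for xs
    have finXY: "finite \<X>" "finite \<Y>" using fam by (auto simp: list_family_def)
    obtain g where g: "\<forall>ys\<in>\<Y>. \<exists>xs\<in>\<X>.
          h' (length xs) (positions xs Z) = h' (length ys) (positions ys Z') \<and> g ys = f xs"
        "\<forall>q. min T (card {xs\<in>\<X>. f xs = q}) = min T (card {ys\<in>\<Y>. g ys = q})"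
    proof -
      have "f ` \<X> \<subseteq> Q" "0 < T" using hQ by (auto simp: f_def T_def)
      moreover have "min (T * card Q) (card {xs\<in>\<X>. h' (length xs) (positions xs Z) = c}) =
          min (T * card Q) (card {ys\<in>\<Y>. h' (length ys) (positions ys Z') = c})" for c
        using eq unfolding class_count_def by blast
      ultimately show thesis
        using capped_choice[OF finXY Q, of f T "\<lambda>xs. h' (length xs) (positions xs Z)"
          "\<lambda>ys. h' (length ys) (positions ys Z')"] that by blast
    qed
    have "\<exists>V\<subseteq>{..<length ys}. g ys = h (length ys) ((positions ys Z')(k := V))" if ys: "ys \<in> \<Y>" for ys
    proof -
      obtain xs where xs: "xs \<in> \<X>" "g ys = f xs"
        "h' (length xs) (positions xs Z) = h' (length ys) (positions ys Z')"
        using g ys by blast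
      have "positions xs (Z(k := W)) = (positions xs Z)(k := {i. i < length xs \<and> xs ! i \<in> W})"
        by (auto simp: positions_def fun_eq_iff)
      then have "f xs \<in> h' (length xs) (positions xs Z)"
        by (auto simp: f_def h'_def)
      then show ?thesis using xs by (auto simp: h'_def)
    qed
    then obtain V where V: "\<And>ys. ys \<in> \<Y> \<Longrightarrow> V ys \<subseteq> {..<length ys}"
        "\<And>ys. ys \<in> \<Y> \<Longrightarrow> g ys = h (length ys) ((positions ys Z')(k := V ys))"
      by metis
    define W' where "W' = (\<Union>ys\<in>\<Y>. (!) ys ` V ys)"
    have W'_sub: "W' \<subseteq> \<Union>(set ` \<Y>)"
      using V(1) by (force simp: W'_def)
    \<comment> \<open>Disjoint lists and distinct entries keep the pieces apart: an element of
      \<open>W'\<close> lying on \<open>ys\<close> can only come from \<open>V ys\<close>, at the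
      same position.\<close>
    have "positions ys (Z'(k := W')) = (positions ys Z')(k := V ys)" if ys: "ys \<in> \<Y>" for ys
    proof -
      have "i \<in> V ys" if i: "i < length ys" "ys ! i \<in> W'" for i
      proof -
        obtain zs j where zs: "zs \<in> \<Y>" "j \<in> V zs" "ys ! i = zs ! j"
          using i by (auto simp: W'_def)
        have j: "j < length zs" using zs V(1) by auto
        have "ys ! i \<in> set ys" "ys ! i \<in> set zs" using nth_mem[OF i(1)] nth_mem[OF j] zs(3) by simp_all
        then have "zs = ys" using fam(2) ys zs(1) by (auto simp: list_family_def)
        moreover have "distinct ys" using fam(2) ys by (simp add: list_family_def)
        ultimately have "i = j" using zs j i by (simp add: nth_eq_iff_index_eq)
        then show ?thesis using zs \<open>zs = ys\<close> by simp
      qed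
      moreover have "ys ! i \<in> W'" "i < length ys" if "i \<in> V ys" for i
        using that ys V(1) by (auto simp: W'_def)
      ultimately show ?thesis by (auto simp: positions_def fun_eq_iff)
    qed
    then have "{ys\<in>\<Y>. g ys = q} = {ys\<in>\<Y>. h (length ys) (positions ys (Z'(k := W'))) = q}" for q
      using V(2) by auto
    then have "\<forall>q. min T (class_count h \<X> (Z(k := W)) q) = min T (class_count h \<Y> (Z'(k := W')) q)"
      using g(2) by (simp add: class_count_def f_def)
    then have "R \<Y> (Z'(k := W'))"
      using h fam W(2) unfolding recognized_by_def by blast
    then show "\<exists>W\<subseteq>\<Union>(set ` \<Y>). R \<Y> (Z'(k := W))" using W'_sub by blast
  qed (rule fin)
  then show ?thesis by (rule recognized_by_recognizable)
qed

section \<open>From formulas to recognizable predicates\<close>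

text \<open>Vertex variables are stored as singletons at even indices and set variables at odd ones,
  so that one kind of quantifier, over sets, serves both sorts.\<close>

definition encode :: "(nat \<Rightarrow> 'a) \<Rightarrow> (nat \<Rightarrow> 'a set) \<Rightarrow> nat \<Rightarrow> 'a set" where
  "encode s S k = (if even k then {s (k div 2)} else S (k div 2))"

lemma encode_upd [simp]:
  "encode (s(x := v)) S = (encode s S)(2 * x := {v})"
  "encode s (S(X := W)) = (encode s S)(2 * X + 1 := W)"
  by (auto simp: encode_def fun_eq_iff)

lemma recognizable_common_vertex:
  "recognizable (\<lambda>\<X> Z. \<exists>xs\<in>\<X>. \<exists>i<length xs. xs ! i \<in> Z k \<and> xs ! i \<in> Z l)"
  using recognizable_some_list[of "\<lambda>_ L. L k \<inter> L l \<noteq> {}"]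
  by (simp add: positions_def Int_def conj_ac Bex_def)

lemma recognizable_adjacent:
  "recognizable (\<lambda>(\<X> :: 'a list set) Z. \<exists>xs\<in>\<X>. \<exists>i. Suc i < length xs \<and>
     (xs ! i \<in> Z k \<and> xs ! Suc i \<in> Z l \<or> xs ! i \<in> Z l \<and> xs ! Suc i \<in> Z k))"
proof -
  have "recognizable (\<lambda>(\<X> :: 'a list set) Z. \<exists>xs\<in>\<X>. \<exists>i. Suc i < length xs \<and>
     (i \<in> positions xs Z k \<and> Suc i \<in> positions xs Z l \<or> i \<in> positions xs Z l \<and> Suc i \<in> positions xs Z k))"
    using recognizable_some_list[of "\<lambda>n L. \<exists>i. Suc i < n \<and> (i \<in> L k \<and> Suc i \<in> L l \<or> i \<in> L l \<and> Suc i \<in> L k)"] .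
  moreover have "(Suc i < length xs \<and>
      (i \<in> positions xs Z k \<and> Suc i \<in> positions xs Z l \<or> i \<in> positions xs Z l \<and> Suc i \<in> positions xs Z k)) =
    (Suc i < length xs \<and> (xs ! i \<in> Z k \<and> xs ! Suc i \<in> Z l \<or> xs ! i \<in> Z l \<and> xs ! Suc i \<in> Z k))"
    for xs :: "'a list" and Z i
    by (auto simp: positions_def)
  ultimately show ?thesis by simp
qed

text \<open>The condition on \<open>s\<close> matters for the atoms: two equal values outside the
  graph satisfy \<open>Eq\<close>, yet leave no trace in any \<open>positions\<close>. Each
  connective is matched by one closure property; a vertex quantifier becomes a quantifier over sets
  meeting the vertex set in exactly one point.\<close>

lemma satisfies_recognizable:
  fixes \<phi> :: mso
  shows "\<exists>R. recognizable R \<and> (\<forall>(\<X> :: 'a list set) s S. list_family \<X> \<longrightarrow>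
    (\<forall>x\<in>free_vertex_vars \<phi>. s x \<in> \<Union>(set ` \<X>)) \<longrightarrow>
    (satisfies (family_graph \<X>) s S \<phi> \<longleftrightarrow> R \<X> (encode s S)))"
proof (induction \<phi>)
  case (Eq x y)
  show ?case
    by (intro exI[of _ "\<lambda>\<X> Z. \<exists>xs\<in>\<X>. \<exists>i<length xs. xs ! i \<in> Z (2 * x) \<and> xs ! i \<in> Z (2 * y)"]
        conjI recognizable_common_vertex) (fastforce simp: encode_def in_set_conv_nth)
next
  case (Mem x X)
  show ?case
    by (intro exI[of _ "\<lambda>\<X> Z. \<exists>xs\<in>\<X>. \<exists>i<length xs. xs ! i \<in> Z (2 * x) \<and> xs ! i \<in> Z (2 * X + 1)"]
        conjI recognizable_common_vertex) (fastforce simp: encode_def in_set_conv_nth)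
next
  case (Adj x y)
  show ?case
    by (intro exI[of _ "\<lambda>\<X> Z. \<exists>xs\<in>\<X>. \<exists>i. Suc i < length xs \<and>
     (xs ! i \<in> Z (2 * x) \<and> xs ! Suc i \<in> Z (2 * y) \<or> xs ! i \<in> Z (2 * y) \<and> xs ! Suc i \<in> Z (2 * x))"]
        conjI recognizable_adjacent)
      (simp add: encode_def adjacent_family_graph)
next
  case (Neg \<phi>)
  then obtain R :: "'a list set \<Rightarrow> (nat \<Rightarrow> 'a set) \<Rightarrow> bool" where R: "recognizable R"
    "\<And>\<X> s S. \<lbrakk>list_family \<X>; \<forall>x\<in>free_vertex_vars \<phi>. s x \<in> \<Union>(set ` \<X>)\<rbrakk> \<Longrightarrow>
      satisfies (family_graph \<X>) s S \<phi> \<longleftrightarrow> R \<X> (encode s S)" by metis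
  show ?case
    by (rule exI[of _ "\<lambda>\<X> Z. \<not> R \<X> Z"], intro conjI recognizable_neg[OF R(1)]) (use R(2) in auto)
next
  case (Conj \<phi> \<psi>)
  then obtain R R' :: "'a list set \<Rightarrow> (nat \<Rightarrow> 'a set) \<Rightarrow> bool" where R: "recognizable R"
    "\<And>\<X> s S. \<lbrakk>list_family \<X>; \<forall>x\<in>free_vertex_vars \<phi>. s x \<in> \<Union>(set ` \<X>)\<rbrakk> \<Longrightarrow>
      satisfies (family_graph \<X>) s S \<phi> \<longleftrightarrow> R \<X> (encode s S)"
    and R': "recognizable R'"
    "\<And>\<X> s S. \<lbrakk>list_family \<X>; \<forall>x\<in>free_vertex_vars \<psi>. s x \<in> \<Union>(set ` \<X>)\<rbrakk> \<Longrightarrow>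
      satisfies (family_graph \<X>) s S \<psi> \<longleftrightarrow> R' \<X> (encode s S)" by metis
  show ?case
    by (rule exI[of _ "\<lambda>\<X> Z. R \<X> Z \<and> R' \<X> Z"], intro conjI recognizable_conj[OF R(1) R'(1)])
      (use R(2) R'(2) in auto)
next
  case (ExV x \<phi>)
  then obtain R :: "'a list set \<Rightarrow> (nat \<Rightarrow> 'a set) \<Rightarrow> bool" where R: "recognizable R"
    "\<And>\<X> s S. \<lbrakk>list_family \<X>; \<forall>x\<in>free_vertex_vars \<phi>. s x \<in> \<Union>(set ` \<X>)\<rbrakk> \<Longrightarrow>
      satisfies (family_graph \<X>) s S \<phi> \<longleftrightarrow> R \<X> (encode s S)" by metis
  let ?R = "\<lambda>\<X> Z. \<exists>W\<subseteq>\<Union>(set ` \<X>). card ((Z(2 * x := W)) (2 * x) \<inter> \<Union>(set ` \<X>)) = 1 \<and> R \<X> (Z(2 * x := W))"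
  have "recognizable ?R"
    by (rule recognizable_ex_set[OF recognizable_conj[OF recognizable_singleton[of "2 * x"] R(1)], of "2 * x"])
  moreover have "satisfies (family_graph \<X>) s S (ExV x \<phi>) \<longleftrightarrow> ?R \<X> (encode s S)"
    if fam: "list_family \<X>" and fv: "\<forall>y\<in>free_vertex_vars (ExV x \<phi>). s y \<in> \<Union>(set ` \<X>)" for \<X> s S
  proof -
    have "satisfies (family_graph \<X>) s S (ExV x \<phi>) \<longleftrightarrow>
        (\<exists>v\<in>\<Union>(set ` \<X>). satisfies (family_graph \<X>) (s(x := v)) S \<phi>)" by simp
    also have "\<dots> \<longleftrightarrow> (\<exists>v\<in>\<Union>(set ` \<X>). R \<X> ((encode s S)(2 * x := {v})))"
    proof (rule bex_cong[OF refl])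
      fix v assume "v \<in> \<Union>(set ` \<X>)"
      then have "\<forall>y\<in>free_vertex_vars \<phi>. (s(x := v)) y \<in> \<Union>(set ` \<X>)" using fv by auto
      from R(2)[OF fam this, of S]
      show "satisfies (family_graph \<X>) (s(x := v)) S \<phi> \<longleftrightarrow> R \<X> ((encode s S)(2 * x := {v}))"
        unfolding encode_upd .
    qed
    also have "\<dots> \<longleftrightarrow> (\<exists>W\<subseteq>\<Union>(set ` \<X>). card (W \<inter> \<Union>(set ` \<X>)) = 1 \<and> R \<X> ((encode s S)(2 * x := W)))"
    proof -
      have 1: "card ({v} \<inter> \<Union>(set ` \<X>)) = 1" "{v} \<subseteq> \<Union>(set ` \<X>)" if "v \<in> \<Union>(set ` \<X>)" for v
        using that by (simp_all add: Int_absorb2)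
      have 2: "\<exists>v\<in>\<Union>(set ` \<X>). W = {v}"
        if "W \<subseteq> \<Union>(set ` \<X>)" "card (W \<inter> \<Union>(set ` \<X>)) = 1" for W
        using that by (metis Int_absorb2 card_1_singletonE insert_subset)
      show ?thesis
      proof
        assume "\<exists>v\<in>\<Union>(set ` \<X>). R \<X> ((encode s S)(2 * x := {v}))"
        then obtain v where "v \<in> \<Union>(set ` \<X>)" "R \<X> ((encode s S)(2 * x := {v}))" by blast
        with 1 show "\<exists>W\<subseteq>\<Union>(set ` \<X>). card (W \<inter> \<Union>(set ` \<X>)) = 1 \<and> R \<X> ((encode s S)(2 * x := W))"
          by meson
      next
        assume "\<exists>W\<subseteq>\<Union>(set ` \<X>). card (W \<inter> \<Union>(set ` \<X>)) = 1 \<and> R \<X> ((encode s S)(2 * x := W))"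
        then show "\<exists>v\<in>\<Union>(set ` \<X>). R \<X> ((encode s S)(2 * x := {v}))" using 2 by metis
      qed
    qed
    finally show ?thesis by (simp only: fun_upd_same)
  qed
  ultimately show ?case by blast
next
  case (ExS X \<phi>)
  then obtain R :: "'a list set \<Rightarrow> (nat \<Rightarrow> 'a set) \<Rightarrow> bool" where R: "recognizable R"
    "\<And>\<X> s S. \<lbrakk>list_family \<X>; \<forall>x\<in>free_vertex_vars \<phi>. s x \<in> \<Union>(set ` \<X>)\<rbrakk> \<Longrightarrow>
      satisfies (family_graph \<X>) s S \<phi> \<longleftrightarrow> R \<X> (encode s S)" by metis
  show ?case
    by (intro exI[of _ "\<lambda>\<X> Z. \<exists>W\<subseteq>\<Union>(set ` \<X>). R \<X> (Z(2 * X + 1 := W))"] conjI recognizable_ex_set[OF R(1)])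
      (use R(2) in auto)
qed

lemma models_sentence_iff:
  assumes "mso_sentence \<phi>"
  shows "models G \<phi> \<longleftrightarrow> satisfies G s S \<phi>"
proof -
  have "satisfies G s' S' \<phi> \<longleftrightarrow> satisfies G s S \<phi>" for s' S'
    by (rule satisfies_cong) (use assms in \<open>auto simp: mso_sentence_def\<close>)
  then show ?thesis unfolding models_def by blast
qed

text \<open>For a sentence the assignments can be chosen freely: vertex variables are sent to a
  natural number outside the finite vertex set, set variables to the empty set. All label sets on
  the lists are then empty, and the class depends on the length alone.\<close>

lemma models_class_count:
  assumes "mso_sentence \<phi>"
  obtains f :: "nat \<Rightarrow> nat" and T where "finite (range f)"
    "\<And>(\<X> :: nat list set) (\<Y> :: nat list set). \<lbrakk>list_family \<X>; list_family \<Y>;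
       \<forall>q. min T (card {xs\<in>\<X>. f (length xs) = q}) = min T (card {ys\<in>\<Y>. f (length ys) = q});
       models (family_graph \<X>) \<phi>\<rbrakk> \<Longrightarrow> models (family_graph \<Y>) \<phi>"
proof -
  obtain R :: "nat list set \<Rightarrow> (nat \<Rightarrow> nat set) \<Rightarrow> bool" where R: "recognizable R"
    "\<And>\<X> s S. \<lbrakk>list_family \<X>; \<forall>x\<in>free_vertex_vars \<phi>. s x \<in> \<Union>(set ` \<X>)\<rbrakk> \<Longrightarrow>
      satisfies (family_graph \<X>) s S \<phi> \<longleftrightarrow> R \<X> (encode s S)"
    using satisfies_recognizable[of \<phi>] by metis
  obtain h :: "nat \<Rightarrow> (nat \<Rightarrow> nat set) \<Rightarrow> nat" and T where h: "recognized_by h T R"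
    using R(1) unfolding recognizable_def by blast
  define f where "f l = h l (\<lambda>_. {})" for l
  have "range f \<subseteq> range (case_prod h)"
    by (auto simp: f_def intro: range_eqI[of _ _ "(_, _)"])
  then have fin: "finite (range f)"
    using h finite_subset unfolding recognized_by_def by blast
  have labels: "\<exists>Z. (models (family_graph \<X>) \<phi> \<longleftrightarrow> R \<X> Z) \<and>
      (\<forall>q. class_count h \<X> Z q = card {xs\<in>\<X>. f (length xs) = q})"
    if "list_family \<X>" for \<X>
  proof -
    have "finite (\<Union>(set ` \<X>))" using that by (simp add: list_family_def)
    then obtain v where v: "v \<notin> \<Union>(set ` \<X>)" using ex_new_if_finite infinite_UNIV_nat by blast
    let ?s = "\<lambda>_. v" and ?S = "\<lambda>_. {}"
    have "positions xs (encode ?s ?S) = (\<lambda>_. {})" if "xs \<in> \<X>" for xs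
      using v that by (force simp: positions_def encode_def fun_eq_iff)
    then have "{xs\<in>\<X>. h (length xs) (positions xs (encode ?s ?S)) = q} = {xs\<in>\<X>. f (length xs) = q}" for q
      by (auto simp: f_def)
    moreover have "models (family_graph \<X>) \<phi> \<longleftrightarrow> R \<X> (encode ?s ?S)"
      using R(2)[OF that, of ?s ?S] assms models_sentence_iff[OF assms, of _ ?s ?S]
      by (simp add: mso_sentence_def)
    ultimately show ?thesis
      by (intro exI[of _ "encode ?s ?S"]) (simp add: class_count_def)
  qed
  show thesis
  proof (rule that[OF fin, of T])
    fix \<X> \<Y> :: "nat list set"
    assume *: "list_family \<X>" "list_family \<Y>" "models (family_graph \<X>) \<phi>"
      "\<forall>q. min T (card {xs\<in>\<X>. f (length xs) = q}) = min T (card {ys\<in>\<Y>. f (length ys) = q})"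
    obtain Z Z' where "models (family_graph \<X>) \<phi> \<longleftrightarrow> R \<X> Z" "models (family_graph \<Y>) \<phi> \<longleftrightarrow> R \<Y> Z'"
      "\<forall>q. min T (class_count h \<X> Z q) = min T (class_count h \<Y> Z' q)"
      using labels[OF *(1)] labels[OF *(2)] *(4) by metis
    then show "models (family_graph \<Y>) \<phi>"
      using h *(1-3) unfolding recognized_by_def by blast
  qed
qed

section \<open>Forests of paths as families of disjoint paths\<close>

definition path_graph :: "'a list \<Rightarrow> 'a graph" where
  "path_graph xs = (set xs, path_edges xs)"

lemma verts_path_graph [simp]: "verts (path_graph xs) = set xs"
  by (simp add: verts_def path_graph_def)

lemma edges_path_graph [simp]: "edges (path_graph xs) = path_edges xs"
  by (simp add: edges_def path_graph_def)

lemma graph_eqI: "verts G = verts H \<Longrightarrow> edges G = edges H \<Longrightarrow> G = H"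
  by (simp add: verts_def edges_def prod_eq_iff)

lemma is_path_iff: "is_path H \<longleftrightarrow> (\<exists>xs. xs \<noteq> [] \<and> distinct xs \<and> H = path_graph xs)"
  unfolding is_path_def path_edges_def[symmetric]
  by (metis edges_path_graph graph_eqI verts_path_graph)

lemma path_edgesD:
  assumes "distinct xs" "e \<in> path_edges xs"
  shows "e \<subseteq> set xs" "card e = 2"
proof -
  obtain i where i: "Suc i < length xs" "e = {xs ! i, xs ! Suc i}"
    using assms(2) by (auto simp: path_edges_def)
  then show "e \<subseteq> set xs" by simp
  have "xs ! i \<noteq> xs ! Suc i" using i assms(1) by (simp add: nth_eq_iff_index_eq)
  then show "card e = 2" using i by simp
qed

lemma is_path_finite: "is_path H \<Longrightarrow> finite (verts H)"
  and is_path_nonempty: "is_path H \<Longrightarrow> verts H \<noteq> {}"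
  and is_path_edge: "is_path H \<Longrightarrow> e \<in> edges H \<Longrightarrow> e \<subseteq> verts H \<and> card e = 2"
  by (auto simp: is_path_iff path_edgesD(2) dest: subsetD[OF path_edgesD(1)])

lemma adjacent_sym: "adjacent G u v \<Longrightarrow> adjacent G v u"
  by (simp add: adjacent_def insert_commute)

lemma reachable_sym: "(adjacent G)\<^sup>*\<^sup>* u v \<Longrightarrow> (adjacent G)\<^sup>*\<^sup>* v u"
  by (metis adjacent_sym sympD sympI symp_rtranclp)

lemma is_path_connected:
  assumes "is_path H" "u \<in> verts H" "v \<in> verts H"
  shows "(adjacent H)\<^sup>*\<^sup>* u v"
proof -
  obtain xs where xs: "xs \<noteq> []" "distinct xs" "H = path_graph xs"
    using assms(1) by (auto simp: is_path_iff)
  have *: "(adjacent H)\<^sup>*\<^sup>* (xs ! 0) (xs ! i)" if "i < length xs" for i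
    using that
  proof (induction i)
    case (Suc i)
    have "adjacent H (xs ! i) (xs ! Suc i)"
      using Suc.prems by (auto simp: adjacent_def xs(3) path_edges_def)
    with Suc show ?case by (meson Suc_lessD rtranclp.rtrancl_into_rtrancl)
  qed simp
  obtain i j where "i < length xs" "xs ! i = u" "j < length xs" "xs ! j = v"
    using assms(2,3) xs(3) by (auto simp: in_set_conv_nth)
  then show ?thesis using * reachable_sym by (metis rtranclp_trans)
qed

definition path_families :: "'a set \<Rightarrow> 'a graph set set" where
  "path_families V = {\<C>. (\<forall>H\<in>\<C>. is_path H) \<and>
     (\<forall>H\<in>\<C>. \<forall>H'\<in>\<C>. H \<noteq> H' \<longrightarrow> verts H \<inter> verts H' = {}) \<and> \<Union>(verts ` \<C>) = V}"

definition graph_union :: "'a graph set \<Rightarrow> 'a graph" where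
  "graph_union \<C> = (\<Union>(verts ` \<C>), \<Union>(edges ` \<C>))"

lemma verts_graph_union [simp]: "verts (graph_union \<C>) = \<Union>(verts ` \<C>)"
  by (simp add: verts_def graph_union_def)

lemma edges_graph_union [simp]: "edges (graph_union \<C>) = \<Union>(edges ` \<C>)"
  by (simp add: edges_def graph_union_def)

lemma edges_induced_subgraph [simp]: "edges (induced_subgraph G W) = {e \<in> edges G. e \<subseteq> W}"
  by (simp add: edges_def induced_subgraph_def)

lemma verts_induced_subgraph [simp]: "verts (induced_subgraph G W) = W"
  by (simp add: verts_def induced_subgraph_def)

lemma path_families_inj:
  "\<C> \<in> path_families V \<Longrightarrow> H \<in> \<C> \<Longrightarrow> H' \<in> \<C> \<Longrightarrow> u \<in> verts H \<Longrightarrow> u \<in> verts H' \<Longrightarrow> H = H'"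
  unfolding path_families_def by blast

text \<open>No edge of the union leaves a member and every member is connected, so the classes of
  \<open>reachability\<close> are exactly the vertex sets of the members.\<close>

lemma components_graph_union:
  assumes "\<C> \<in> path_families V"
  shows "components (graph_union \<C>) = \<C>"
proof -
  let ?G = "graph_union \<C>"
  have path: "is_path H" if "H \<in> \<C>" for H using that assms by (auto simp: path_families_def)
  have step: "v \<in> verts H" if H: "H \<in> \<C>" "u \<in> verts H" and adj: "adjacent ?G u v" for H u v
  proof -
    obtain H' where H': "H' \<in> \<C>" "{u, v} \<in> edges H'"
      using adj by (auto simp: adjacent_def)
    then have "u \<in> verts H'" "v \<in> verts H'" using is_path_edge[OF path] by blast+
    then show ?thesis using path_families_inj[OF assms H'(1) H(1)] H(2) by blast
  qed
  have reach: "(adjacent ?G)\<^sup>*\<^sup>* u v \<longleftrightarrow> v \<in> verts H" if H: "H \<in> \<C>" "u \<in> verts H" for H u v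
  proof
    show "v \<in> verts H" if "(adjacent ?G)\<^sup>*\<^sup>* u v"
      using that by induction (use step H in auto)
    assume "v \<in> verts H"
    then have "(adjacent H)\<^sup>*\<^sup>* u v" using is_path_connected path H by metis
    moreover have "adjacent H \<le> adjacent ?G"
      using H by (auto simp: adjacent_def)
    ultimately show "(adjacent ?G)\<^sup>*\<^sup>* u v" using rtranclp_mono by blast
  qed
  have cl: "reachability ?G `` {u} = verts H" if "H \<in> \<C>" "u \<in> verts H" for H u
    using reach[OF that] that by (auto simp: reachability_def)
  have "verts ?G // reachability ?G = verts ` \<C>"
  proof
    show "verts ?G // reachability ?G \<subseteq> verts ` \<C>"
    proof
      fix W assume "W \<in> verts ?G // reachability ?G"
      then obtain u where u: "u \<in> verts ?G" "W = reachability ?G `` {u}" by (rule quotientE)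
      then obtain H where "H \<in> \<C>" "u \<in> verts H" by auto
      with u cl show "W \<in> verts ` \<C>" by blast
    qed
    show "verts ` \<C> \<subseteq> verts ?G // reachability ?G"
    proof
      fix W assume "W \<in> verts ` \<C>"
      then obtain H where H: "H \<in> \<C>" "W = verts H" by blast
      then obtain u where u: "u \<in> verts H" using is_path_nonempty[OF path] by blast
      then have "u \<in> verts ?G" using H by auto
      then show "W \<in> verts ?G // reachability ?G"
        using quotientI[of u "verts ?G" "reachability ?G"] cl[OF H(1) u] H(2) by simp
    qed
  qed
  moreover have "induced_subgraph ?G (verts H) = H" if H: "H \<in> \<C>" for H
  proof (rule graph_eqI)
    show "edges (induced_subgraph ?G (verts H)) = edges H"
    proof -
      have "e \<in> edges H" if e: "H' \<in> \<C>" "e \<in> edges H'" "e \<subseteq> verts H" for e H'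
      proof -
        have "e \<subseteq> verts H'" "e \<noteq> {}" using is_path_edge[OF path[OF e(1)] e(2)] by auto
        then have "H' = H" using path_families_inj[OF assms e(1) H] e(3) by blast
        then show ?thesis using e by simp
      qed
      then show ?thesis
        using H is_path_edge[OF path[OF H]] unfolding edges_induced_subgraph edges_graph_union by blast
    qed
  qed simp
  ultimately show ?thesis by (simp add: components_def image_image)
qed

lemma forest_graph_union:
  assumes "\<C> \<in> path_families V"
  shows "verts (graph_union \<C>) = V" "forest_of_paths (graph_union \<C>)"
proof -
  show "verts (graph_union \<C>) = V" using assms by (simp add: path_families_def)
  have path: "is_path H" if "H \<in> \<C>" for H using that assms by (auto simp: path_families_def)
  show "forest_of_paths (graph_union \<C>)"
    unfolding forest_of_paths_def components_graph_union[OF assms] simple_graph_def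
    using path is_path_edge by fastforce
qed

lemma equiv_reachability: "equiv (verts G) (reachability G)"
  by (auto simp: equiv_def refl_on_def sym_def trans_def reachability_def
      intro: reachable_sym)

lemma components_path_families:
  assumes "forest_of_paths G"
  shows "components G \<in> path_families (verts G)" "graph_union (components G) = G"
proof -
  let ?r = "reachability G"
  have inv: "verts ` components G = verts G // ?r"
    by (simp add: components_def image_image)
  have disj: "verts H \<inter> verts H' = {}" if "H \<in> components G" "H' \<in> components G" "H \<noteq> H'" for H H'
    using that quotient_disj[OF equiv_reachability] unfolding components_def by fastforce
  show "components G \<in> path_families (verts G)"
    using assms disj Union_quotient[OF equiv_reachability, of G]
    by (simp add: path_families_def forest_of_paths_def inv)
  show "graph_union (components G) = G"
  proof (rule graph_eqI)
    show "verts (graph_union (components G)) = verts G"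
      using Union_quotient[OF equiv_reachability, of G] by (simp add: inv)
    show "edges (graph_union (components G)) = edges G"
    proof
      show "edges (graph_union (components G)) \<subseteq> edges G"
        unfolding edges_graph_union by (auto simp: components_def induced_subgraph_def edges_def)
      show "edges G \<subseteq> edges (graph_union (components G))"
      proof
        fix e assume e: "e \<in> edges G"
        then have "card e = 2" "e \<subseteq> verts G"
          using assms by (auto simp: forest_of_paths_def simple_graph_def)
        then obtain a b where ab: "e = {a, b}" "a \<in> verts G" "b \<in> verts G"
          by (auto simp: card_2_iff)
        then have "adjacent G a b" using e by (simp add: adjacent_def)
        then have "e \<subseteq> ?r `` {a}" using ab by (auto simp: reachability_def)
        moreover have "?r `` {a} \<in> verts G // ?r" using ab by (simp add: quotientI)
        ultimately show "e \<in> edges (graph_union (components G))"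
          using e unfolding edges_graph_union by (auto simp: components_def induced_subgraph_def edges_def)
      qed
    qed
  qed
qed

lemma bij_betw_components:
  "bij_betw components {G. verts G = V \<and> forest_of_paths G} (path_families V)"
  by (rule bij_betw_byWitness[where f' = graph_union])
    (auto simp: components_path_families components_graph_union forest_graph_union
      simp del: verts_graph_union)

text \<open>A direction is chosen for every component. The clause on counts holds for any property
  of the size, which covers classes of sizes as well as single sizes.\<close>

lemma forest_list_family:
  assumes "forest_of_paths G" "finite (verts G)"
  obtains \<X> where "list_family \<X>" "family_graph \<X> = G"
    "\<And>P. card {xs\<in>\<X>. P (length xs)} = card {H\<in>components G. P (card (verts H))}"
proof -
  let ?C = "components G"
  have C: "?C \<in> path_families (verts G)" "graph_union ?C = G"
    using components_path_families[OF assms(1)] by auto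
  have path: "is_path H" if "H \<in> ?C" for H using that C by (auto simp: path_families_def)
  then obtain l where l: "\<And>H. H \<in> ?C \<Longrightarrow> l H \<noteq> [] \<and> distinct (l H) \<and> H = path_graph (l H)"
    unfolding is_path_iff by metis
  have vl: "set (l H) = verts H" "path_edges (l H) = edges H" if "H \<in> ?C" for H
    using l[OF that] by (metis verts_path_graph, metis edges_path_graph)
  have inj: "inj_on l ?C" using l by (metis inj_onI)
  have fin: "finite ?C"
  proof -
    have "verts H \<in> Pow (verts G)" if "H \<in> ?C" for H using C that by (auto simp: path_families_def)
    moreover have "inj_on verts ?C"
    proof (rule inj_onI)
      fix H H' assume H: "H \<in> ?C" "H' \<in> ?C" "verts H = verts H'"
      obtain u where "u \<in> verts H" using is_path_nonempty[OF path[OF H(1)]] by blast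
      then show "H = H'" using path_families_inj[OF C(1)] H by metis
    qed
    ultimately show ?thesis using assms(2) by (meson finite_Pow_iff finite_subset image_subsetI finite_imageD)
  qed
  show thesis
  proof (rule that[of "l ` ?C"])
    show "list_family (l ` ?C)"
      unfolding list_family_def
    proof (intro conjI ballI impI)
      fix xs ys assume "xs \<in> l ` ?C" "ys \<in> l ` ?C" "xs \<noteq> ys"
      then show "set xs \<inter> set ys = {}"
        using vl path_families_inj[OF C(1)] by fastforce
    qed (use fin l in auto)
    have "family_graph (l ` ?C) = graph_union ?C"
      using vl by (intro graph_eqI) auto
    then show "family_graph (l ` ?C) = G" using C(2) by simp
    fix P
    have "{xs \<in> l ` ?C. P (length xs)} = l ` {H\<in>?C. P (card (verts H))}"
      using l vl by (auto simp flip: distinct_card)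
    then show "card {xs \<in> l ` ?C. P (length xs)} = card {H\<in>?C. P (card (verts H))}"
      using inj by (simp add: card_image inj_on_subset)
  qed
qed

section \<open>Counting paths\<close>

lemma path_edges_rev: "path_edges (rev xs) = path_edges xs"
proof -
  have sub: "path_edges (rev xs) \<subseteq> path_edges xs" for xs :: "'a list"
  proof
    fix e assume "e \<in> path_edges (rev xs)"
    then obtain i where i: "Suc i < length xs" "e = {rev xs ! i, rev xs ! Suc i}"
      by (auto simp: path_edges_def)
    let ?j = "length xs - Suc (Suc i)"
    have "rev xs ! i = xs ! Suc ?j" "rev xs ! Suc i = xs ! ?j" "Suc ?j < length xs"
      using i by (auto simp: rev_nth Suc_diff_Suc)
    then have "e = {xs ! ?j, xs ! Suc ?j} \<and> Suc ?j < length xs"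
      using i(2) by (simp add: insert_commute)
    then show "e \<in> path_edges xs" unfolding path_edges_def by (intro CollectI exI)
  qed
  from sub[of xs] sub[of "rev xs"] show ?thesis by simp
qed

lemma path_graph_rev: "path_graph (rev xs) = path_graph xs"
  by (simp add: path_graph_def path_edges_rev)

lemma path_edges_Cons_Cons: "path_edges (x # y # ys) = insert {x, y} (path_edges (y # ys))"
proof -
  have "{x, y} \<in> path_edges (x # y # ys)"
    by (auto simp: path_edges_def intro: exI[of _ 0])
  moreover have "e \<in> path_edges (x # y # ys)" if "e \<in> path_edges (y # ys)" for e
    using that unfolding path_edges_def by (auto intro: exI[of _ "Suc _"])
  moreover have "e = {x, y} \<or> e \<in> path_edges (y # ys)" if e: "e \<in> path_edges (x # y # ys)" for e
  proof -
    obtain i where "Suc i < length (x # y # ys)" "e = {(x # y # ys) ! i, (x # y # ys) ! Suc i}"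
      using e by (auto simp: path_edges_def)
    then show ?thesis by (cases i) (auto simp: path_edges_def)
  qed
  ultimately show ?thesis by blast
qed

lemma path_edges_single [simp]: "path_edges [x] = {}"
  by (simp add: path_edges_def)

text \<open>The only edge at the head determines the second vertex; removing the head leaves a
  shorter path whose head is known.\<close>

lemma path_edges_inj_same_head:
  assumes "distinct (x # xs)" "distinct (x # ys)" "path_edges (x # xs) = path_edges (x # ys)"
    "set xs = set ys"
  shows "xs = ys"
  using assms
proof (induction xs arbitrary: x ys)
  case (Cons y xs)
  obtain z zs where ys: "ys = z # zs" using Cons.prems(4) by (cases ys) auto
  have nin: "x \<notin> e" if "e \<in> path_edges (y # xs) \<or> e \<in> path_edges (z # zs)" for e
    using that Cons.prems(1,2) path_edgesD(1)[of "y # xs" e] path_edgesD(1)[of "z # zs" e] ys by auto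
  have eq: "insert {x, y} (path_edges (y # xs)) = insert {x, z} (path_edges (z # zs))"
    using Cons.prems(3) by (simp add: ys path_edges_Cons_Cons)
  then have "{x, y} = {x, z}" using nin by blast
  then have yz: "y = z" by (auto simp: doubleton_eq_iff)
  have "path_edges (y # xs) = path_edges (y # zs)"
    using eq nin yz by blast
  moreover have "set xs = set zs"
  proof -
    have "y \<notin> set xs" "y \<notin> set zs" "insert y (set xs) = insert y (set zs)"
      using Cons.prems(1,2,4) unfolding ys yz by auto
    then show ?thesis by (simp add: insert_ident)
  qed
  moreover have "distinct (y # xs)" "distinct (y # zs)"
    using Cons.prems(1,2) unfolding ys yz by auto
  ultimately have "xs = zs" using Cons.IH[of y zs] by blast
  then show ?case unfolding ys yz by (rule arg_cong)
qed simp

lemma path_edges_head_unique: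
  assumes "distinct (x # xs)" "{x, y} \<in> path_edges (x # xs)" "{x, z} \<in> path_edges (x # xs)"
  shows "y = z"
proof (cases xs)
  case Nil
  then show ?thesis using assms by simp
next
  case (Cons a as)
  have "e \<noteq> {x, w}" if "e \<in> path_edges (a # as)" for e w
    using path_edgesD(1)[OF _ that] assms(1) Cons by auto
  then have "{x, y} = {x, a}" "{x, z} = {x, a}"
    using assms(2,3) by (auto simp: Cons path_edges_Cons_Cons)
  then show ?thesis by (auto simp: doubleton_eq_iff)
qed

text \<open>The head of \<open>xs\<close> has at most one neighbour, so it stands at an end of
  \<open>ys\<close>. Up to reversal both lists then start alike.\<close>

lemma path_graph_eq_iff:
  assumes "distinct xs" "distinct ys" "xs \<noteq> []"
  shows "path_graph ys = path_graph xs \<longleftrightarrow> ys = xs \<or> ys = rev xs"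
proof
  assume eq: "path_graph ys = path_graph xs"
  then have se: "set ys = set xs" "path_edges ys = path_edges xs"
    by (auto simp: path_graph_def)
  obtain x xs' where xs: "xs = x # xs'" using assms(3) by (cases xs) auto
  obtain i where i: "i < length ys" "ys ! i = x"
    using se(1) xs by (metis in_set_conv_nth list.set_intros(1))
  have head: "zs = xs" if zs0: "distinct zs" "set zs = set xs" "path_edges zs = path_edges xs" "zs \<noteq> []" "hd zs = x"
    for zs
  proof -
    obtain zs' where zs: "zs = x # zs'" using zs0(4,5) by (cases zs) auto
    have "set zs' = set xs'" using zs0(1,2) assms(1) by (auto simp: zs xs)
    then show ?thesis
      using path_edges_inj_same_head[of x zs' xs'] zs0(1,3) assms(1) by (simp add: zs xs)
  qed
  have "i = 0 \<or> Suc i = length ys"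
  proof (rule ccontr)
    assume "\<not> ?thesis"
    then obtain j where j: "i = Suc j" "Suc i < length ys" using i(1) by (cases i) auto
    have "{ys ! j, ys ! Suc j} \<in> path_edges ys" "{ys ! i, ys ! Suc i} \<in> path_edges ys"
      using j unfolding path_edges_def by fastforce+
    then have "{x, ys ! j} \<in> path_edges (x # xs')" "{x, ys ! Suc i} \<in> path_edges (x # xs')"
      using i(2) j(1) se(2) xs by (simp_all add: insert_commute)
    then have "ys ! j = ys ! Suc i"
      using path_edges_head_unique assms(1) xs by metis
    then show False using j assms(2) by (simp add: nth_eq_iff_index_eq)
  qed
  then show "ys = xs \<or> ys = rev xs"
  proof
    assume "i = 0"
    then have "ys = xs" using head[of ys] se assms(2) i by (cases ys) auto
    then show ?thesis ..
  next
    assume "Suc i = length ys"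
    then have "i = length ys - 1" "ys \<noteq> []" by auto
    then have "hd (rev ys) = x" "ys \<noteq> []"
      using i(2) by (simp_all add: hd_rev last_conv_nth)
    then have "rev ys = xs"
      using head[of "rev ys"] se assms(2) by (simp add: path_edges_rev)
    then show ?thesis by auto
  qed
qed (auto simp: path_graph_rev)

text \<open>For \<open>k \<ge> 1\<close>, the coefficient of z^k in z + z^2 / (2 (1 - z)), the
  exponential generating function of paths.\<close>

definition path_weight :: "nat \<Rightarrow> real" where
  "path_weight k = (if k = 1 then 1 else 1 / 2)"

definition paths_over :: "'a set \<Rightarrow> 'a graph set" where
  "paths_over U = {H. is_path H \<and> verts H = U}"

lemma paths_over_eq:
  assumes "U \<noteq> {}"
  shows "paths_over U = path_graph ` permutations_of_set U"
proof -
  have "is_path H \<and> verts H = U \<longleftrightarrow> (\<exists>xs. (set xs = U \<and> distinct xs) \<and> H = path_graph xs)" for H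
    unfolding is_path_iff using assms by (metis set_empty verts_path_graph)
  then show ?thesis
    unfolding paths_over_def permutations_of_set_def by blast
qed

text \<open>A path on at least two vertices comes from exactly two orderings, reverses of each
  other; a single vertex has only one ordering.\<close>

lemma card_paths_over:
  assumes "finite U" "U \<noteq> {}"
  shows "real (card (paths_over U)) = fact (card U) * path_weight (card U)"
proof (cases "card U = 1")
  case True
  then obtain u where "U = {u}" by (auto simp: card_1_singleton_iff)
  then show ?thesis by (simp add: paths_over_eq path_weight_def)
next
  case False
  let ?P = "permutations_of_set U"
  have fin: "finite ?P" by simp
  have "card {ys\<in>?P. path_graph ys = H} = 2" if H: "H \<in> path_graph ` ?P" for H
  proof -
    obtain xs where xs: "xs \<in> ?P" "H = path_graph xs" using H by blast
    then have d: "distinct xs" "set xs = U" by (auto simp: permutations_of_set_def)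
    then have "length xs = card U" by (metis distinct_card)
    moreover have "card U \<noteq> 0" using assms by simp
    ultimately have len: "2 \<le> length xs" using False by linarith
    have "{ys\<in>?P. path_graph ys = H} = {xs, rev xs}"
      using xs d path_graph_eq_iff[OF d(1)] assms(2) by (auto simp: permutations_of_set_def)
    moreover have "rev xs \<noteq> xs"
    proof
      assume "rev xs = xs"
      then have "xs ! 0 = xs ! (length xs - 1)" using len by (metis One_nat_def diff_Suc_1 gr0I not_numeral_le_zero rev_nth)
      then show False using d(1) len by (subst (asm) nth_eq_iff_index_eq) auto
    qed
    ultimately show ?thesis by simp
  qed
  then have "(\<Sum>H\<in>path_graph ` ?P. card {ys\<in>?P. path_graph ys = H}) = 2 * card (path_graph ` ?P)"
    by simp
  moreover have "(\<Sum>H\<in>path_graph ` ?P. card {ys\<in>?P. path_graph ys = H}) = card ?P"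
    using sum.group[of ?P "path_graph ` ?P" path_graph "\<lambda>_. 1::nat"] fin by simp
  ultimately have "fact (card U) = 2 * card (paths_over U)"
    using assms by (simp add: paths_over_eq card_permutations_of_set)
  then have "(fact (card U) :: real) = 2 * real (card (paths_over U))"
    by (metis of_nat_fact of_nat_mult of_nat_numeral)
  then show ?thesis using False by (simp add: path_weight_def)
qed

section \<open>Counting forests of paths\<close>

lemma finite_paths_over: "finite U \<Longrightarrow> finite (paths_over U)"
proof (rule finite_subset)
  show "paths_over U \<subseteq> {U} \<times> Pow (Pow U)"
  proof
    fix H assume "H \<in> paths_over U"
    then have "fst H = U" "snd H \<subseteq> Pow U"
      using is_path_edge[of H] by (auto simp: paths_over_def verts_def edges_def)
    then show "H \<in> {U} \<times> Pow (Pow U)" by (simp add: mem_Times_iff)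
  qed
qed simp

lemma finite_path_families:
  assumes "finite V"
  shows "finite (path_families V)"
proof (rule finite_subset)
  show "path_families V \<subseteq> Pow (\<Union>U\<in>Pow V. paths_over U)"
    by (auto simp: path_families_def paths_over_def)
  show "finite (Pow (\<Union>U\<in>Pow V. paths_over U))"
    using assms finite_paths_over finite_subset by blast
qed

lemma finite_family:
  assumes "\<C> \<in> path_families V" "finite V"
  shows "finite \<C>"
proof -
  have "\<C> \<subseteq> (\<Union>U\<in>Pow V. paths_over U)"
    using assms(1) by (auto simp: path_families_def paths_over_def)
  moreover have "finite (\<Union>U\<in>Pow V. paths_over U)"
    using assms(2) finite_paths_over finite_subset by blast
  ultimately show ?thesis by (rule finite_subset)
qed

lemma insert_path_family:
  assumes "H \<in> paths_over U" "U \<subseteq> V" "\<C> \<in> path_families (V - U)"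
  shows "insert H \<C> \<in> path_families V" "H \<notin> \<C>"
proof -
  have H: "is_path H" "verts H = U" using assms(1) by (auto simp: paths_over_def)
  have disj: "verts H' \<inter> U = {}" if "H' \<in> \<C>" for H'
    using assms(3) that by (auto simp: path_families_def)
  show "H \<notin> \<C>" using disj H is_path_nonempty by blast
  have "\<Union>(verts ` insert H \<C>) = V" using assms(2,3) H by (auto simp: path_families_def)
  then show "insert H \<C> \<in> path_families V"
    using assms(3) H disj by (auto simp: path_families_def Int_commute)
qed

lemma remove_path_family:
  assumes "\<C> \<in> path_families V" "H \<in> \<C>"
  shows "\<C> - {H} \<in> path_families (V - verts H)" "H \<in> paths_over (verts H)" "verts H \<subseteq> V"
proof -
  have "\<Union>(verts ` (\<C> - {H})) = V - verts H"
    using assms by (auto simp: path_families_def)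
  then show "\<C> - {H} \<in> path_families (V - verts H)"
    using assms(1) by (simp add: path_families_def)
qed (use assms in \<open>auto simp: path_families_def paths_over_def\<close>)

text \<open>A family splits uniquely into the path through the fixed vertex \<open>v\<close> and a
  family on the remaining vertices. Rooting at \<open>v\<close> avoids counting a family once for
  each of its members.\<close>

lemma sum_path_families:
  fixes \<Phi> :: "'a graph set \<Rightarrow> real"
  assumes fin: "finite V" and v: "v \<in> V"
  shows "(\<Sum>\<C>\<in>path_families V. \<Phi> \<C>) =
    (\<Sum>U\<in>{U. v \<in> U \<and> U \<subseteq> V}. \<Sum>H\<in>paths_over U. \<Sum>\<C>\<in>path_families (V - U). \<Phi> (insert H \<C>))"
proof -
  let ?T = "SIGMA U:{U. v \<in> U \<and> U \<subseteq> V}. paths_over U \<times> path_families (V - U)"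
  define comp where "comp \<C> = (THE H. H \<in> \<C> \<and> v \<in> verts H)" for \<C>
  have compI: "comp \<C> = H" if "\<C> \<in> path_families V" "H \<in> \<C>" "v \<in> verts H" for \<C> H
    unfolding comp_def using that path_families_inj[OF that(1)] by blast
  have comp: "comp \<C> \<in> \<C> \<and> v \<in> verts (comp \<C>)" if C: "\<C> \<in> path_families V" for \<C>
  proof -
    have "v \<in> \<Union>(verts ` \<C>)" using C v by (simp add: path_families_def)
    then obtain H where "H \<in> \<C>" "v \<in> verts H" by blast
    then show ?thesis using compI[OF C] by metis
  qed
  have "(\<Sum>\<C>\<in>path_families V. \<Phi> \<C>) = (\<Sum>(U, H, \<C>)\<in>?T. \<Phi> (insert H \<C>))"
  proof (rule sum.reindex_bij_witness[where i = "\<lambda>(U, H, \<C>). insert H \<C>"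
        and j = "\<lambda>\<C>. (verts (comp \<C>), comp \<C>, \<C> - {comp \<C>})"])
    fix \<C> assume C: "\<C> \<in> path_families V"
    show "(case (verts (comp \<C>), comp \<C>, \<C> - {comp \<C>}) of (U, H, \<C>) \<Rightarrow> insert H \<C>) = \<C>"
      using comp[OF C] by auto
    show "(verts (comp \<C>), comp \<C>, \<C> - {comp \<C>}) \<in> ?T"
      using comp[OF C] remove_path_family[OF C, of "comp \<C>"] by auto
    show "(case (verts (comp \<C>), comp \<C>, \<C> - {comp \<C>}) of (U, H, \<C>) \<Rightarrow> \<Phi> (insert H \<C>)) = \<Phi> \<C>"
      using comp[OF C] by (auto simp: insert_absorb)
  next
    fix b assume "b \<in> ?T"
    then obtain U H \<C> where b: "b = (U, H, \<C>)" "v \<in> U" "U \<subseteq> V" "H \<in> paths_over U"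
      "\<C> \<in> path_families (V - U)" by auto
    have *: "insert H \<C> \<in> path_families V" "H \<notin> \<C>"
      using insert_path_family[OF b(4,3,5)] by auto
    have "verts H = U" using b(4) by (simp add: paths_over_def)
    moreover have "comp (insert H \<C>) = H"
      using b(2) compI[OF *(1)] \<open>verts H = U\<close> by auto
    ultimately show "(\<lambda>\<C>. (verts (comp \<C>), comp \<C>, \<C> - {comp \<C>})) (case b of (U, H, \<C>) \<Rightarrow> insert H \<C>) = b"
      using *(2) by (simp add: b(1))
    show "(case b of (U, H, \<C>) \<Rightarrow> insert H \<C>) \<in> path_families V"
      using *(1) by (simp add: b(1))
  qed
  also have "\<dots> = (\<Sum>U\<in>{U. v \<in> U \<and> U \<subseteq> V}. \<Sum>(H, \<C>)\<in>paths_over U \<times> path_families (V - U). \<Phi> (insert H \<C>))"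
  proof (subst sum.Sigma)
    show "finite {U. v \<in> U \<and> U \<subseteq> V}" using fin by simp
    show "\<forall>U\<in>{U. v \<in> U \<and> U \<subseteq> V}. finite (paths_over U \<times> path_families (V - U))"
    proof
      fix U assume "U \<in> {U. v \<in> U \<and> U \<subseteq> V}"
      then have "finite U" "finite (V - U)" using fin finite_subset by blast+
      then show "finite (paths_over U \<times> path_families (V - U))"
        by (simp add: finite_paths_over finite_path_families)
    qed
  qed (simp add: case_prod_unfold)
  also have "\<dots> = (\<Sum>U\<in>{U. v \<in> U \<and> U \<subseteq> V}. \<Sum>H\<in>paths_over U. \<Sum>\<C>\<in>path_families (V - U). \<Phi> (insert H \<C>))"
    unfolding sum.cartesian_product ..
  finally show ?thesis .
qed

lemma card_subsets_containing:
  assumes "finite V" "v \<in> V" "1 \<le> k"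
  shows "card {U. v \<in> U \<and> U \<subseteq> V \<and> card U = k} = (card V - 1) choose (k - 1)"
proof -
  have "{U. v \<in> U \<and> U \<subseteq> V \<and> card U = k} = insert v ` {U. U \<subseteq> V - {v} \<and> card U = k - 1}"
  proof (intro equalityI subsetI)
    fix U assume "U \<in> {U. v \<in> U \<and> U \<subseteq> V \<and> card U = k}"
    then have U: "v \<in> U" "U \<subseteq> V" "card U = k" by auto
    then have "U = insert v (U - {v})" "U - {v} \<subseteq> V - {v}" "card (U - {v}) = k - 1"
      using assms(1) finite_subset by auto
    then show "U \<in> insert v ` {U. U \<subseteq> V - {v} \<and> card U = k - 1}" by blast
  next
    fix U assume "U \<in> insert v ` {U. U \<subseteq> V - {v} \<and> card U = k - 1}"
    then obtain W where W: "U = insert v W" "W \<subseteq> V - {v}" "card W = k - 1" by blast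
    then have "finite W" "v \<notin> W" using assms(1) finite_subset by blast+
    then show "U \<in> {U. v \<in> U \<and> U \<subseteq> V \<and> card U = k}"
      using W assms(2,3) by auto
  qed
  moreover have "inj_on (insert v) {U. U \<subseteq> V - {v} \<and> card U = k - 1}"
    by (rule inj_onI) (auto simp: insert_ident subset_Diff_insert)
  ultimately show ?thesis
    using assms n_subsets[of "V - {v}" "k - 1"] by (simp add: card_image)
qed


section \<open>Forests with prescribed numbers of small components\<close>

text \<open>The value 0 outside \<open>{1..K}\<close> makes equality of functions compare the
  recorded sizes only; it is also the default value in \<open>limit_counts\<close>.\<close>

definition comp_count :: "nat \<Rightarrow> 'a graph set \<Rightarrow> nat \<Rightarrow> nat" where
  "comp_count K \<C> l = (if l \<in> {1..K} then card {H\<in>\<C>. card (verts H) = l} else 0)"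

lemma comp_count_insert:
  assumes "finite \<C>" "H \<notin> \<C>" "1 \<le> card (verts H)"
  shows "comp_count K (insert H \<C>) =
    (if card (verts H) \<le> K then (comp_count K \<C>)(card (verts H) := Suc (comp_count K \<C> (card (verts H))))
     else comp_count K \<C>)"
proof -
  have "{H'\<in>insert H \<C>. card (verts H') = l} =
      (if l = card (verts H) then insert H {H'\<in>\<C>. card (verts H') = l} else {H'\<in>\<C>. card (verts H') = l})" for l
    by auto
  then show ?thesis
    using assms by (auto simp: comp_count_def fun_eq_iff)
qed

text \<open>Up to a factor \<open>n!\<close>, the number of forests all of whose components have more than
  \<open>K\<close> vertices.\<close>

fun large_coeff :: "nat \<Rightarrow> nat \<Rightarrow> real" where
  "large_coeff K n = (if n = 0 then 1 else
     (\<Sum>k\<in>{Suc K..n}. real k * path_weight k * large_coeff K (n - k)) / real n)"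

declare large_coeff.simps [simp del]

lemma large_coeff_0 [simp]: "large_coeff K 0 = 1"
  by (simp add: large_coeff.simps)

lemma large_coeff_rec:
  "real n * large_coeff K n = (if n = 0 then 0 else \<Sum>k\<in>{Suc K..n}. real k * path_weight k * large_coeff K (n - k))"
  by (subst large_coeff.simps) simp

lemma path_weight_pos: "path_weight k > 0"
  by (simp add: path_weight_def)

definition vsize :: "nat \<Rightarrow> (nat \<Rightarrow> nat) \<Rightarrow> nat" where
  "vsize K a = (\<Sum>l\<in>{1..K}. l * a l)"

text \<open>The factor of the prescribed components in the exponential formula; the factorials
  account for components of equal size being unordered. Multiplied by
  \<open>exp (- path_weight l)\<close> for each \<open>l\<close>, it is a product of Poisson
  weights.\<close>

definition vweight :: "nat \<Rightarrow> (nat \<Rightarrow> nat) \<Rightarrow> real" where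
  "vweight K a = (\<Prod>l\<in>{1..K}. path_weight l ^ a l / fact (a l))"

lemma vsize_dec:
  assumes "k \<in> {1..K}" "0 < a k"
  shows "vsize K a = vsize K (a(k := a k - 1)) + k"
proof -
  have 1: "vsize K f = k * f k + (\<Sum>l\<in>{1..K} - {k}. l * f l)" for f
    using assms(1) unfolding vsize_def by (simp add: sum.remove)
  have "k * a k = k * (a k - 1) + k" using assms(2) by (cases "a k") auto
  then show ?thesis unfolding 1 by simp
qed

lemma vweight_dec:
  assumes "k \<in> {1..K}" "0 < a k"
  shows "path_weight k * vweight K (a(k := a k - 1)) = real (a k) * vweight K a"
proof -
  have 1: "vweight K f = path_weight k ^ f k / fact (f k) * (\<Prod>l\<in>{1..K} - {k}. path_weight l ^ f l / fact (f l))" for f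
    using assms(1) unfolding vweight_def by (simp add: prod.remove)
  obtain m where m: "a k = Suc m" using assms(2) by (cases "a k") auto
  have "path_weight k * (path_weight k ^ m / fact m) = real (Suc m) * (path_weight k ^ Suc m / fact (Suc m))"
    by (simp add: field_simps del: of_nat_Suc)
  then show ?thesis unfolding 1 by (simp add: m)
qed

text \<open>The product formula satisfies the recurrence that comes from removing the component of a
  fixed vertex. By \<open>vweight_dec\<close>, sizes up to \<open>K\<close> contribute the factor
  \<open>vsize K a\<close>; by the recurrence of \<open>large_coeff\<close>, larger sizes contribute
  \<open>n - vsize K a\<close>. Together this is the factor \<open>n\<close>.\<close>

lemma forest_count_step:
  assumes a: "\<And>l. l \<notin> {1..K} \<Longrightarrow> a l = 0" and n: "0 < n"
    and M: "\<And>k. k \<in> {1..n} \<Longrightarrow> M k =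
      (if k \<le> K then if a k = 0 then 0 else
         vweight K (a(k := a k - 1)) * (if vsize K (a(k := a k - 1)) \<le> n - k
           then large_coeff K (n - k - vsize K (a(k := a k - 1))) else 0)
       else vweight K a * (if vsize K a \<le> n - k then large_coeff K (n - k - vsize K a) else 0))"
  shows "(\<Sum>k\<in>{1..n}. real k * path_weight k * M k) =
    real n * (vweight K a * (if vsize K a \<le> n then large_coeff K (n - vsize K a) else 0))"
proof -
  let ?s = "vsize K a"
  have small: "real k * path_weight k * M k = vweight K a * (real (k * a k) * (if ?s \<le> n then large_coeff K (n - ?s) else 0))"
    if k: "k \<in> {1..n}" "k \<le> K" for k
  proof (cases "a k = 0")
    case False
    then have pos: "0 < a k" and kK: "k \<in> {1..K}" using k by auto
    note s = vsize_dec[of k K a, OF kK pos] and w = vweight_dec[of k K a, OF kK pos]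
    have "?s \<le> n \<longleftrightarrow> vsize K (a(k := a k - 1)) \<le> n - k" "n - k - vsize K (a(k := a k - 1)) = n - ?s"
      using s k by auto
    then have "real k * path_weight k * M k =
        real k * (path_weight k * vweight K (a(k := a k - 1))) * (if ?s \<le> n then large_coeff K (n - ?s) else 0)"
      using M[OF k(1)] k(2) False by simp
    then show ?thesis unfolding w by (simp only: of_nat_mult ac_simps)
  qed (use M[OF k(1)] k(2) in simp)
  have large: "real k * path_weight k * M k =
      vweight K a * (if k \<le> n - ?s \<and> ?s \<le> n then real k * path_weight k * large_coeff K (n - ?s - k) else 0)"
    if k: "k \<in> {1..n}" "\<not> k \<le> K" for k
  proof -
    have "?s \<le> n - k \<longleftrightarrow> k \<le> n - ?s \<and> ?s \<le> n" using k by auto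
    moreover have "n - k - ?s = n - ?s - k" by simp
    ultimately show ?thesis using M[OF k(1)] k(2) by simp
  qed
  have "(\<Sum>k\<in>{1..n}. real k * path_weight k * M k) =
      (\<Sum>k\<in>{k\<in>{1..n}. k \<le> K}. real k * path_weight k * M k) +
      (\<Sum>k\<in>{k\<in>{1..n}. \<not> k \<le> K}. real k * path_weight k * M k)"
  proof -
    have "{1..n} = {k\<in>{1..n}. k \<le> K} \<union> {k\<in>{1..n}. \<not> k \<le> K}" by auto
    moreover have "sum f ({k\<in>{1..n}. k \<le> K} \<union> {k\<in>{1..n}. \<not> k \<le> K}) =
        sum f {k\<in>{1..n}. k \<le> K} + sum f {k\<in>{1..n}. \<not> k \<le> K}" for f :: "nat \<Rightarrow> real"
      by (rule sum.union_disjoint) auto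
    ultimately show ?thesis by metis
  qed
  also have "(\<Sum>k\<in>{k\<in>{1..n}. k \<le> K}. real k * path_weight k * M k) =
      vweight K a * (real (\<Sum>k\<in>{k\<in>{1..n}. k \<le> K}. k * a k) * (if ?s \<le> n then large_coeff K (n - ?s) else 0))"
    unfolding of_nat_sum sum_distrib_right sum_distrib_left by (rule sum.cong[OF refl], rule small) auto
  also have "(\<Sum>k\<in>{k\<in>{1..n}. \<not> k \<le> K}. real k * path_weight k * M k) =
      vweight K a * (\<Sum>k\<in>{k\<in>{1..n}. \<not> k \<le> K}. if k \<le> n - ?s \<and> ?s \<le> n
        then real k * path_weight k * large_coeff K (n - ?s - k) else 0)"
    unfolding sum_distrib_left by (rule sum.cong[OF refl], rule large) auto
  finally have eq: "(\<Sum>k\<in>{1..n}. real k * path_weight k * M k) = vweight K a *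
      (real (\<Sum>k\<in>{k\<in>{1..n}. k \<le> K}. k * a k) * (if ?s \<le> n then large_coeff K (n - ?s) else 0) +
       (\<Sum>k\<in>{k\<in>{1..n}. \<not> k \<le> K}. if k \<le> n - ?s \<and> ?s \<le> n
        then real k * path_weight k * large_coeff K (n - ?s - k) else 0))"
    by (simp add: distrib_left)
  show ?thesis
  proof (cases "?s \<le> n")
    case True
    have "(\<Sum>k\<in>{k\<in>{1..n}. k \<le> K}. k * a k) = ?s"
      unfolding vsize_def
    proof (rule sum.mono_neutral_left)
      \<comment> \<open>A size \<open>k > n\<close> cannot be prescribed when
        \<open>vsize K a \<le> n\<close>, so cutting the sum at \<open>n\<close> loses
        nothing.\<close>
      show "\<forall>k\<in>{1..K} - {k\<in>{1..n}. k \<le> K}. k * a k = 0"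
      proof
        fix k assume k: "k \<in> {1..K} - {k\<in>{1..n}. k \<le> K}"
        then have "k * a k \<le> ?s" unfolding vsize_def by (intro member_le_sum) auto
        moreover have "n < k" using k by auto
        ultimately have "k * a k < k" using True by linarith
        then show "k * a k = 0" by (cases "a k") auto
      qed
    qed auto
    moreover have "(\<Sum>k\<in>{k\<in>{1..n}. \<not> k \<le> K}. if k \<le> n - ?s \<and> ?s \<le> n
        then real k * path_weight k * large_coeff K (n - ?s - k) else 0) = real (n - ?s) * large_coeff K (n - ?s)"
    proof -
      have "(\<Sum>k\<in>{k\<in>{1..n}. \<not> k \<le> K}. if k \<le> n - ?s \<and> ?s \<le> n
          then real k * path_weight k * large_coeff K (n - ?s - k) else 0) =
        (\<Sum>k\<in>{Suc K..n - ?s}. real k * path_weight k * large_coeff K (n - ?s - k))"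
        by (rule sum.mono_neutral_cong_right) (use True in auto)
      also have "\<dots> = real (n - ?s) * large_coeff K (n - ?s)"
        by (simp add: large_coeff_rec)
      finally show ?thesis .
    qed
    ultimately show ?thesis unfolding eq using True by (simp add: of_nat_diff algebra_simps)
  next
    case False
    then show ?thesis unfolding eq by simp
  qed
qed


text \<open>Induction on \<open>card V\<close>, removing the component of one vertex. The answer
  separates the prescribed small components from a forest of large components on the
  \<open>card V - vsize K a\<close> vertices that are left.\<close>

lemma card_forests_comp_count:
  assumes "finite V" and a: "\<forall>l. l \<notin> {1..K} \<longrightarrow> a l = 0"
  shows "real (card {\<C>\<in>path_families V. comp_count K \<C> = a}) =
    fact (card V) * (vweight K a * (if vsize K a \<le> card V then large_coeff K (card V - vsize K a) else 0))"
  using assms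
proof (induction "card V" arbitrary: V a rule: less_induct)
  case less
  show ?case
  proof (cases "V = {}")
    case True
    have fam: "path_families V = {{}}"
    proof -
      have "\<C> = {}" if "\<C> \<in> path_families V" for \<C>
      proof -
        have "\<forall>H\<in>\<C>. is_path H \<and> verts H = {}" using that True by (auto simp: path_families_def)
        then show ?thesis using is_path_nonempty by blast
      qed
      moreover have "{} \<in> path_families V" using True by (simp add: path_families_def)
      ultimately show ?thesis by blast
    qed
    show ?thesis
    proof (cases "a = (\<lambda>_. 0)")
      case a0: True
      have "{\<C>\<in>path_families V. comp_count K \<C> = a} = {{}}"
        unfolding fam a0 by (auto simp: comp_count_def)
      then show ?thesis using True a0 by (simp add: vsize_def vweight_def)
    next
      case False
      then obtain l where l: "a l \<noteq> 0" by (meson ext)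
      have lK: "l \<in> {1..K}" proof (rule ccontr)
        assume "l \<notin> {1..K}"
        then have "a l = 0" by (rule less.prems(2)[rule_format])
        with l show False by contradiction
      qed
      then have "l * a l \<le> vsize K a" unfolding vsize_def by (intro member_le_sum) auto
      moreover have "0 < l * a l" using l lK by auto
      ultimately have "\<not> vsize K a \<le> 0" by linarith
      moreover have "card {\<C>\<in>path_families V. comp_count K \<C> = a} = 0"
        unfolding fam using False by (auto simp: comp_count_def fun_eq_iff)
      ultimately show ?thesis using True by simp
    qed
  next
    case False
    then obtain v where v: "v \<in> V" by blast
    let ?n = "card V"
    have n: "0 < ?n" using False less.prems by (simp add: card_gt_0_iff)
    \<comment> \<open>The count promised by the induction hypothesis for the rest of the forest once
      a component of size \<open>k\<close> is removed, divided by \<open>fact (card V - k)\<close>.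
      It is 0 where the vector \<open>a\<close> forbids such a component.\<close>
    define M where "M k = (if k \<le> K then if a k = 0 then 0 else
         vweight K (a(k := a k - 1)) * (if vsize K (a(k := a k - 1)) \<le> ?n - k
           then large_coeff K (?n - k - vsize K (a(k := a k - 1))) else 0)
       else vweight K a * (if vsize K a \<le> ?n - k then large_coeff K (?n - k - vsize K a) else 0))" for k
    have inner: "(\<Sum>\<C>\<in>path_families (V - U). of_bool (comp_count K (insert H \<C>) = a)) = fact (?n - card U) * M (card U)"
      if U: "v \<in> U" "U \<subseteq> V" and H: "H \<in> paths_over U" for U H
    proof -
      have finU: "finite U" using U less.prems(1) finite_subset by blast
      let ?k = "card U"
      have k: "1 \<le> ?k" using U(1) finU by (simp add: Suc_le_eq card_gt_0_iff) blast
      have vH: "verts H = U" using H by (simp add: paths_over_def)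
      have cardVU: "card (V - U) = ?n - ?k" using U finU by (simp add: card_Diff_subset)
      have lt: "card (V - U) < ?n" using cardVU k n by simp
      have fin: "finite (V - U)" using less.prems(1) by simp
      have cc: "comp_count K (insert H \<C>) = (if ?k \<le> K then (comp_count K \<C>)(?k := Suc (comp_count K \<C> ?k))
          else comp_count K \<C>)" if "\<C> \<in> path_families (V - U)" for \<C>
        using comp_count_insert[OF finite_family[OF that fin] insert_path_family(2)[OF H U(2) that], of K] k vH
        by simp
      have card_sum: "(\<Sum>\<C>\<in>path_families (V - U). of_bool (comp_count K \<C> = b)) =
          real (card {\<C>\<in>path_families (V - U). comp_count K \<C> = b})" for b
        using finite_path_families[OF fin] by (simp add: of_bool_def flip: sum.inter_filter)
      consider "?k \<le> K" "a ?k = 0" | "?k \<le> K" "a ?k \<noteq> 0" | "\<not> ?k \<le> K" by blast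
      then show ?thesis
      proof cases
        case 1
        have "comp_count K (insert H \<C>) \<noteq> a" if "\<C> \<in> path_families (V - U)" for \<C>
          using cc[OF that] 1 by (auto simp: fun_eq_iff intro: exI[of _ ?k])
        then show ?thesis using 1 by (simp add: M_def)
      next
        case 2
        let ?b = "a(?k := a ?k - 1)"
        have "comp_count K (insert H \<C>) = a \<longleftrightarrow> comp_count K \<C> = ?b" if "\<C> \<in> path_families (V - U)" for \<C>
          using cc[OF that] 2 by (auto simp: fun_eq_iff split: if_splits)
        then have "(\<Sum>\<C>\<in>path_families (V - U). of_bool (comp_count K (insert H \<C>) = a)) =
            (\<Sum>\<C>\<in>path_families (V - U). of_bool (comp_count K \<C> = ?b) :: real)" by simp
        also have "\<dots> = fact (?n - ?k) * M ?k"
        proof -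
          have "\<forall>l. l \<notin> {1..K} \<longrightarrow> ?b l = 0"
            using less.prems(2) by simp
          note IH = less.hyps[OF lt fin, of ?b, OF this]
          have "M ?k = vweight K ?b * (if vsize K ?b \<le> ?n - ?k then large_coeff K (?n - ?k - vsize K ?b) else 0)"
            unfolding M_def using 2 by presburger
          then show ?thesis by (simp only: card_sum IH cardVU)
        qed
        finally show ?thesis .
      next
        case 3
        have "comp_count K (insert H \<C>) = a \<longleftrightarrow> comp_count K \<C> = a" if "\<C> \<in> path_families (V - U)" for \<C>
          using cc[OF that] 3 by simp
        then have "(\<Sum>\<C>\<in>path_families (V - U). of_bool (comp_count K (insert H \<C>) = a)) =
            (\<Sum>\<C>\<in>path_families (V - U). of_bool (comp_count K \<C> = a) :: real)" by simp
        also have "\<dots> = fact (?n - ?k) * M ?k"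
          unfolding card_sum using less.hyps[OF lt fin less.prems(2)] 3
          by (simp add: M_def cardVU)
        finally show ?thesis .
      qed
    qed
    let ?S = "{U. v \<in> U \<and> U \<subseteq> V}"
    have finS: "finite ?S" using less.prems(1) by simp
    have "real (card {\<C>\<in>path_families V. comp_count K \<C> = a}) =
        (\<Sum>\<C>\<in>path_families V. of_bool (comp_count K \<C> = a))"
      using finite_path_families[OF less.prems(1)] by (simp add: of_bool_def flip: sum.inter_filter)
    also have "\<dots> = (\<Sum>U\<in>?S. \<Sum>H\<in>paths_over U. \<Sum>\<C>\<in>path_families (V - U). of_bool (comp_count K (insert H \<C>) = a))"
      by (rule sum_path_families[OF less.prems(1) v])
    also have "\<dots> = (\<Sum>U\<in>?S. fact (card U) * path_weight (card U) * (fact (?n - card U) * M (card U)))"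
    proof (rule sum.cong[OF refl])
      fix U assume "U \<in> ?S"
      then have U: "v \<in> U" "U \<subseteq> V" by auto
      then have "finite U" "U \<noteq> {}" using less.prems(1) finite_subset by blast+
      note c = card_paths_over[OF this]
      show "(\<Sum>H\<in>paths_over U. \<Sum>\<C>\<in>path_families (V - U). of_bool (comp_count K (insert H \<C>) = a)) =
          fact (card U) * path_weight (card U) * (fact (?n - card U) * M (card U))"
        using inner[OF U] by (simp add: c)
    qed
    also have "\<dots> = (\<Sum>k\<in>{1..?n}. \<Sum>U\<in>{U\<in>?S. card U = k}. fact (card U) * path_weight (card U) * (fact (?n - card U) * M (card U)))"
    proof (rule sum.group[symmetric, OF finS])
      show "card ` ?S \<subseteq> {1..?n}"
      proof
        fix k assume "k \<in> card ` ?S"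
        then obtain U where U: "v \<in> U" "U \<subseteq> V" "k = card U" by blast
        then have "finite U" "U \<noteq> {}" using less.prems(1) finite_subset by blast+
        then show "k \<in> {1..?n}" using U less.prems(1) by (simp add: card_mono Suc_le_eq card_gt_0_iff)
      qed
    qed simp
    also have "\<dots> = (\<Sum>k\<in>{1..?n}. fact (?n - 1) * (real k * path_weight k * M k))"
    proof (rule sum.cong[OF refl])
      fix k assume k: "k \<in> {1..?n}"
      have eq: "{U\<in>?S. card U = k} = {U. v \<in> U \<and> U \<subseteq> V \<and> card U = k}" by auto
      have "(\<Sum>U\<in>{U\<in>?S. card U = k}. fact (card U) * path_weight (card U) * (fact (?n - card U) * M (card U))) =
          (\<Sum>U\<in>{U\<in>?S. card U = k}. fact k * path_weight k * (fact (?n - k) * M k))"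
        by (rule sum.cong) auto
      also have "\<dots> = real ((?n - 1) choose (k - 1)) * (fact k * path_weight k * (fact (?n - k) * M k))"
        unfolding eq using card_subsets_containing[OF less.prems(1) v] k by simp
      \<comment> \<open>The binomial coefficient counts the vertex sets of size \<open>k\<close>
        containing \<open>v\<close>; against \<open>fact k * fact (?n - k)\<close> it collapses to
        \<open>k * fact (?n - 1)\<close>.\<close>
      also have "\<dots> = fact (?n - 1) * (real k * path_weight k * M k)"
      proof -
        have b: "fact (k - 1) * fact (?n - k) * real ((?n - 1) choose (k - 1)) = fact (?n - 1)"
        proof -
          have "?n - 1 - (k - 1) = ?n - k" "k - 1 \<le> ?n - 1" using k by auto
          then have "fact (k - 1) * fact (?n - k) * ((?n - 1) choose (k - 1)) = (fact (?n - 1) :: nat)"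
            using binomial_fact_lemma[of "k - 1" "?n - 1"] by simp
          then have "real (fact (k - 1) * fact (?n - k) * ((?n - 1) choose (k - 1))) = real (fact (?n - 1))"
            by (rule arg_cong)
          then show ?thesis by (simp only: of_nat_mult of_nat_fact)
        qed
        have "fact k = real k * fact (k - 1)" using k by (simp add: fact_reduce)
        then show ?thesis unfolding b[symmetric] by simp
      qed
      finally show "(\<Sum>U\<in>{U\<in>?S. card U = k}. fact (card U) * path_weight (card U) * (fact (?n - card U) * M (card U))) =
          fact (?n - 1) * (real k * path_weight k * M k)" .
    qed
    also have "\<dots> = fact (?n - 1) * (real ?n * (vweight K a * (if vsize K a \<le> ?n then large_coeff K (?n - vsize K a) else 0)))"
    proof -
      have "(\<Sum>k\<in>{1..?n}. real k * path_weight k * M k) =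
          real ?n * (vweight K a * (if vsize K a \<le> ?n then large_coeff K (?n - vsize K a) else 0))"
        by (rule forest_count_step[OF _ n]) (use less.prems(2) in \<open>auto simp: M_def\<close>)
      then show ?thesis by (simp only: sum_distrib_left[symmetric])
    qed
    also have "\<dots> = fact ?n * (vweight K a * (if vsize K a \<le> ?n then large_coeff K (?n - vsize K a) else 0))"
      using n by (simp add: fact_reduce)
    finally show ?thesis .
  qed
qed

section \<open>Asymptotics of the coefficients\<close>

abbreviation forest_coeff :: "nat \<Rightarrow> real" where
  "forest_coeff \<equiv> large_coeff 0"

definition coeff_diff :: "nat \<Rightarrow> real" where
  "coeff_diff n = forest_coeff (Suc n) - forest_coeff n"

lemma large_coeff_nonneg: "0 \<le> large_coeff K n"
proof (induction n rule: less_induct)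
  case (less n)
  show ?case
  proof (cases "n = 0")
    case False
    have "0 \<le> (\<Sum>k\<in>{Suc K..n}. real k * path_weight k * large_coeff K (n - k))"
      using less False path_weight_pos by (intro sum_nonneg mult_nonneg_nonneg) (auto intro: less_imp_le)
    then show ?thesis using False by (subst large_coeff.simps) simp
  qed simp
qed

text \<open>\<open>k * path_weight k\<close> is \<open>k / 2\<close> except for an additional
  \<open>1 / 2\<close> at \<open>k = 1\<close>, which produces the separate first term.\<close>

lemma forest_coeff_rec:
  assumes "0 < n"
  shows "real n * forest_coeff n = forest_coeff (n - 1) / 2 + (\<Sum>j<n. real (n - j) * forest_coeff j) / 2"
proof -
  have w: "real k * path_weight k = real k / 2 + (if k = 1 then 1 / 2 else 0)" for k
    by (simp add: path_weight_def)
  have "real n * forest_coeff n = (\<Sum>k\<in>{1..n}. real k * path_weight k * forest_coeff (n - k))"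
    using assms large_coeff_rec[of n 0] by simp
  also have "\<dots> = (\<Sum>k\<in>{1..n}. real k / 2 * forest_coeff (n - k)) +
      (\<Sum>k\<in>{1..n}. if k = 1 then forest_coeff (n - k) / 2 else 0)"
    unfolding sum.distrib[symmetric] by (rule sum.cong[OF refl], subst w) (simp add: algebra_simps)
  also have "(\<Sum>k\<in>{1..n}. if k = 1 then forest_coeff (n - k) / 2 else 0) = forest_coeff (n - 1) / 2"
    using assms by (subst sum.delta) auto
  also have "(\<Sum>k\<in>{1..n}. real k / 2 * forest_coeff (n - k)) = (\<Sum>j<n. real (n - j) * forest_coeff j / 2)"
    by (rule sum.reindex_bij_witness[of _ "\<lambda>j. n - j" "\<lambda>k. n - k"]) (use assms in auto)
  finally show ?thesis by (simp add: sum_divide_distrib)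
qed

text \<open>Differencing the recurrence replaces the linear weights \<open>n - j\<close> by constant
  ones, and the boundary terms cancel the last two summands. The right side is nonnegative, whence
  monotonicity of the coefficients.\<close>

lemma coeff_diff_sum:
  assumes "0 < n"
  shows "real (Suc n) * coeff_diff n = (\<Sum>j<n - 1. forest_coeff j) / 2"
proof -
  have "(\<Sum>j<Suc n. real (Suc n - j) * forest_coeff j) =
      (\<Sum>j<n. real (n - j) * forest_coeff j) + (\<Sum>j<Suc n. forest_coeff j)"
  proof -
    have "(\<Sum>j<Suc n. real (Suc n - j) * forest_coeff j) =
        (\<Sum>j<Suc n. real (n - j) * forest_coeff j + forest_coeff j)"
      by (rule sum.cong) (auto simp: Suc_diff_le algebra_simps)
    then show ?thesis by (simp add: sum.distrib)
  qed
  moreover obtain m where m: "n = Suc m" using assms by (cases n) auto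
  ultimately show ?thesis
    using forest_coeff_rec[of n] forest_coeff_rec[of "Suc n"]
    by (simp add: coeff_diff_def algebra_simps add_divide_distrib)
qed

lemma forest_coeff_1: "forest_coeff (Suc 0) = 1"
  using forest_coeff_rec[of "Suc 0"] by simp

lemma coeff_diff_nonneg: "0 \<le> coeff_diff n"
proof (cases "n = 0")
  case False
  then have "real (Suc n) * coeff_diff n = (\<Sum>j<n - 1. forest_coeff j) / 2"
    by (simp only: coeff_diff_sum neq0_conv)
  moreover have "0 \<le> (\<Sum>j<n - 1. forest_coeff j) / 2"
    by (simp add: sum_nonneg large_coeff_nonneg)
  ultimately have "0 \<le> real (Suc n) * coeff_diff n" by linarith
  then show ?thesis by (simp add: zero_le_mult_iff)
qed (simp add: coeff_diff_def forest_coeff_1)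

lemma forest_coeff_mono: "m \<le> n \<Longrightarrow> forest_coeff m \<le> forest_coeff n"
  by (rule lift_Suc_mono_le) (use coeff_diff_nonneg in \<open>auto simp: coeff_diff_def\<close>)

lemma forest_coeff_ge_1: "1 \<le> forest_coeff n"
  using forest_coeff_mono[of 0 n] by simp

lemma coeff_diff_rec:
  assumes "2 \<le> n"
  shows "real (Suc n) * coeff_diff n = real n * coeff_diff (n - 1) + forest_coeff (n - 2) / 2"
proof -
  obtain m where m: "n = Suc (Suc m)" using assms by (metis add_2_eq_Suc le_Suc_ex)
  show ?thesis
    using coeff_diff_sum[of n] coeff_diff_sum[of "n - 1"] by (simp add: m add_divide_distrib)
qed

text \<open>Read as \<open>\<rho> n \<le> 1 / sqrt n\<close> for the ratio \<open>\<rho> n = coeff_diff n / forest_coeff n\<close>; it is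
  inductive because \<open>\<rho> n \<le> n / (n + 1) * (\<rho> (n - 1) / (1 + \<rho> (n - 1))) + 1 / (2 * (n + 1))\<close>.\<close>

lemma coeff_diff_le:
  assumes "1 \<le> n"
  shows "coeff_diff n * sqrt (real n) \<le> forest_coeff n"
  using assms
proof (induction n rule: nat_induct_at_least)
  case base
  have "coeff_diff 1 = 0" using coeff_diff_sum[of 1] by simp
  then show ?case by (simp add: forest_coeff_1)
next
  case (Suc m)
  define g where "g = forest_coeff m"
  define d where "d = coeff_diff m"
  define t where "t = sqrt (real (Suc m))"
  define s where "s = sqrt (real m)"
  have t: "1 \<le> t" "t * t = real (Suc m)" and s: "1 \<le> s" "s * s = real m"
    using Suc.hyps by (auto simp: t_def s_def)
  have d: "0 \<le> d" "d * s \<le> g" using Suc.IH coeff_diff_nonneg by (auto simp: d_def g_def s_def)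
  have g: "1 \<le> g" using forest_coeff_ge_1 by (simp add: g_def)
  have rec: "(t * t + 1) * coeff_diff (Suc m) \<le> t * t * d + g / 2"
  proof -
    have "real (Suc (Suc m)) * coeff_diff (Suc m) = real (Suc m) * d + forest_coeff (m - 1) / 2"
      using coeff_diff_rec[of "Suc m"] Suc.hyps by (simp add: d_def numeral_2_eq_2)
    moreover have "forest_coeff (m - 1) \<le> g" unfolding g_def by (rule forest_coeff_mono) simp
    ultimately show ?thesis using t(2) by simp
  qed
  \<comment> \<open>Since \<open>s * s = t * t - 1\<close>, this turns the induction hypothesis
    \<open>d * s \<le> g\<close> into \<open>d * (t * t - 1) \<le> g * t\<close>, which is free of
    \<open>s\<close>.\<close>
  have st: "t * t - 1 \<le> s * t"
  proof -
    have "s \<le> t" by (simp add: s_def t_def)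
    then have "s * s \<le> s * t" using s(1) by (intro mult_left_mono) auto
    then show ?thesis using s(2) t(2) by simp
  qed
  have "t * (t * t * d + g / 2) \<le> (t * t + 1) * (g + d)"
  proof -
    have "d * (t * t - 1) \<le> g * t"
    proof -
      have "d * (t * t - 1) \<le> d * (s * t)" using st d(1) by (rule mult_left_mono)
      also have "\<dots> = (d * s) * t" by simp
      also have "\<dots> \<le> g * t" using d(2) t(1) by (intro mult_right_mono) auto
      finally show ?thesis .
    qed
    \<comment> \<open>The coefficient of \<open>d\<close> once the goal is sorted into
      \<open>d * ?c \<le> g * (t * t + 1 - t / 2)\<close>. If it is nonnegative, multiplying by
      \<open>t * t - 1\<close> lets the bound on \<open>d * (t * t - 1)\<close> eliminate
      \<open>d\<close>; the slack that remains is \<open>t^3 / 2 + 3 * t / 2 - 1\<close>, positive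
      for \<open>t \<ge> 1\<close>.\<close>
    let ?c = "t * t * t - t * t - 1"
    have t2: "0 < t * t - 1" using t(2) Suc.hyps by simp
    have "d * ?c \<le> g * (t * t + 1 - t / 2)"
    proof (cases "0 \<le> ?c")
      case True
      have "(t * t - 1) * (d * ?c) \<le> (g * t) * ?c"
        using mult_right_mono[OF \<open>d * (t * t - 1) \<le> g * t\<close> True] by (simp only: mult_ac)
      also have "\<dots> = g * (t * ?c)" by simp
      also have "\<dots> \<le> g * ((t * t - 1) * (t * t + 1 - t / 2))"
      proof (rule mult_left_mono)
        have "1 * 1 \<le> t * t" using t(1) by (intro mult_mono) auto
        then have "1 * 1 \<le> t * t * t" using t(1) by (intro mult_mono) auto
        moreover have "(t * t - 1) * (t * t + 1 - t / 2) - t * ?c = t * t * t / 2 + 3 * t / 2 - 1"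
          by (simp add: field_simps)
        ultimately show "t * ?c \<le> (t * t - 1) * (t * t + 1 - t / 2)" using t(1) by linarith
      qed (use g in simp)
      also have "\<dots> = (t * t - 1) * (g * (t * t + 1 - t / 2))" by (simp only: mult_ac)
      finally show ?thesis using t2 by (simp only: mult_le_cancel_left_pos)
    next
      case False
      then have "d * ?c \<le> 0" using d(1) by (simp add: mult_nonneg_nonpos)
      moreover have "t * 1 \<le> t * t" using t(1) by (intro mult_left_mono) auto
      then have "0 \<le> t * t + 1 - t / 2" using t(1) by linarith
      then have "0 \<le> g * (t * t + 1 - t / 2)" using g by simp
      ultimately show ?thesis by linarith
    qed
    then show ?thesis by (simp add: algebra_simps)
  qed
  then have "t * ((t * t + 1) * coeff_diff (Suc m)) \<le> (t * t + 1) * (g + d)"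
    using mult_left_mono[OF rec, of t] t(1) by linarith
  then have "(t * t + 1) * (coeff_diff (Suc m) * t) \<le> (t * t + 1) * (g + d)"
    by (simp add: mult_ac)
  moreover have "0 < t * t + 1" using t(2) by simp
  ultimately have "coeff_diff (Suc m) * t \<le> g + d" by (simp only: mult_le_cancel_left_pos)
  then show ?case by (simp add: t_def g_def d_def coeff_diff_def)
qed

text \<open>For consecutive coefficients the ratio is
  \<open>1 / (1 + coeff_diff n / forest_coeff n)\<close>, and the inner quotient is at most
  \<open>1 / sqrt n\<close>. Larger shifts are products of such ratios.\<close>

lemma forest_coeff_ratio: "(\<lambda>n. forest_coeff (n - s) / forest_coeff n) \<longlonglongrightarrow> 1"
proof -
  have pos: "0 < forest_coeff n" for n using forest_coeff_ge_1[of n] by linarith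
  have "(\<lambda>n. coeff_diff n / forest_coeff n) \<longlonglongrightarrow> 0"
  proof (rule tendsto_sandwich[where f = "\<lambda>_. 0" and h = "\<lambda>n. 1 / sqrt (real n)"])
    show "\<forall>\<^sub>F n in sequentially. coeff_diff n / forest_coeff n \<le> 1 / sqrt (real n)"
      using eventually_ge_at_top[of 1]
    proof eventually_elim
      case (elim n)
      then show ?case using coeff_diff_le[of n] pos[of n] by (simp add: field_simps)
    qed
    show "\<forall>\<^sub>F n in sequentially. 0 \<le> coeff_diff n / forest_coeff n"
      using coeff_diff_nonneg pos by (simp add: less_imp_le)
    show "(\<lambda>n. 1 / sqrt (real n)) \<longlonglongrightarrow> 0"
      by (rule tendsto_divide_0[OF tendsto_const])
        (rule filterlim_compose[OF filterlim_at_top_imp_at_infinity[OF sqrt_at_top] filterlim_real_sequentially])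
  qed simp
  then have "(\<lambda>n. 1 / (1 + coeff_diff n / forest_coeff n)) \<longlonglongrightarrow> 1 / (1 + 0)"
    by (intro tendsto_intros) auto
  moreover have "1 / (1 + coeff_diff n / forest_coeff n) = forest_coeff n / forest_coeff (Suc n)" for n
    using pos[of n] pos[of "Suc n"] by (simp add: coeff_diff_def field_simps)
  ultimately have one: "(\<lambda>n. forest_coeff n / forest_coeff (Suc n)) \<longlonglongrightarrow> 1" by simp
  have "(\<lambda>n. forest_coeff n / forest_coeff (n + s)) \<longlonglongrightarrow> 1"
  proof (induction s)
    case 0
    have "forest_coeff n / forest_coeff (n + 0) = 1" for n using pos[of n] by simp
    then show ?case by simp
  next
    case (Suc s)
    have "(\<lambda>n. (forest_coeff n / forest_coeff (n + s)) * (forest_coeff (n + s) / forest_coeff (Suc (n + s)))) \<longlonglongrightarrow> 1 * 1"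
      by (intro tendsto_mult Suc LIMSEQ_ignore_initial_segment[OF one, of s])
    moreover have "(forest_coeff n / forest_coeff (n + s)) * (forest_coeff (n + s) / forest_coeff (Suc (n + s))) =
        forest_coeff n / forest_coeff (n + Suc s)" for n
      using pos[of "n + s"] by simp
    ultimately show ?case by (simp only: mult_1)
  qed
  then have "(\<lambda>n. forest_coeff (n + s - s) / forest_coeff (n + s)) \<longlonglongrightarrow> 1" by simp
  then show ?thesis by (rule LIMSEQ_offset)
qed

text \<open>Dominated convergence for series: the \<open>i\<close>-th term tends to
  \<open>b i * c\<close>, and it is bounded by a constant multiple of the absolute value of
  \<open>b i\<close> because monotonicity keeps \<open>g (n - i) / g n\<close> at most 1.\<close>

lemma convolution_limit:
  fixes b x g :: "nat \<Rightarrow> real"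
  assumes b: "summable (\<lambda>i. \<bar>b i\<bar>)" and g: "\<And>n. 0 < g n" "mono g"
    and ratio: "\<And>i. (\<lambda>n. g (n - i) / g n) \<longlonglongrightarrow> 1"
    and x: "(\<lambda>n. x n / g n) \<longlonglongrightarrow> c"
  shows "(\<lambda>n. (\<Sum>i\<le>n. b i * x (n - i)) / g n) \<longlonglongrightarrow> suminf b * c"
proof -
  define a where "a i n = (if i \<le> n then b i * (x (n - i) / g n) else 0)" for i n
  obtain B where B: "0 < B" "\<And>n. \<bar>x n / g n\<bar> \<le> B"
    using convergent_imp_Bseq[OF convergentI[OF x]] by (auto simp: Bseq_def)
  have split: "x (n - i) / g n = (x (n - i) / g (n - i)) * (g (n - i) / g n)" for n i
    using g(1)[of "n - i"] by simp
  have lim: "(\<lambda>n. a i n) \<longlonglongrightarrow> b i * c" for i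
  proof -
    have "(\<lambda>n. x (n - i) / g (n - i)) \<longlonglongrightarrow> c"
      by (rule LIMSEQ_offset[of _ i]) (use x in simp)
    then have "(\<lambda>n. b i * ((x (n - i) / g (n - i)) * (g (n - i) / g n))) \<longlonglongrightarrow> b i * (c * 1)"
      by (intro tendsto_mult tendsto_const ratio)
    moreover have "\<forall>\<^sub>F n in sequentially. b i * ((x (n - i) / g (n - i)) * (g (n - i) / g n)) = a i n"
      using eventually_ge_at_top[of i] by eventually_elim (simp only: a_def if_True split[symmetric])
    ultimately have "a i \<longlonglongrightarrow> b i * (c * 1)" by (rule Lim_transform_eventually)
    then show ?thesis by simp
  qed
  have bound: "norm (a i n) \<le> \<bar>b i\<bar> * B" for i n
  proof (cases "i \<le> n")
    case True
    have "\<bar>g (n - i) / g n\<bar> \<le> 1"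
      using g(1)[of n] g(1)[of "n - i"] monoD[OF g(2), of "n - i" n] by simp
    then have "\<bar>x (n - i) / g (n - i)\<bar> * \<bar>g (n - i) / g n\<bar> \<le> B * 1"
      using B by (intro mult_mono) auto
    then have "\<bar>x (n - i) / g n\<bar> \<le> B" unfolding split abs_mult by simp
    then have "\<bar>b i\<bar> * \<bar>x (n - i) / g n\<bar> \<le> \<bar>b i\<bar> * B" by (intro mult_left_mono) auto
    then show ?thesis using True by (simp add: a_def abs_mult)
  qed (use B in \<open>simp add: a_def\<close>)
  have "(\<lambda>n. suminf (\<lambda>i. a i n)) \<longlonglongrightarrow> (\<Sum>i. b i * c)"
  proof -
    have "\<forall>\<^sub>F (i, n) in at_top \<times>\<^sub>F sequentially. norm (a i n) \<le> \<bar>b i\<bar> * B"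
      by (rule always_eventually) (use bound in auto)
    from tannerys_theorem[OF lim this summable_mult2[OF b]] show ?thesis by simp
  qed
  moreover have "suminf (\<lambda>i. a i n) = (\<Sum>i\<le>n. b i * x (n - i)) / g n" for n
  proof -
    have "suminf (\<lambda>i. a i n) = (\<Sum>i\<le>n. a i n)"
      by (rule suminf_finite) (auto simp: a_def)
    then show ?thesis by (simp add: a_def sum_divide_distrib)
  qed
  moreover have "(\<Sum>i. b i * c) = suminf b * c"
    by (rule suminf_mult2[OF summable_rabs_cancel[OF b], symmetric])
  ultimately show ?thesis by simp
qed

section \<open>Forbidding one component size by multiplication of power series\<close>

text \<open>The series z C'(z), where C is the generating function of paths with more than
  \<open>K\<close> vertices. With constant term 1, the equation z F' = z C' F characterises F = exp
  C without composing power series.\<close>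

definition component_fps :: "nat \<Rightarrow> real fps" where
  "component_fps K = Abs_fps (\<lambda>k. if K < k then real k * path_weight k else 0)"

lemma large_coeff_fps:
  "fps_X * fps_deriv (Abs_fps (large_coeff K)) = component_fps K * Abs_fps (large_coeff K)"
proof (rule fps_ext)
  fix n
  have "fps_nth (component_fps K * Abs_fps (large_coeff K)) n =
      (\<Sum>k=0..n. if K < k then real k * path_weight k * large_coeff K (n - k) else 0)"
    unfolding fps_mult_nth component_fps_def by (rule sum.cong) auto
  also have "\<dots> = (\<Sum>k\<in>{Suc K..n}. real k * path_weight k * large_coeff K (n - k))"
    by (rule sum.mono_neutral_cong_right) auto
  also have "\<dots> = real n * large_coeff K n"
    by (simp add: large_coeff_rec)
  finally show "fps_nth (fps_X * fps_deriv (Abs_fps (large_coeff K))) n =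
      fps_nth (component_fps K * Abs_fps (large_coeff K)) n"
    by (cases n) auto
qed

text \<open>As \<open>component_fps K\<close> has no constant term, the equation determines the
  \<open>n\<close>-th coefficient from the earlier ones.\<close>

lemma large_coeff_fps_unique:
  assumes "fps_X * fps_deriv F = component_fps K * F" "fps_nth F 0 = 1"
  shows "F = Abs_fps (large_coeff K)"
proof (rule fps_ext)
  fix n
  show "fps_nth F n = fps_nth (Abs_fps (large_coeff K)) n"
  proof (induction n rule: less_induct)
    case (less n)
    show ?case
    proof (cases "n = 0")
      case False
      have coeff: "real n * fps_nth A n = (\<Sum>k=0..n. fps_nth (component_fps K) k * fps_nth A (n - k))"
        if "fps_X * fps_deriv A = component_fps K * A" for A
      proof -
        have "fps_nth (fps_X * fps_deriv A) n = real n * fps_nth A n" using False by (cases n) auto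
        then show ?thesis by (simp add: that fps_mult_nth)
      qed
      have "(\<Sum>k=0..n. fps_nth (component_fps K) k * fps_nth F (n - k)) =
          (\<Sum>k=0..n. fps_nth (component_fps K) k * fps_nth (Abs_fps (large_coeff K)) (n - k))"
      proof (rule sum.cong[OF refl])
        fix k assume "k \<in> {0..n}"
        show "fps_nth (component_fps K) k * fps_nth F (n - k) = fps_nth (component_fps K) k * fps_nth (Abs_fps (large_coeff K)) (n - k)"
        proof (cases "k = 0")
          case True
          then show ?thesis by (simp add: component_fps_def)
        next
          case k0: False
          then show ?thesis using less[of "n - k"] False by simp
        qed
      qed
      then have "real n * fps_nth F n = real n * fps_nth (Abs_fps (large_coeff K)) n"
        using coeff[OF assms(1)] coeff[OF large_coeff_fps] by simp
      then show ?thesis using False by simp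
    qed (use assms(2) in simp)
  qed
qed

text \<open>Coefficients of \<open>exp (- path_weight K * z\<^sup>K)\<close>: multiplying by this power series removes
  the components with exactly \<open>K\<close> vertices.\<close>

definition removal_coeff :: "nat \<Rightarrow> nat \<Rightarrow> real" where
  "removal_coeff K i = (if K dvd i then (- path_weight K) ^ (i div K) / fact (i div K) else 0)"

lemma removal_coeff_fps:
  assumes "0 < K"
  shows "fps_X * fps_deriv (Abs_fps (removal_coeff K)) =
    fps_const (- (real K * path_weight K)) * fps_X ^ K * Abs_fps (removal_coeff K)"
proof (rule fps_ext)
  fix n
  have "real n * removal_coeff K n = (if n < K then 0 else - (real K * path_weight K) * removal_coeff K (n - K))"
  proof (cases "K dvd n")
    case True
    then obtain j where j: "n = K * j" by (rule dvdE)
    show ?thesis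
    proof (cases j)
      case 0
      then show ?thesis using j assms by simp
    next
      case (Suc i)
      have "n - K = K * i" "\<not> n < K" using j Suc by auto
      moreover have "real (K * Suc i) * ((- path_weight K) ^ Suc i / fact (Suc i)) =
          - (real K * path_weight K) * ((- path_weight K) ^ i / fact i)"
      proof -
        have "k * c * (- p * q / (c * f)) = - (k * p) * (q / f)" if "c \<noteq> 0" for k c p q f :: real
          using that by simp
        from this[of "real (Suc i)" "real K" "path_weight K" "(- path_weight K) ^ i" "fact i"]
        show ?thesis by (simp only: of_nat_mult fact_Suc power_Suc of_nat_fact)
      qed
      ultimately show ?thesis using assms by (simp add: removal_coeff_def j Suc del: of_nat_mult of_nat_Suc fact_Suc power_Suc)
    qed
  next
    case False
    then have "\<not> K dvd n - K" if "\<not> n < K" using that by (simp add: dvd_minus_self)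
    then show ?thesis using False by (simp add: removal_coeff_def)
  qed
  then show "fps_nth (fps_X * fps_deriv (Abs_fps (removal_coeff K))) n =
      fps_nth (fps_const (- (real K * path_weight K)) * fps_X ^ K * Abs_fps (removal_coeff K)) n"
    by (cases n) (auto simp: mult.assoc fps_X_power_mult_nth)
qed

text \<open>Multiplying F by exp (- w z^(K+1)), with w the weight of size \<open>K + 1\<close>,
  subtracts (K+1) w z^(K+1) from z F' / F. This is the passage from \<open>component_fps K\<close>
  to \<open>component_fps (Suc K)\<close>, and uniqueness identifies the product.\<close>

lemma large_coeff_convolution:
  "large_coeff (Suc K) n = (\<Sum>i\<le>n. removal_coeff (Suc K) i * large_coeff K (n - i))"
proof -
  let ?E = "Abs_fps (removal_coeff (Suc K))" and ?A = "Abs_fps (large_coeff K)"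
  have comp: "component_fps K = component_fps (Suc K) + fps_const (real (Suc K) * path_weight (Suc K)) * fps_X ^ Suc K"
  proof (rule fps_ext)
    fix n
    show "fps_nth (component_fps K) n =
        fps_nth (component_fps (Suc K) + fps_const (real (Suc K) * path_weight (Suc K)) * fps_X ^ Suc K) n"
      by (cases "n = Suc K") (auto simp: component_fps_def fps_X_power_nth simp del: power_Suc)
  qed
  have "fps_X * fps_deriv (?E * ?A) = ?E * (fps_X * fps_deriv ?A) + (fps_X * fps_deriv ?E) * ?A"
    by (simp add: algebra_simps)
  also have "\<dots> = component_fps (Suc K) * (?E * ?A)"
  proof -
    have "E * ((D + c * X) * A) + (- c * X * E) * A = D * (E * A)" for A D E X c :: "real fps"
      by (simp add: algebra_simps)
    then show ?thesis
      unfolding large_coeff_fps removal_coeff_fps[OF zero_less_Suc] comp fps_const_neg[symmetric] .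
  qed
  finally have "?E * ?A = Abs_fps (large_coeff (Suc K))"
    by (rule large_coeff_fps_unique) (simp add: removal_coeff_def)
  then have "fps_nth (?E * ?A) n = large_coeff (Suc K) n" by simp
  then show ?thesis by (simp add: fps_mult_nth atLeast0AtMost)
qed

lemma removal_coeff_sums:
  assumes "0 < K"
  shows "removal_coeff K sums exp (- path_weight K)" "summable (\<lambda>i. \<bar>removal_coeff K i\<bar>)"
proof -
  have mono: "strict_mono (\<lambda>j. K * j)" using assms by (simp add: strict_mono_def)
  have zero: "removal_coeff K n = 0" if "n \<notin> range (\<lambda>j. K * j)" for n
    using that by (auto simp: removal_coeff_def elim!: dvdE)
  have val: "removal_coeff K (K * j) = (- path_weight K) ^ j /\<^sub>R fact j" for j
    using assms by (simp add: removal_coeff_def field_simps)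
  show "removal_coeff K sums exp (- path_weight K)"
    using sums_mono_reindex[OF mono, of "removal_coeff K"] zero exp_converges[of "- path_weight K"] by (simp add: val)
  have "(\<lambda>j. \<bar>removal_coeff K (K * j)\<bar>) sums exp (path_weight K)"
    using exp_converges[of "path_weight K"] path_weight_pos[of K] by (simp add: val abs_mult power_abs)
  then have "(\<lambda>i. \<bar>removal_coeff K i\<bar>) sums exp (path_weight K)"
    using sums_mono_reindex[OF mono, of "\<lambda>i. \<bar>removal_coeff K i\<bar>"] zero by simp
  then show "summable (\<lambda>i. \<bar>removal_coeff K i\<bar>)" by (rule sums_summable)
qed

text \<open>Each step convolves with \<open>removal_coeff (Suc K)\<close>, whose sum
  \<open>exp (- path_weight (Suc K))\<close> is the new factor of the limit. The product is the
  limiting probability that no component has at most \<open>K\<close> vertices.\<close>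

lemma large_coeff_limit:
  "(\<lambda>n. large_coeff K n / forest_coeff n) \<longlonglongrightarrow> (\<Prod>l\<in>{1..K}. exp (- path_weight l))"
proof (induction K)
  case 0
  have "forest_coeff n / forest_coeff n = 1" for n using forest_coeff_ge_1[of n] by simp
  then show ?case by simp
next
  case (Suc K)
  have "(\<lambda>n. (\<Sum>i\<le>n. removal_coeff (Suc K) i * large_coeff K (n - i)) / forest_coeff n)
      \<longlonglongrightarrow> suminf (removal_coeff (Suc K)) * (\<Prod>l\<in>{1..K}. exp (- path_weight l))"
  proof (rule convolution_limit)
    show "0 < forest_coeff n" for n using forest_coeff_ge_1[of n] by linarith
    show "mono forest_coeff" by (rule monoI) (rule forest_coeff_mono)
  qed (use removal_coeff_sums(2)[of "Suc K"] Suc forest_coeff_ratio in auto)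
  moreover have "suminf (removal_coeff (Suc K)) = exp (- path_weight (Suc K))"
    using removal_coeff_sums(1)[of "Suc K"] by (simp add: sums_iff)
  ultimately show ?case
    by (simp add: mult.commute flip: large_coeff_convolution)
qed

section \<open>Convergence of the component counts\<close>

lemma pmf_finite_approx:
  fixes p :: "'a pmf"
  assumes "0 < \<epsilon>"
  obtains F where "finite F" "1 - \<epsilon> < measure_pmf.prob p F"
proof -
  define A where "A n = from_nat_into (set_pmf p) ` {..<n}" for n :: nat
  have "(\<lambda>n. measure_pmf.prob p (A n)) \<longlonglongrightarrow> measure_pmf.prob p (\<Union>n. A n)"
    by (rule measure_pmf.finite_Lim_measure_incseq) (auto simp: A_def incseq_def)
  moreover have "(\<Union>n. A n) = set_pmf p"
    using range_from_nat_into[OF set_pmf_not_empty countable_set_pmf, of p]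
    by (auto simp: A_def)
  ultimately have "(\<lambda>n. measure_pmf.prob p (A n)) \<longlonglongrightarrow> 1"
    by (simp add: measure_pmf.prob_eq_1[THEN iffD2] AE_measure_pmf)
  then have "\<forall>\<^sub>F n in sequentially. 1 - \<epsilon> < measure_pmf.prob p (A n)"
    using assms by (intro order_tendstoD) auto
  then obtain n where "1 - \<epsilon> < measure_pmf.prob p (A n)"
    by (auto simp: eventually_sequentially)
  then show thesis by (intro that[of "A n"]) (simp_all add: A_def)
qed

text \<open>No mass escapes because the pointwise limit is itself a probability distribution: a
  finite set carrying almost all of \<open>q\<close> eventually carries almost all of
  \<open>p n\<close>, and on finite sets pointwise convergence suffices.\<close>

lemma pmf_tendsto_imp_measure_tendsto:
  fixes p :: "nat \<Rightarrow> 'a pmf"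
  assumes "\<And>a. (\<lambda>n. pmf (p n) a) \<longlonglongrightarrow> pmf q a"
  shows "(\<lambda>n. measure_pmf.prob (p n) A) \<longlonglongrightarrow> measure_pmf.prob q A"
proof (rule tendstoI)
  fix e :: real assume "0 < e"
  then have e: "0 < e / 4" by simp
  then obtain F where F: "finite F" "1 - e / 4 < measure_pmf.prob q F" by (rule pmf_finite_approx)
  have fin: "(\<lambda>n. measure_pmf.prob (p n) B) \<longlonglongrightarrow> measure_pmf.prob q B" if "finite B" for B
    unfolding measure_measure_pmf_finite[OF that] by (intro tendsto_sum assms)
  have "\<forall>\<^sub>F n in sequentially. 1 - e / 4 < measure_pmf.prob (p n) F"
    using order_tendstoD(1)[OF fin[OF F(1)] F(2)] .
  moreover have "\<forall>\<^sub>F n in sequentially. dist (measure_pmf.prob (p n) (A \<inter> F)) (measure_pmf.prob q (A \<inter> F)) < e / 4"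
    using fin[of "A \<inter> F"] F(1) e by (intro tendstoD) auto
  ultimately show "\<forall>\<^sub>F n in sequentially. dist (measure_pmf.prob (p n) A) (measure_pmf.prob q A) < e"
  proof eventually_elim
    case (elim n)
    have "measure_pmf.prob r (A \<inter> F) \<le> measure_pmf.prob r A"
      "measure_pmf.prob r A \<le> measure_pmf.prob r (A \<inter> F) + (1 - measure_pmf.prob r F)" for r :: "'a pmf"
    proof -
      show "measure_pmf.prob r (A \<inter> F) \<le> measure_pmf.prob r A"
        by (intro measure_pmf.finite_measure_mono) auto
      have "measure_pmf.prob r A \<le> measure_pmf.prob r ((A \<inter> F) \<union> (- F))"
        by (intro measure_pmf.finite_measure_mono) auto
      also have "\<dots> \<le> measure_pmf.prob r (A \<inter> F) + measure_pmf.prob r (- F)"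
        by (intro measure_Un_le) auto
      also have "measure_pmf.prob r (- F) = 1 - measure_pmf.prob r F"
        using measure_pmf.prob_compl[of F r] by (simp add: Compl_eq_Diff_UNIV)
      finally show "measure_pmf.prob r A \<le> measure_pmf.prob r (A \<inter> F) + (1 - measure_pmf.prob r F)" .
    qed
    from this[of "p n"] this[of q] show ?case
      using elim F(2) \<open>0 < e\<close> unfolding dist_real_def by linarith
  qed
qed

definition count_vector :: "nat \<Rightarrow> 'a graph \<Rightarrow> nat \<Rightarrow> nat" where
  "count_vector K G = comp_count K (components G)"

definition limit_counts :: "nat \<Rightarrow> (nat \<Rightarrow> nat) pmf" where
  "limit_counts K = Pi_pmf {1..K} 0 (\<lambda>l. poisson_pmf (path_weight l))"

lemma card_forests_count_vector:
  "card {G\<in>path_forests_on n. count_vector K G = a} =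
   card {\<C>\<in>path_families {1..n}. comp_count K \<C> = a}"
proof -
  have bij: "bij_betw components (path_forests_on n) (path_families {1..n})"
    unfolding path_forests_on_def by (rule bij_betw_components)
  have "bij_betw components {G\<in>path_forests_on n. count_vector K G = a}
      {\<C>\<in>path_families {1..n}. comp_count K \<C> = a}"
    using bij by (rule bij_betw_Collect) (simp add: count_vector_def)
  then show ?thesis by (rule bij_betw_same_card)
qed

lemma card_path_forests_on: "real (card (path_forests_on n)) = fact n * forest_coeff n"
proof -
  have 0: "count_vector 0 G = (\<lambda>_. 0)" for G :: "nat graph"
    by (simp add: count_vector_def comp_count_def fun_eq_iff)
  have "real (card (path_forests_on n)) = real (card {G\<in>path_forests_on n. count_vector 0 G = (\<lambda>_. 0)})"
    by (simp add: 0)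
  also have "\<dots> = fact n * forest_coeff n"
    unfolding card_forests_count_vector
    by (subst card_forests_comp_count) (simp_all add: vweight_def vsize_def)
  finally show ?thesis .
qed

text \<open>With \<open>s = vsize K a\<close>, the quotient of the exact counts is
  \<open>vweight K a * large_coeff K (n - s) / forest_coeff n\<close>; inserting
  \<open>forest_coeff (n - s)\<close> splits it into two known limits. A vector not supported in
  \<open>{1..K}\<close> has probability 0 on both sides.\<close>

lemma pmf_count_vector_tendsto:
  "(\<lambda>n. pmf (map_pmf (count_vector K) (random_path_forest n)) a) \<longlonglongrightarrow> pmf (limit_counts K) a"
proof -
  have eq: "pmf (map_pmf (count_vector K) (random_path_forest n)) a =
      real (card {\<C>\<in>path_families {1..n}. comp_count K \<C> = a}) / (fact n * forest_coeff n)" for n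
  proof -
    have "path_forests_on n \<inter> count_vector K -` {a} = {G\<in>path_forests_on n. count_vector K G = a}" by auto
    then show ?thesis
      by (simp add: pmf_map random_path_forest_def measure_pmf_of_set[OF path_forests_on_nonempty finite_path_forests_on]
          card_path_forests_on card_forests_count_vector)
  qed
  show ?thesis
  proof (cases "\<forall>l. l \<notin> {1..K} \<longrightarrow> a l = 0")
    case True
    let ?s = "vsize K a"
    have "(\<lambda>n. large_coeff K (n - ?s) / forest_coeff (n - ?s)) \<longlonglongrightarrow> (\<Prod>l\<in>{1..K}. exp (- path_weight l))"
      by (rule LIMSEQ_offset[of _ ?s]) (use large_coeff_limit in simp)
    then have "(\<lambda>n. vweight K a * ((large_coeff K (n - ?s) / forest_coeff (n - ?s)) * (forest_coeff (n - ?s) / forest_coeff n)))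
        \<longlonglongrightarrow> vweight K a * ((\<Prod>l\<in>{1..K}. exp (- path_weight l)) * 1)"
      by (intro tendsto_mult tendsto_const forest_coeff_ratio)
    moreover have "\<forall>\<^sub>F n in sequentially.
        vweight K a * ((large_coeff K (n - ?s) / forest_coeff (n - ?s)) * (forest_coeff (n - ?s) / forest_coeff n)) =
        pmf (map_pmf (count_vector K) (random_path_forest n)) a"
      using eventually_ge_at_top[of ?s]
    proof eventually_elim
      case (elim n)
      have "forest_coeff (n - ?s) \<noteq> 0" using forest_coeff_ge_1[of "n - ?s"] by linarith
      then show ?case
        unfolding eq using card_forests_comp_count[of "{1..n}" K a] True elim by simp
    qed
    ultimately have "(\<lambda>n. pmf (map_pmf (count_vector K) (random_path_forest n)) a)
        \<longlonglongrightarrow> vweight K a * ((\<Prod>l\<in>{1..K}. exp (- path_weight l)) * 1)"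
      by (rule Lim_transform_eventually)
    also have "vweight K a * ((\<Prod>l\<in>{1..K}. exp (- path_weight l)) * 1) = pmf (limit_counts K) a"
    proof -
      have "pmf (limit_counts K) a = (\<Prod>l\<in>{1..K}. pmf (poisson_pmf (path_weight l)) (a l))"
        unfolding limit_counts_def using True by (intro pmf_Pi') auto
      also have "\<dots> = (\<Prod>l\<in>{1..K}. path_weight l ^ a l / fact (a l) * exp (- path_weight l))"
        by (simp add: path_weight_pos)
      finally show ?thesis unfolding vweight_def prod.distrib by simp
    qed
    finally show ?thesis .
  next
    case False
    then obtain l where l: "l \<notin> {1..K}" "a l \<noteq> 0" by blast
    have "comp_count K \<C> \<noteq> a" for \<C> :: "nat graph set"
      using l by (auto simp: comp_count_def fun_eq_iff intro!: exI[of _ l])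
    moreover have "pmf (limit_counts K) a = 0"
      unfolding limit_counts_def using l by (intro pmf_Pi_outside) auto
    ultimately show ?thesis unfolding eq by simp
  qed
qed

lemma prob_count_vector_tendsto:
  "(\<lambda>n. measure_pmf.prob (random_path_forest n) {G. count_vector K G \<in> A})
    \<longlonglongrightarrow> measure_pmf.prob (limit_counts K) A"
proof -
  have "(\<lambda>n. measure_pmf.prob (map_pmf (count_vector K) (random_path_forest n)) A)
      \<longlonglongrightarrow> measure_pmf.prob (limit_counts K) A"
    by (rule pmf_tendsto_imp_measure_tendsto) (rule pmf_count_vector_tendsto)
  then show ?thesis by (simp add: vimage_def)
qed

lemma prob_limit_counts_Pi:
  "measure_pmf.prob (limit_counts K) (Pi {1..K} B) =
    (\<Prod>l\<in>{1..K}. measure_pmf.prob (poisson_pmf (path_weight l)) (B l))"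
  unfolding limit_counts_def by (rule measure_Pi_pmf_Pi) simp

lemma prob_poisson_0:
  "measure_pmf.prob (poisson_pmf (path_weight l)) {0} = exp (- path_weight l)"
  by (simp add: measure_pmf_single path_weight_pos)

lemma prob_poisson_nonzero:
  "measure_pmf.prob (poisson_pmf (path_weight l)) (- {0}) = 1 - exp (- path_weight l)"
  using measure_pmf.prob_compl[of "{0}" "poisson_pmf (path_weight l)"]
  by (simp add: Compl_eq_Diff_UNIV prob_poisson_0)

text \<open>The sizes are absent independently, each with probability
  \<open>exp (- path_weight l)\<close>, which is at most \<open>exp (- 1 / 2)\<close>.\<close>

lemma prob_limit_counts_zero:
  assumes "B \<subseteq> {1..K}"
  shows "measure_pmf.prob (limit_counts K) {a. \<forall>l\<in>B. a l = 0} \<le> exp (- real (card B) / 2)"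
proof -
  have fin: "finite B" using assms finite_subset by blast
  have eq: "{a. \<forall>l\<in>B. a l = 0} = Pi {1..K} (\<lambda>l. if l \<in> B then {0} else UNIV)"
    using assms by (auto simp: Pi_def)
  have "measure_pmf.prob (limit_counts K) {a. \<forall>l\<in>B. a l = 0} =
      (\<Prod>l\<in>{1..K}. measure_pmf.prob (poisson_pmf (path_weight l)) (if l \<in> B then {0} else UNIV))"
    unfolding eq by (rule prob_limit_counts_Pi)
  also have "\<dots> = (\<Prod>l\<in>{1..K}. if l \<in> B then exp (- path_weight l) else 1)"
    by (rule prod.cong) (auto simp: prob_poisson_0)
  also have "\<dots> = (\<Prod>l\<in>B. exp (- path_weight l))"
    using assms by (simp add: prod.If_cases Int_absorb1)
  also have "\<dots> \<le> (\<Prod>l\<in>B. exp (- 1 / 2))"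
    by (rule prod_mono) (auto simp: path_weight_def)
  also have "\<dots> = exp (- real (card B) / 2)"
    by (simp add: exp_of_nat_mult[symmetric])
  finally show ?thesis .
qed

section \<open>The convergence law for random forests of paths\<close>

text \<open>The sequence is Cauchy by a three-term estimate. The approximating sequence may vary
  with the error because the range of recorded sizes will.\<close>

lemma convergent_if_approximable:
  fixes x :: "nat \<Rightarrow> real"
  assumes "\<And>\<epsilon>. 0 < \<epsilon> \<Longrightarrow> \<exists>b. convergent b \<and> (\<forall>\<^sub>F n in sequentially. \<bar>x n - b n\<bar> < \<epsilon>)"
  shows "convergent x"
proof -
  have "Cauchy x"
  proof (rule metric_CauchyI)
    fix e :: real assume "0 < e"
    then obtain b where b: "convergent b" "\<forall>\<^sub>F n in sequentially. \<bar>x n - b n\<bar> < e / 3"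
      using assms[of "e / 3"] by auto
    obtain M where M: "\<And>n. n \<ge> M \<Longrightarrow> \<bar>x n - b n\<bar> < e / 3"
      using b(2) by (auto simp: eventually_sequentially)
    obtain N where N: "\<And>m n. m \<ge> N \<Longrightarrow> n \<ge> N \<Longrightarrow> dist (b m) (b n) < e / 3"
      using metric_CauchyD[OF convergent_Cauchy[OF b(1)], of "e / 3"] \<open>0 < e\<close> by auto
    have "dist (x m) (x n) < e" if "m \<ge> max M N" "n \<ge> max M N" for m n
      using M[of m] M[of n] N[of m n] that unfolding dist_real_def by (simp add: abs_if split: if_splits)
    then show "\<exists>M. \<forall>m\<ge>M. \<forall>n\<ge>M. dist (x m) (x n) < e" by blast
  qed
  then show ?thesis by (rule Cauchy_convergent)
qed

lemma path_forests_onD: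
  assumes "G \<in> path_forests_on n"
  shows "forest_of_paths G" "verts G = {1..n}" "finite (verts G)"
    "components G \<in> path_families {1..n}" "finite (components G)"
  using assms components_path_families(1)[of G] finite_family[of "components G" "{1..n}"]
  by (auto simp: path_forests_on_def)

lemma set_random_path_forest: "set_pmf (random_path_forest n) = path_forests_on n"
  by (simp add: random_path_forest_def set_pmf_of_set path_forests_on_nonempty finite_path_forests_on)

lemma forest_models_class_count:
  assumes "mso_sentence \<phi>"
  obtains f :: "nat \<Rightarrow> nat" and T where "finite (range f)"
    "\<And>m n G G'. \<lbrakk>G \<in> path_forests_on m; G' \<in> path_forests_on n;
       \<forall>q. min T (card {H\<in>components G. f (card (verts H)) = q}) =
           min T (card {H\<in>components G'. f (card (verts H)) = q}); models G \<phi>\<rbrakk> \<Longrightarrow> models G' \<phi>"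
proof (rule models_class_count[OF assms])
  fix f :: "nat \<Rightarrow> nat" and T
  assume f: "finite (range f)"
    "\<And>(\<X> :: nat list set) (\<Y> :: nat list set). \<lbrakk>list_family \<X>; list_family \<Y>;
       \<forall>q. min T (card {xs\<in>\<X>. f (length xs) = q}) = min T (card {ys\<in>\<Y>. f (length ys) = q});
       models (family_graph \<X>) \<phi>\<rbrakk> \<Longrightarrow> models (family_graph \<Y>) \<phi>"
  show thesis
  proof (rule that[OF f(1), of T])
    fix m n G G'
    assume G: "G \<in> path_forests_on m" "G' \<in> path_forests_on n" "models G \<phi>"
      and eq: "\<forall>q. min T (card {H\<in>components G. f (card (verts H)) = q}) =
           min T (card {H\<in>components G'. f (card (verts H)) = q})"
    obtain \<X> where X: "list_family \<X>" "family_graph \<X> = G"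
      "\<And>P. card {xs\<in>\<X>. P (length xs)} = card {H\<in>components G. P (card (verts H))}"
      using forest_list_family[OF path_forests_onD(1,3)[OF G(1)]] by blast
    obtain \<Y> where Y: "list_family \<Y>" "family_graph \<Y> = G'"
      "\<And>P. card {xs\<in>\<Y>. P (length xs)} = card {H\<in>components G'. P (card (verts H))}"
      using forest_list_family[OF path_forests_onD(1,3)[OF G(2)]] by blast
    have "\<forall>q. min T (card {xs\<in>\<X>. f (length xs) = q}) = min T (card {ys\<in>\<Y>. f (length ys) = q})"
    proof
      fix q
      show "min T (card {xs\<in>\<X>. f (length xs) = q}) = min T (card {ys\<in>\<Y>. f (length ys) = q})"
        using eq X(3)[of "\<lambda>l. f l = q"] Y(3)[of "\<lambda>l. f l = q"] by simp
    qed
    then show "models G' \<phi>" using f(2)[OF X(1) Y(1)] G(3) X(2) Y(2) by simp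
  qed
qed

lemma card_components_sizes:
  assumes "G \<in> path_forests_on n" "S \<subseteq> {1..K}"
  shows "card {H\<in>components G. card (verts H) \<in> S} = (\<Sum>l\<in>S. count_vector K G l)"
proof -
  have fin: "finite S" using assms(2) finite_subset by blast
  have "card (\<Union>l\<in>S. {H\<in>components G. card (verts H) = l}) = (\<Sum>l\<in>S. card {H\<in>components G. card (verts H) = l})"
    by (rule card_UN_disjoint) (use fin path_forests_onD(5)[OF assms(1)] in auto)
  moreover have "(\<Union>l\<in>S. {H\<in>components G. card (verts H) = l}) = {H\<in>components G. card (verts H) \<in> S}" by auto
  moreover have "card {H\<in>components G. card (verts H) = l} = count_vector K G l" if "l \<in> S" for l
    using that assms(2) by (auto simp: count_vector_def comp_count_def)
  ultimately show ?thesis by simp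
qed

section \<open>Recurrent classes of sizes and their saturation\<close>

definition sizes_in_class :: "(nat \<Rightarrow> 'q) \<Rightarrow> nat \<Rightarrow> 'q \<Rightarrow> nat set" where
  "sizes_in_class f K q = {l\<in>{1..K}. f l = q}"

definition recurrent :: "(nat \<Rightarrow> 'q) \<Rightarrow> 'q set" where
  "recurrent f = {q. infinite {l. f l = q}}"

text \<open>Only sizes up to \<open>K\<close> are counted, which makes saturation an event of the
  count vector; larger components can only increase the class counts.\<close>

definition saturated :: "(nat \<Rightarrow> 'q) \<Rightarrow> nat \<Rightarrow> nat \<Rightarrow> (nat \<Rightarrow> nat) set" where
  "saturated f T K = {a. \<forall>q\<in>recurrent f. T \<le> (\<Sum>l\<in>sizes_in_class f K q. a l)}"

lemma nonrecurrent_bound: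
  assumes "finite (range f)"
  obtains L where "\<And>l :: nat. f l \<notin> recurrent f \<Longrightarrow> l \<le> L"
proof -
  have "{l. f l \<notin> recurrent f} = (\<Union>q\<in>range f - recurrent f. {l. f l = q})" by auto
  moreover have "finite (\<Union>q\<in>range f - recurrent f. {l. f l = q})"
    using assms by (auto simp: recurrent_def)
  ultimately have "finite {l. f l \<notin> recurrent f}" by simp
  then show thesis using that[of "Max {l. f l \<notin> recurrent f}"] by auto
qed

text \<open>A recurrent class reaches the threshold in both forests, whatever their larger
  components are. Any other class has no size above \<open>K\<close>, so its count is read off
  exactly from the common vector.\<close>

lemma saturated_class_count:
  assumes L: "\<And>l. f l \<notin> recurrent f \<Longrightarrow> l \<le> K"
    and G: "G \<in> path_forests_on m" and G': "G' \<in> path_forests_on n"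
    and eq: "count_vector K G = count_vector K G'" and sat: "count_vector K G \<in> saturated f T K"
  shows "min T (card {H\<in>components G. f (card (verts H)) = q}) =
    min T (card {H\<in>components G'. f (card (verts H)) = q})"
proof -
  let ?S = "sizes_in_class f K q"
  have S: "?S \<subseteq> {1..K}" by (auto simp: sizes_in_class_def)
  have pos: "1 \<le> card (verts H)" if "H \<in> components G" "G \<in> path_forests_on n" for G :: "nat graph" and H n
    using that path_forests_onD(4)[OF that(2)] is_path_nonempty[of H] is_path_finite[of H]
    by (auto simp: path_families_def Suc_le_eq card_gt_0_iff)
  show ?thesis
  proof (cases "q \<in> recurrent f")
    case True
    have "T \<le> card {H\<in>components G. f (card (verts H)) = q}"
      if "G \<in> path_forests_on n" "count_vector K G \<in> saturated f T K" for G n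
    proof -
      have "T \<le> card {H\<in>components G. card (verts H) \<in> ?S}"
        using that True card_components_sizes[OF that(1) S] by (simp add: saturated_def)
      also have "\<dots> \<le> card {H\<in>components G. f (card (verts H)) = q}"
        by (rule card_mono) (use path_forests_onD(5)[OF that(1)] in \<open>auto simp: sizes_in_class_def\<close>)
      finally show ?thesis .
    qed
    from this[OF G sat] this[OF G' sat[unfolded eq]] show ?thesis by simp
  next
    case False
    have "card {H\<in>components G. f (card (verts H)) = q} = (\<Sum>l\<in>?S. count_vector K G l)"
      if "G \<in> path_forests_on n" for G n
    proof -
      have "{H\<in>components G. f (card (verts H)) = q} = {H\<in>components G. card (verts H) \<in> ?S}"
        using pos[OF _ that] L False by (auto simp: sizes_in_class_def)
      then show ?thesis using card_components_sizes[OF that S] by simp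
    qed
    from this[OF G] this[OF G'] eq show ?thesis by simp
  qed
qed

text \<open>The \<open>T\<close> blocks of indices are disjoint and each contributes at least
  1.\<close>

lemma sum_ge_if_blocks_nonzero:
  fixes e :: "nat \<Rightarrow> nat"
  assumes "inj e" "e ` {..<T * M} \<subseteq> S" "finite S"
    and "\<And>t. t < T \<Longrightarrow> \<exists>l\<in>e ` {t * M..<Suc t * M}. a l \<noteq> (0::nat)"
  shows "T \<le> (\<Sum>l\<in>S. a l)"
proof -
  have "(\<Sum>t<T. 1) \<le> (\<Sum>t<T. \<Sum>i\<in>{t * M..<Suc t * M}. a (e i))"
  proof (rule sum_mono)
    fix t assume "t \<in> {..<T}"
    then obtain i where i: "i \<in> {t * M..<Suc t * M}" "a (e i) \<noteq> 0" using assms(4)[of t] by auto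
    then have "a (e i) \<le> (\<Sum>i\<in>{t * M..<Suc t * M}. a (e i))" by (intro member_le_sum) auto
    then show "1 \<le> (\<Sum>i\<in>{t * M..<Suc t * M}. a (e i))" using i(2) by linarith
  qed
  also have "\<dots> = (\<Sum>i<T * M. a (e i))"
    using sum.nat_group[of "\<lambda>i. a (e i)" M T] by (simp add: add.commute)
  also have "\<dots> = (\<Sum>l\<in>e ` {..<T * M}. a l)"
    using assms(1) by (subst sum.reindex) (auto simp: inj_on_def)
  also have "\<dots> \<le> (\<Sum>l\<in>S. a l)"
    by (rule sum_mono2) (use assms(2,3) in auto)
  finally show ?thesis by simp
qed

text \<open>For each recurrent class, reserve \<open>T\<close> disjoint blocks of \<open>M\<close> component sizes in that class;
  with high probability every block contains a size that occurs.\<close>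

lemma saturated_likely:
  fixes f :: "nat \<Rightarrow> 'q"
  assumes fin: "finite (range f)" and "0 < \<epsilon>"
  shows "\<exists>K\<ge>L. measure_pmf.prob (limit_counts K) (- saturated f T K) < \<epsilon>"
proof -
  let ?R = "recurrent f"
  have finR: "finite ?R"
  proof (rule finite_subset[OF _ fin])
    show "?R \<subseteq> range f"
    proof
      fix q assume "q \<in> ?R"
      then have "{l. f l = q} \<noteq> {}" unfolding recurrent_def by (intro infinite_imp_nonempty) simp
      then show "q \<in> range f" by auto
    qed
  qed
  \<comment> \<open>A block of \<open>M\<close> sizes is missed with probability at most
    \<open>exp (- M / 2)\<close>; there are \<open>card ?R * T\<close> blocks, so this is the union
    bound.\<close>
  have "(\<lambda>M. real (card ?R) * real T * exp (- real M / 2)) \<longlonglongrightarrow> 0"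
    by (rule tendsto_mult_right_zero) real_asymp
  then have "\<forall>\<^sub>F M in sequentially. real (card ?R) * real T * exp (- real M / 2) < \<epsilon>"
    using \<open>0 < \<epsilon>\<close> by (rule order_tendstoD(2))
  then obtain M where M: "real (card ?R) * real T * exp (- real M / 2) < \<epsilon>"
    by (auto simp: eventually_sequentially)
  \<comment> \<open>Size 0 is left out because count vectors record sizes from 1 on.\<close>
  define e where "e q = enumerate {l. 1 \<le> l \<and> f l = q}" for q
  have inf: "infinite {l. 1 \<le> l \<and> f l = q}" if "q \<in> ?R" for q
  proof
    assume "finite {l. 1 \<le> l \<and> f l = q}"
    moreover have "{l. f l = q} \<subseteq> insert 0 {l. 1 \<le> l \<and> f l = q}" by auto
    ultimately have "finite {l. f l = q}" by (meson finite_insert finite_subset)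
    then show False using that by (simp add: recurrent_def)
  qed
  have e: "inj (e q)" "\<And>i. 1 \<le> e q i \<and> f (e q i) = q" if "q \<in> ?R" for q
    using inf[OF that] strict_mono_enumerate[OF inf[OF that]] enumerate_in_set[OF inf[OF that]]
    by (auto simp: e_def strict_mono_imp_inj_on)
  define K where "K = Max (insert L ((\<lambda>(q, i). e q i) ` (?R \<times> {..<T * M})))"
  have finI: "finite (insert L ((\<lambda>(q, i). e q i) ` (?R \<times> {..<T * M})))" using finR by simp
  have "L \<le> K" unfolding K_def by (rule Max_ge[OF finI]) simp
  have eK: "e q i \<le> K" if "q \<in> ?R" "i < T * M" for q i
    unfolding K_def by (rule Max_ge[OF finI]) (use that in auto)
  define B where "B q t = e q ` {t * M..<Suc t * M}" for q t
  have BK: "B q t \<subseteq> {1..K}" "card (B q t) = M" if "q \<in> ?R" "t < T" for q t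
  proof -
    have "Suc t * M \<le> T * M" using that(2) by (intro mult_le_mono1) simp
    then show "B q t \<subseteq> {1..K}" using eK[OF that(1)] e(2)[OF that(1)] by (auto simp: B_def)
    show "card (B q t) = M"
      using e(1)[OF that(1)] by (simp add: B_def card_image inj_on_subset)
  qed
  have "- saturated f T K \<subseteq> (\<Union>(q, t)\<in>?R \<times> {..<T}. {a. \<forall>l\<in>B q t. a l = 0})"
  proof
    fix a assume "a \<in> - saturated f T K"
    then obtain q where q: "q \<in> ?R" "\<not> T \<le> (\<Sum>l\<in>sizes_in_class f K q. a l)"
      by (auto simp: saturated_def)
    have "\<exists>t<T. \<forall>l\<in>B q t. a l = 0"
    proof (rule ccontr)
      assume "\<not> ?thesis"
      then have "\<exists>l\<in>e q ` {t * M..<Suc t * M}. a l \<noteq> 0" if "t < T" for t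
        using that unfolding B_def by blast
      moreover have "e q ` {..<T * M} \<subseteq> sizes_in_class f K q"
        using eK[OF q(1)] e(2)[OF q(1)] by (auto simp: sizes_in_class_def)
      ultimately have "T \<le> (\<Sum>l\<in>sizes_in_class f K q. a l)"
        by (intro sum_ge_if_blocks_nonzero[OF e(1)[OF q(1)]]) (auto simp: sizes_in_class_def)
      with q(2) show False ..
    qed
    then show "a \<in> (\<Union>(q, t)\<in>?R \<times> {..<T}. {a. \<forall>l\<in>B q t. a l = 0})" using q(1) by blast
  qed
  then have "measure_pmf.prob (limit_counts K) (- saturated f T K) \<le>
      measure_pmf.prob (limit_counts K) (\<Union>(q, t)\<in>?R \<times> {..<T}. {a. \<forall>l\<in>B q t. a l = 0})"
    by (intro measure_pmf.finite_measure_mono) auto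
  also have "\<dots> \<le> (\<Sum>(q, t)\<in>?R \<times> {..<T}. measure_pmf.prob (limit_counts K) {a. \<forall>l\<in>B q t. a l = 0})"
    using measure_UNION_le[of "?R \<times> {..<T}" "\<lambda>(q, t). {a. \<forall>l\<in>B q t. a l = 0}" "measure_pmf (limit_counts K)"] finR
    by (simp add: case_prod_unfold)
  also have "\<dots> \<le> (\<Sum>(q, t)\<in>?R \<times> {..<T}. exp (- real M / 2))"
  proof (rule sum_mono)
    fix x assume "x \<in> ?R \<times> {..<T}"
    then obtain q t where x: "x = (q, t)" "q \<in> ?R" "t < T" by auto
    show "(case x of (q, t) \<Rightarrow> measure_pmf.prob (limit_counts K) {a. \<forall>l\<in>B q t. a l = 0}) \<le>
        (case x of (q, t) \<Rightarrow> exp (- real M / 2))"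
      using prob_limit_counts_zero[OF BK(1)[OF x(2,3)]] BK(2)[OF x(2,3)] by (simp add: x(1))
  qed
  also have "\<dots> = real (card ?R) * real T * exp (- real M / 2)"
    by (simp add: case_prod_unfold card_cartesian_product)
  finally show ?thesis using M \<open>L \<le> K\<close> by (intro exI[of _ K]) linarith
qed

lemma path_forest_convergent:
  assumes "mso_sentence \<phi>"
  shows "convergent (\<lambda>n. prob_models (random_path_forest n) \<phi>)"
proof (rule convergent_if_approximable)
  fix \<epsilon> :: real assume "0 < \<epsilon>"
  show "\<exists>b. convergent b \<and> (\<forall>\<^sub>F n in sequentially. \<bar>prob_models (random_path_forest n) \<phi> - b n\<bar> < \<epsilon>)"
  proof (rule forest_models_class_count[OF assms])
    fix f :: "nat \<Rightarrow> nat" and T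
    assume f: "finite (range f)"
      "\<And>m n G G'. \<lbrakk>G \<in> path_forests_on m; G' \<in> path_forests_on n;
         \<forall>q. min T (card {H\<in>components G. f (card (verts H)) = q}) =
             min T (card {H\<in>components G'. f (card (verts H)) = q}); models G \<phi>\<rbrakk> \<Longrightarrow> models G' \<phi>"
    obtain L where L: "\<And>l. f l \<notin> recurrent f \<Longrightarrow> l \<le> L" using nonrecurrent_bound[OF f(1)] by blast
    obtain K where K: "L \<le> K" "measure_pmf.prob (limit_counts K) (- saturated f T K) < \<epsilon>"
      using saturated_likely[OF f(1) \<open>0 < \<epsilon>\<close>] by blast
    let ?p = "\<lambda>n. measure_pmf.prob (random_path_forest n)"
    \<comment> \<open>On saturated vectors the truth of the sentence depends on the vector alone,
      not even on \<open>n\<close>, so forests of all orders may be pooled. The error of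
      \<open>b\<close> is then at most the probability that saturation fails.\<close>
    define A where "A = {count_vector K G | G n. G \<in> path_forests_on n \<and> models G \<phi>} \<inter> saturated f T K"
    define b where "b n = ?p n {G. count_vector K G \<in> A}" for n
    have "convergent b"
      using prob_count_vector_tendsto convergentI unfolding b_def by blast
    moreover have "\<bar>prob_models (random_path_forest n) \<phi> - b n\<bar> \<le> ?p n {G. count_vector K G \<in> - saturated f T K}" for n
    proof -
      let ?X = "{G. models G \<phi>} \<inter> path_forests_on n"
      let ?Y = "{G. count_vector K G \<in> A} \<inter> path_forests_on n"
      let ?Z = "{G. count_vector K G \<in> - saturated f T K}"
      have XY: "models G \<phi> \<longleftrightarrow> count_vector K G \<in> A"
        if G: "G \<in> path_forests_on n" "count_vector K G \<in> saturated f T K" for G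
      proof
        assume "count_vector K G \<in> A"
        then obtain G' m where G': "G' \<in> path_forests_on m" "models G' \<phi>" "count_vector K G' = count_vector K G"
          by (auto simp: A_def)
        show "models G \<phi>"
          by (rule f(2)[OF G'(1) G(1) _ G'(2)], intro allI saturated_class_count[OF _ G'(1) G(1) G'(3)])
            (use L K(1) G(2) G'(3) order_trans in auto)
      next
        assume "models G \<phi>"
        then show "count_vector K G \<in> A" using G unfolding A_def by blast
      qed
      have "?X \<subseteq> ?Y \<union> ?Z" "?Y \<subseteq> ?X \<union> ?Z" using XY by auto
      then have "?p n ?X \<le> ?p n (?Y \<union> ?Z)" "?p n ?Y \<le> ?p n (?X \<union> ?Z)"
        by (intro measure_pmf.finite_measure_mono; simp)+
      moreover have "?p n (?Y \<union> ?Z) \<le> ?p n ?Y + ?p n ?Z" "?p n (?X \<union> ?Z) \<le> ?p n ?X + ?p n ?Z"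
        by (intro measure_Un_le; simp)+
      moreover have "?p n ?X = prob_models (random_path_forest n) \<phi>" "?p n ?Y = b n"
        using measure_Int_set_pmf[of "random_path_forest n"]
        by (simp_all add: prob_models_def b_def set_random_path_forest)
      ultimately show ?thesis by linarith
    qed
    moreover have "\<forall>\<^sub>F n in sequentially. ?p n {G. count_vector K G \<in> - saturated f T K} < \<epsilon>"
      by (rule order_tendstoD(2)[OF prob_count_vector_tendsto K(2)])
    ultimately show "\<exists>b. convergent b \<and> (\<forall>\<^sub>F n in sequentially. \<bar>prob_models (random_path_forest n) \<phi> - b n\<bar> < \<epsilon>)"
      by (intro exI[of _ b] conjI) (auto elim!: eventually_mono intro: le_less_trans)
  qed
qed

section \<open>Definable properties of paths\<close>

text \<open>The neighbours of an entry in the whole graph are its neighbours in the list, so a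
  nonempty such list runs through an entire component. Formulas are evaluated along this local
  description.\<close>

definition component_path :: "'a graph \<Rightarrow> 'a list \<Rightarrow> bool" where
  "component_path G xs \<longleftrightarrow> distinct xs \<and> set xs \<subseteq> verts G \<and> (\<forall>i<length xs. \<forall>v.
     adjacent G (xs ! i) v \<longleftrightarrow> (\<exists>j<length xs. v = xs ! j \<and> (j = Suc i \<or> i = Suc j)))"

lemma component_pathD:
  assumes "component_path G xs"
  shows "distinct xs" "set xs \<subseteq> verts G"
    "\<And>i v. i < length xs \<Longrightarrow>
      adjacent G (xs ! i) v \<longleftrightarrow> (\<exists>j<length xs. v = xs ! j \<and> (j = Suc i \<or> i = Suc j))"
  using assms by (auto simp: component_path_def)

lemma component_path_family:
  assumes "list_family \<X>" "xs \<in> \<X>"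
  shows "component_path (family_graph \<X>) xs"
  unfolding component_path_def
proof (intro conjI allI impI)
  show dist: "distinct xs" using assms by (simp add: list_family_def)
  show "set xs \<subseteq> verts (family_graph \<X>)" using assms by auto
  fix i v assume i: "i < length xs"
  show "adjacent (family_graph \<X>) (xs ! i) v \<longleftrightarrow> (\<exists>j<length xs. v = xs ! j \<and> (j = Suc i \<or> i = Suc j))"
  proof
    assume "adjacent (family_graph \<X>) (xs ! i) v"
    then obtain ys j where ys: "ys \<in> \<X>" "Suc j < length ys"
      "ys ! j = xs ! i \<and> ys ! Suc j = v \<or> ys ! j = v \<and> ys ! Suc j = xs ! i"
      by (auto simp: adjacent_family_graph)
    have "ys ! j \<in> set ys" "ys ! Suc j \<in> set ys" "xs ! i \<in> set xs" using ys(2) i by auto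
    then have "set xs \<inter> set ys \<noteq> {}" using ys(3) by auto
    then have [simp]: "ys = xs" using assms ys(1) unfolding list_family_def by blast
    show "\<exists>j<length xs. v = xs ! j \<and> (j = Suc i \<or> i = Suc j)"
      using ys(3)
    proof
      assume a: "ys ! j = xs ! i \<and> ys ! Suc j = v"
      then have "j = i" using nth_eq_iff_index_eq[OF dist, of j i] ys(2) i by simp
      then show ?thesis using a ys(2) by (intro exI[of _ "Suc j"]) auto
    next
      assume a: "ys ! j = v \<and> ys ! Suc j = xs ! i"
      then have "Suc j = i" using nth_eq_iff_index_eq[OF dist, of "Suc j" i] ys(2) i by simp
      then show ?thesis using a ys(2) by (intro exI[of _ j]) auto
    qed
  next
    assume "\<exists>j<length xs. v = xs ! j \<and> (j = Suc i \<or> i = Suc j)"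
    then obtain j where j: "j < length xs" "v = xs ! j" "j = Suc i \<or> i = Suc j" by blast
    from j(3) show "adjacent (family_graph \<X>) (xs ! i) v"
      unfolding adjacent_family_graph using assms(2) i j(1,2) by blast
  qed
qed

lemma component_path_rev:
  assumes "component_path G xs"
  shows "component_path G (rev xs)"
  unfolding component_path_def
proof (intro conjI allI impI)
  note xs = component_pathD[OF assms]
  show "distinct (rev xs)" "set (rev xs) \<subseteq> verts G" using xs by auto
  fix i v assume i: "i < length (rev xs)"
  let ?n = "length xs"
  have i': "?n - Suc i < ?n" using i by simp
  have "adjacent G (rev xs ! i) v \<longleftrightarrow>
      (\<exists>j<?n. v = xs ! j \<and> (j = Suc (?n - Suc i) \<or> ?n - Suc i = Suc j))"
    using xs(3)[OF i', of v] i by (simp add: rev_nth)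
  also have "\<dots> \<longleftrightarrow> (\<exists>j<?n. v = rev xs ! j \<and> (j = Suc i \<or> i = Suc j))"
  proof
    assume "\<exists>j<?n. v = xs ! j \<and> (j = Suc (?n - Suc i) \<or> ?n - Suc i = Suc j)"
    then obtain j where "j < ?n" "v = xs ! j" "j = Suc (?n - Suc i) \<or> ?n - Suc i = Suc j" by blast
    then show "\<exists>j<?n. v = rev xs ! j \<and> (j = Suc i \<or> i = Suc j)"
      using i by (intro exI[of _ "?n - Suc j"]) (auto simp: rev_nth)
  next
    assume "\<exists>j<?n. v = rev xs ! j \<and> (j = Suc i \<or> i = Suc j)"
    then obtain j where "j < ?n" "v = rev xs ! j" "j = Suc i \<or> i = Suc j" by blast
    then show "\<exists>j<?n. v = xs ! j \<and> (j = Suc (?n - Suc i) \<or> ?n - Suc i = Suc j)"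
      using i by (intro exI[of _ "?n - Suc j"]) (auto simp: rev_nth)
  qed
  finally show "adjacent G (rev xs ! i) v \<longleftrightarrow> (\<exists>j<length (rev xs). v = rev xs ! j \<and> (j = Suc i \<or> i = Suc j))"
    by simp
qed

text \<open>With \<open>x\<^sub>i\<close>, \<open>x\<^sub>i\<^sub>+\<^sub>1\<close> consecutive on a path, \<open>tail_formula k i\<close> says that exactly \<open>k\<close> vertices
  follow \<open>x\<^sub>i\<^sub>+\<^sub>1\<close>.\<close>

fun tail_formula :: "nat \<Rightarrow> nat \<Rightarrow> mso" where
  "tail_formula 0 i = Neg (ExV (Suc (Suc i)) (Conj (Adj (Suc i) (Suc (Suc i))) (Neg (Eq (Suc (Suc i)) i))))"
| "tail_formula (Suc k) i = ExV (Suc (Suc i)) (Conj (Conj (Adj (Suc i) (Suc (Suc i)))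
     (Neg (Eq (Suc (Suc i)) i))) (tail_formula k (Suc i)))"

text \<open>Variable 0 is an end of a component and variable 1 its only neighbour; from there on
  \<open>k\<close> more vertices follow.\<close>

definition component_formula :: "nat \<Rightarrow> mso" where
  "component_formula k = ExV 0 (ExV 1 (Conj (Conj (Adj 0 1)
     (Neg (ExV 2 (Conj (Adj 0 2) (Neg (Eq 2 1)))))) (tail_formula k 0)))"

lemma free_vars_tail_formula:
  "free_vertex_vars (tail_formula k i) \<subseteq> {i, Suc i}" "free_set_vars (tail_formula k i) = {}"
  by (induction k arbitrary: i) auto

lemma mso_sentence_component_formula: "mso_sentence (component_formula k)"
  using free_vars_tail_formula[of k 0] by (auto simp: mso_sentence_def component_formula_def)

text \<open>On a path the only way on from \<open>xs ! Suc j\<close> that does not return to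
  \<open>xs ! j\<close> is \<open>xs ! Suc (Suc j)\<close>. Each quantifier thus has at most one
  witness, and the recursion walks along the list.\<close>

lemma satisfies_tail_formula:
  assumes "component_path G xs" "Suc j < length xs" "s i = xs ! j" "s (Suc i) = xs ! Suc j"
  shows "satisfies G s S (tail_formula k i) \<longleftrightarrow> length xs = j + 2 + k"
  using assms(2-)
proof (induction k arbitrary: i j s)
  note xs = component_pathD[OF assms(1)]
  have next_vertex: "v \<in> verts G \<and> adjacent G (xs ! Suc j) v \<and> v \<noteq> xs ! j \<longleftrightarrow>
      Suc (Suc j) < length xs \<and> v = xs ! Suc (Suc j)" if j: "Suc j < length xs" for j v
  proof -
    have "xs ! Suc (Suc j) \<noteq> xs ! j" if "Suc (Suc j) < length xs"
      using that j nth_eq_iff_index_eq[OF xs(1), of "Suc (Suc j)" j] by simp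
    then show ?thesis using xs(2) xs(3)[OF j] by (auto simp: subset_iff)
  qed
  {
    case 0
    then have "satisfies G s S (tail_formula 0 i) \<longleftrightarrow>
        \<not> (\<exists>v. v \<in> verts G \<and> adjacent G (xs ! Suc j) v \<and> v \<noteq> xs ! j)"
      by auto
    also have "\<dots> \<longleftrightarrow> length xs = j + 2 + 0"
      unfolding next_vertex[OF 0(1)] using 0(1) by auto
    finally show ?case .
  next
    case (Suc k)
    have "satisfies G s S (tail_formula (Suc k) i) \<longleftrightarrow>
        (\<exists>v. (v \<in> verts G \<and> adjacent G (xs ! Suc j) v \<and> v \<noteq> xs ! j) \<and>
          satisfies G (s(Suc (Suc i) := v)) S (tail_formula k (Suc i)))"
      using Suc.prems(2,3) by auto
    also have "\<dots> \<longleftrightarrow> Suc (Suc j) < length xs \<and>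
        satisfies G (s(Suc (Suc i) := xs ! Suc (Suc j))) S (tail_formula k (Suc i))"
      unfolding next_vertex[OF Suc.prems(1)] by blast
    also have "\<dots> \<longleftrightarrow> Suc (Suc j) < length xs \<and> length xs = Suc j + 2 + k"
    proof -
      have "satisfies G (s(Suc (Suc i) := xs ! Suc (Suc j))) S (tail_formula k (Suc i)) \<longleftrightarrow>
          length xs = Suc j + 2 + k" if "Suc (Suc j) < length xs"
        by (rule Suc.IH) (use that Suc.prems(3) in simp_all)
      then show ?thesis by blast
    qed
    finally show ?case by auto
  }
qed

text \<open>Having only one neighbour forces the chosen vertex to the first or last place of its
  list; in the latter case the reversed list is walked.\<close>

lemma models_component_formula:
  assumes "list_family \<X>"
  shows "models (family_graph \<X>) (component_formula k) \<longleftrightarrow> (\<exists>xs\<in>\<X>. length xs = k + 2)"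
proof -
  let ?G = "family_graph \<X>"
  define s :: "nat \<Rightarrow> 'a" where "s = (\<lambda>_. undefined)"
  define S :: "nat \<Rightarrow> 'a set" where "S = (\<lambda>_. {})"
  have "models ?G (component_formula k) \<longleftrightarrow> (\<exists>x\<in>verts ?G. \<exists>y\<in>verts ?G. adjacent ?G x y \<and>
      (\<forall>z\<in>verts ?G. adjacent ?G x z \<longrightarrow> z = y) \<and> satisfies ?G (s(0 := x, 1 := y)) S (tail_formula k 0))"
    unfolding models_sentence_iff[OF mso_sentence_component_formula, of _ _ s S]
    by (auto simp: component_formula_def numeral_2_eq_2)
  also have "\<dots> \<longleftrightarrow> (\<exists>xs\<in>\<X>. length xs = k + 2)"
  proof
    assume "\<exists>x\<in>verts ?G. \<exists>y\<in>verts ?G. adjacent ?G x y \<and>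
      (\<forall>z\<in>verts ?G. adjacent ?G x z \<longrightarrow> z = y) \<and> satisfies ?G (s(0 := x, 1 := y)) S (tail_formula k 0)"
    then obtain x y where xy: "x \<in> verts ?G" "adjacent ?G x y"
      "\<And>z. z \<in> verts ?G \<Longrightarrow> adjacent ?G x z \<Longrightarrow> z = y" "satisfies ?G (s(0 := x, 1 := y)) S (tail_formula k 0)"
      by blast
    obtain xs p where xs: "xs \<in> \<X>" "p < length xs" "x = xs ! p"
      using xy(1) by (auto simp: in_set_conv_nth)
    note path = component_path_family[OF assms xs(1)]
    note D = component_pathD[OF path]
    obtain q where q: "q < length xs" "y = xs ! q" "q = Suc p \<or> p = Suc q"
      using D(3)[OF xs(2), of y] xy(2) xs(3) by auto
    have only: "r = q" if "r < length xs" "r = Suc p \<or> p = Suc r" for r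
    proof -
      have "adjacent ?G x (xs ! r)" unfolding xs(3) D(3)[OF xs(2)] using that by blast
      moreover have "xs ! r \<in> verts ?G" by (rule subsetD[OF D(2) nth_mem[OF that(1)]])
      ultimately have "xs ! r = xs ! q" using xy(3) q(2) by simp
      then show ?thesis using nth_eq_iff_index_eq[OF D(1)] that(1) q(1) by simp
    qed
    have "\<exists>ys. component_path ?G ys \<and> length ys = length xs \<and> Suc 0 < length ys \<and> ys ! 0 = x \<and> ys ! Suc 0 = y"
    proof (cases "q = Suc p")
      case True
      have "p = 0" using only[of "p - 1"] xs(2) True by (cases p) auto
      then show ?thesis using path True q xs by (intro exI[of _ xs]) auto
    next
      case False
      then have p: "p = Suc q" using q(3) by simp
      have "Suc p = length xs" using only[of "Suc p"] xs(2) p by (cases "Suc p < length xs") auto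
      then have "length xs = Suc (Suc q)" using p by simp
      then have "rev xs ! 0 = xs ! Suc q" "rev xs ! Suc 0 = xs ! q" by (simp_all add: rev_nth)
      then show ?thesis using component_path_rev[OF path] p q(2) xs(3) \<open>length xs = Suc (Suc q)\<close>
        by (intro exI[of _ "rev xs"]) simp
    qed
    then obtain ys where ys: "component_path ?G ys" "length ys = length xs" "Suc 0 < length ys" "ys ! 0 = x" "ys ! Suc 0 = y"
      by blast
    then have "length ys = 0 + 2 + k"
      using satisfies_tail_formula[OF ys(1,3), of "s(0 := x, 1 := y)" 0 S k] xy(4) by simp
    then show "\<exists>xs\<in>\<X>. length xs = k + 2" using xs(1) ys(2) by auto
  next
    assume "\<exists>xs\<in>\<X>. length xs = k + 2"
    then obtain xs where xs: "xs \<in> \<X>" "length xs = k + 2" by blast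
    note path = component_path_family[OF assms xs(1)]
    note D = component_pathD[OF path]
    let ?x = "xs ! 0" and ?y = "xs ! Suc 0"
    have len: "Suc 0 < length xs" "0 < length xs" using xs(2) by auto
    have "adjacent ?G ?x z \<longleftrightarrow> z = ?y" for z
      unfolding D(3)[OF len(2)] using len by auto
    moreover have "satisfies ?G (s(0 := ?x, 1 := ?y)) S (tail_formula k 0)"
      using satisfies_tail_formula[OF path len(1), of "s(0 := ?x, 1 := ?y)" 0 S k] xs(2) by simp
    moreover have "?x \<in> verts ?G" "?y \<in> verts ?G" using D(2) len nth_mem by blast+
    ultimately show "\<exists>x\<in>verts ?G. \<exists>y\<in>verts ?G. adjacent ?G x y \<and>
      (\<forall>z\<in>verts ?G. adjacent ?G x z \<longrightarrow> z = y) \<and> satisfies ?G (s(0 := x, 1 := y)) S (tail_formula k 0)"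
      by blast
  qed
  finally show ?thesis .
qed

section \<open>The parity of a path\<close>

definition alternating_formula :: mso where
  "alternating_formula = Neg (ExV 0 (ExV 1 (Conj (Adj 0 1)
     (Conj (Neg (Conj (Mem 0 0) (Neg (Mem 1 0)))) (Neg (Conj (Mem 1 0) (Neg (Mem 0 0))))))))"

text \<open>The bound variables are 2 and 3, so \<open>i\<close> is to be 0 or 1 to avoid capture. A
  vertex without neighbours counts as an end.\<close>

definition end_formula :: "nat \<Rightarrow> mso" where
  "end_formula i = Neg (ExV 2 (ExV 3 (Conj (Adj i 2) (Conj (Adj i 3) (Neg (Eq 2 3))))))"

definition parity_formula :: mso where
  "parity_formula = ExS 0 (Conj alternating_formula (ExV 0 (ExV 1
     (Conj (Conj (end_formula 0) (end_formula 1)) (Conj (Mem 0 0) (Neg (Mem 1 0)))))))"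

lemma mso_sentence_parity_formula: "mso_sentence parity_formula"
  by (auto simp: mso_sentence_def parity_formula_def alternating_formula_def end_formula_def)

lemma satisfies_alternating_formula:
  "satisfies G s S alternating_formula \<longleftrightarrow>
    (\<forall>u\<in>verts G. \<forall>v\<in>verts G. adjacent G u v \<longrightarrow> (u \<in> S 0 \<longleftrightarrow> v \<notin> S 0))"
proof -
  have "satisfies G s S alternating_formula \<longleftrightarrow> \<not> (\<exists>u\<in>verts G. \<exists>v\<in>verts G. adjacent G u v \<and>
      \<not> (u \<in> S 0 \<and> v \<notin> S 0) \<and> \<not> (v \<in> S 0 \<and> u \<notin> S 0))"
    by (simp add: alternating_formula_def)
  then show ?thesis by blast
qed

lemma satisfies_end_formula:
  assumes "i < 2"
  shows "satisfies G s S (end_formula i) \<longleftrightarrow>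
    (\<forall>v\<in>verts G. \<forall>w\<in>verts G. adjacent G (s i) v \<longrightarrow> adjacent G (s i) w \<longrightarrow> v = w)"
  using assms by (simp add: end_formula_def)

text \<open>Membership in an alternating set flips at each step of the path, and ends stand at
  positions 0 and \<open>n - 1\<close> only. Ends on different sides therefore require
  \<open>n\<close> to be even; conversely, the entries at even positions form such a set.\<close>

lemma models_parity_formula:
  assumes "is_path G"
  shows "models G parity_formula \<longleftrightarrow> even (card (verts G))"
proof -
  obtain xs where xs: "xs \<noteq> []" "distinct xs" "G = path_graph xs"
    using assms by (auto simp: is_path_iff)
  have "component_path (family_graph {xs}) xs"
    by (rule component_path_family) (use xs in \<open>auto simp: list_family_def\<close>)
  moreover have "family_graph {xs} = G" by (rule graph_eqI) (auto simp: xs(3))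
  ultimately have path: "component_path G xs" by simp
  note D = component_pathD[OF path]
  have V: "verts G = set xs" by (simp add: xs(3))
  let ?n = "length xs"
  let ?end = "\<lambda>u. \<forall>v\<in>verts G. \<forall>w\<in>verts G. adjacent G u v \<longrightarrow> adjacent G u w \<longrightarrow> v = w"
  let ?alt = "\<lambda>W. \<forall>u\<in>verts G. \<forall>v\<in>verts G. adjacent G u v \<longrightarrow> (u \<in> W \<longleftrightarrow> v \<notin> W)"
  have "models G parity_formula \<longleftrightarrow> (\<exists>W\<subseteq>verts G. ?alt W \<and>
      (\<exists>u\<in>verts G. \<exists>v\<in>verts G. ?end u \<and> ?end v \<and> u \<in> W \<and> v \<notin> W))"
    unfolding models_sentence_iff[OF mso_sentence_parity_formula, of _ "\<lambda>_. undefined" "\<lambda>_. {}"]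
    by (simp add: parity_formula_def satisfies_alternating_formula satisfies_end_formula)
  also have "\<dots> \<longleftrightarrow> even ?n"
  proof
    assume "\<exists>W\<subseteq>verts G. ?alt W \<and> (\<exists>u\<in>verts G. \<exists>v\<in>verts G. ?end u \<and> ?end v \<and> u \<in> W \<and> v \<notin> W)"
    then obtain W u v where W: "?alt W" and uv: "u \<in> verts G" "v \<in> verts G" "?end u" "?end v" "u \<in> W" "v \<notin> W"
      by (elim exE conjE bexE) (rule that)
    have member: "xs ! i \<in> W \<longleftrightarrow> (xs ! 0 \<in> W \<longleftrightarrow> even i)" if "i < ?n" for i
      using that
    proof (induction i)
      case (Suc i)
      have "adjacent G (xs ! i) (xs ! Suc i)" using D(3)[of i "xs ! Suc i"] Suc.prems by auto
      then have "xs ! i \<in> W \<longleftrightarrow> xs ! Suc i \<notin> W" using W Suc.prems V by auto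
      then show ?case using Suc by auto
    qed simp
    have ends: "i = 0 \<or> Suc i = ?n" if i: "i < ?n" "?end (xs ! i)" for i
    proof (rule ccontr)
      assume "\<not> ?thesis"
      then obtain j where j: "i = Suc j" "Suc i < ?n" using i(1) by (cases i) auto
      have "adjacent G (xs ! i) (xs ! j)"
        unfolding D(3)[OF i(1)] by (rule exI[of _ j]) (use j in simp)
      moreover have "adjacent G (xs ! i) (xs ! Suc i)"
        unfolding D(3)[OF i(1)] by (rule exI[of _ "Suc i"]) (use j in simp)
      moreover have "xs ! j \<in> verts G" "xs ! Suc i \<in> verts G" using j V by auto
      ultimately have "xs ! j = xs ! Suc i" using i(2) by blast
      then show False using nth_eq_iff_index_eq[OF D(1), of j "Suc i"] j by simp
    qed
    obtain p q where pq: "p < ?n" "u = xs ! p" "q < ?n" "v = xs ! q"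
      using uv(1,2) V by (auto simp: in_set_conv_nth)
    then have "p = 0 \<or> Suc p = ?n" "q = 0 \<or> Suc q = ?n" using ends uv(3,4) by auto
    moreover have "even p \<noteq> even q" using member[OF pq(1)] member[OF pq(3)] uv(5,6) pq(2,4) by auto
    ultimately show "even ?n" by (metis even_Suc even_zero)
  next
    assume even: "even ?n"
    define W where "W = {xs ! i | i. i < ?n \<and> even i}"
    have member: "xs ! i \<in> W \<longleftrightarrow> even i" if "i < ?n" for i
    proof
      assume "xs ! i \<in> W"
      then obtain j where "xs ! i = xs ! j" "j < ?n" "even j" by (auto simp: W_def)
      then show "even i" using nth_eq_iff_index_eq[OF D(1) that] by simp
    qed (use that in \<open>auto simp: W_def\<close>)
    have "W \<subseteq> verts G" by (auto simp: W_def V)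
    moreover have "?alt W"
    proof (intro ballI impI)
      fix u v assume uv: "u \<in> verts G" "v \<in> verts G" "adjacent G u v"
      then obtain i where i: "i < ?n" "u = xs ! i" using V by (auto simp: in_set_conv_nth)
      then obtain j where "j < ?n" "v = xs ! j" "j = Suc i \<or> i = Suc j"
        using uv(3) D(3)[OF i(1), of v] by auto
      then show "u \<in> W \<longleftrightarrow> v \<notin> W" using i member by auto
    qed
    moreover have "?end (xs ! 0)" "?end (xs ! (?n - 1))"
      using D(3)[of 0] D(3)[of "?n - 1"] xs(1) by auto
    moreover have "xs ! 0 \<in> W" "xs ! (?n - 1) \<notin> W"
      using member[of 0] member[of "?n - 1"] xs(1) even by auto
    moreover have "xs ! 0 \<in> verts G" "xs ! (?n - 1) \<in> verts G" using xs(1) V by auto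
    ultimately show "\<exists>W\<subseteq>verts G. ?alt W \<and> (\<exists>u\<in>verts G. \<exists>v\<in>verts G. ?end u \<and> ?end v \<and> u \<in> W \<and> v \<notin> W)"
      by (intro exI[of _ W] conjI bexI[of _ "xs ! 0"] bexI[of _ "xs ! (?n - 1)"])
  qed
  also have "?n = card (verts G)" using xs(2) by (simp add: V distinct_card)
  finally show ?thesis .
qed

lemma prob_parity_formula:
  assumes "1 \<le> n"
  shows "prob_models (random_path n) parity_formula = (if even n then 1 else 0)"
proof -
  have "models G parity_formula \<longleftrightarrow> even n" if "G \<in> paths_on n" for G
    using that models_parity_formula[of G] by (auto simp: paths_on_def)
  then have "paths_on n \<inter> {G. models G parity_formula} = (if even n then paths_on n else {})"
    by auto
  moreover have "card (paths_on n) \<noteq> 0"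
    using paths_on_nonempty[OF assms] finite_paths_on[of n] by simp
  ultimately show ?thesis
    by (simp add: prob_models_def random_path_def
        measure_pmf_of_set[OF paths_on_nonempty[OF assms] finite_paths_on])
qed

lemma not_convergent_random_path: "\<not> mso_convergence_law random_path"
proof
  assume "mso_convergence_law random_path"
  then obtain c where c: "(\<lambda>n. prob_models (random_path n) parity_formula) \<longlonglongrightarrow> c"
    using mso_sentence_parity_formula by (auto simp: mso_convergence_law_def convergent_def)
  \<comment> \<open>Both subsequences avoid \<open>n = 0\<close>, where the distribution is
    unspecified.\<close>
  have "strict_mono (\<lambda>n::nat. 2 * n + 2)" "strict_mono (\<lambda>n::nat. 2 * n + 1)"
    by (auto simp: strict_mono_def)
  from LIMSEQ_subseq_LIMSEQ[OF c this(1)] LIMSEQ_subseq_LIMSEQ[OF c this(2)]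
  have "(\<lambda>n. 1 :: real) \<longlonglongrightarrow> c" "(\<lambda>n. 0 :: real) \<longlonglongrightarrow> c"
    by (simp_all add: comp_def prob_parity_formula)
  then have "c = 1" "c = 0" by (auto simp: LIMSEQ_const_iff)
  then show False by simp
qed

section \<open>Density of the limit probabilities\<close>

definition expressible :: "(nat graph \<Rightarrow> bool) \<Rightarrow> bool" where
  "expressible P \<longleftrightarrow> (\<exists>\<phi>. mso_sentence \<phi> \<and> (\<forall>n. \<forall>G\<in>path_forests_on n. models G \<phi> \<longleftrightarrow> P G))"

lemma expressible_True: "expressible (\<lambda>_. True)"
proof -
  have "mso_sentence (Neg (ExV 0 (Neg (Eq 0 0))))" by (simp add: mso_sentence_def)
  moreover have "models G (Neg (ExV 0 (Neg (Eq 0 0))))" for G :: "nat graph"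
    by (simp add: models_def)
  ultimately show ?thesis unfolding expressible_def by blast
qed

lemma expressible_not:
  assumes "expressible P"
  shows "expressible (\<lambda>G. \<not> P G)"
proof -
  obtain \<phi> where \<phi>: "mso_sentence \<phi>" "\<And>n G. G \<in> path_forests_on n \<Longrightarrow> models G \<phi> \<longleftrightarrow> P G"
    using assms by (auto simp: expressible_def)
  have s: "mso_sentence (Neg \<phi>)" using \<phi>(1) by (simp add: mso_sentence_def)
  have "models G (Neg \<phi>) \<longleftrightarrow> \<not> models G \<phi>" for G :: "nat graph"
    unfolding models_sentence_iff[OF s, of G "\<lambda>_. 0" "\<lambda>_. {}"] models_sentence_iff[OF \<phi>(1), of G "\<lambda>_. 0" "\<lambda>_. {}"]
    by simp
  then show ?thesis unfolding expressible_def using s \<phi>(2) by blast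
qed

lemma expressible_conj:
  assumes "expressible P" "expressible Q"
  shows "expressible (\<lambda>G. P G \<and> Q G)"
proof -
  obtain \<phi> where \<phi>: "mso_sentence \<phi>" "\<And>n G. G \<in> path_forests_on n \<Longrightarrow> models G \<phi> \<longleftrightarrow> P G"
    using assms(1) by (auto simp: expressible_def)
  obtain \<psi> where \<psi>: "mso_sentence \<psi>" "\<And>n G. G \<in> path_forests_on n \<Longrightarrow> models G \<psi> \<longleftrightarrow> Q G"
    using assms(2) by (auto simp: expressible_def)
  have s: "mso_sentence (Conj \<phi> \<psi>)" using \<phi>(1) \<psi>(1) by (simp add: mso_sentence_def)
  have "models G (Conj \<phi> \<psi>) \<longleftrightarrow> models G \<phi> \<and> models G \<psi>" for G :: "nat graph"
    by (auto simp: models_def)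
  then show ?thesis unfolding expressible_def using s \<phi>(2) \<psi>(2) by blast
qed

lemma expressible_ball:
  assumes "finite A" "\<And>x. x \<in> A \<Longrightarrow> expressible (P x)"
  shows "expressible (\<lambda>G. \<forall>x\<in>A. P x G)"
  using assms by (induction A) (auto intro: expressible_True expressible_conj)

lemma expressible_bex:
  assumes "finite A" "\<And>x. x \<in> A \<Longrightarrow> expressible (P x)"
  shows "expressible (\<lambda>G. \<exists>x\<in>A. P x G)"
proof -
  have "expressible (\<lambda>G. \<not> (\<forall>x\<in>A. \<not> P x G))"
    by (intro expressible_not expressible_ball assms)
  then show ?thesis by simp
qed

text \<open>Sizes start at 2, the smallest size described by a
  \<open>component_formula\<close>.\<close>

definition occurring_sizes :: "nat \<Rightarrow> (nat \<Rightarrow> nat) \<Rightarrow> nat set" where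
  "occurring_sizes K a = {l\<in>{2..K}. a l \<noteq> 0}"

lemma expressible_occurs:
  assumes "l \<in> {2..K}"
  shows "expressible (\<lambda>G. count_vector K G l \<noteq> 0)"
  unfolding expressible_def
proof (intro exI[of _ "component_formula (l - 2)"] conjI allI ballI)
  fix n G assume G: "G \<in> path_forests_on n"
  obtain \<X> where X: "list_family \<X>" "family_graph \<X> = G"
    "\<And>P. card {xs\<in>\<X>. P (length xs)} = card {H\<in>components G. P (card (verts H))}"
    using forest_list_family[OF path_forests_onD(1,3)[OF G]] by blast
  have "models G (component_formula (l - 2)) \<longleftrightarrow> (\<exists>xs\<in>\<X>. length xs = l)"
  proof -
    have "l - 2 + 2 = l" using assms by (intro le_add_diff_inverse2) simp
    then show ?thesis using models_component_formula[OF X(1), of "l - 2"] by (simp only: X(2))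
  qed
  also have "\<dots> \<longleftrightarrow> card {xs\<in>\<X>. length xs = l} \<noteq> 0"
    using X(1) by (auto simp: list_family_def)
  also have "card {xs\<in>\<X>. length xs = l} = count_vector K G l"
    using X(3)[of "\<lambda>m. m = l"] assms by (simp add: count_vector_def comp_count_def)
  finally show "models G (component_formula (l - 2)) \<longleftrightarrow> count_vector K G l \<noteq> 0" .
qed (rule mso_sentence_component_formula)

text \<open>An event about occurring sizes is a finite disjunction of atoms, each deciding for every
  size in \<open>{2..K}\<close> whether it occurs.\<close>

lemma expressible_occurring_sizes:
  assumes "\<E> \<subseteq> Pow {2..K}"
  shows "expressible (\<lambda>G. occurring_sizes K (count_vector K G) \<in> \<E>)"
proof -
  have "finite \<E>" using assms finite_subset by blast
  then have "expressible (\<lambda>G. \<exists>e\<in>\<E>. \<forall>l\<in>{2..K}. if l \<in> e then count_vector K G l \<noteq> 0 else \<not> (count_vector K G l \<noteq> 0))"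
  proof (intro expressible_bex expressible_ball)
    fix e l assume "l \<in> {2..K}"
    from expressible_occurs[OF this] expressible_not[OF expressible_occurs[OF this]]
    show "expressible (\<lambda>G. if l \<in> e then count_vector K G l \<noteq> 0 else \<not> (count_vector K G l \<noteq> 0))"
      by (cases "l \<in> e") simp_all
  qed auto
  moreover have "(\<forall>l\<in>{2..K}. if l \<in> e then a l \<noteq> 0 else \<not> (a l \<noteq> 0)) \<longleftrightarrow> occurring_sizes K a = e"
    if "e \<in> \<E>" for e and a :: "nat \<Rightarrow> nat"
  proof -
    have "e \<subseteq> {2..K}" using that assms by blast
    have "occurring_sizes K a = e \<longleftrightarrow> (\<forall>l\<in>{2..K}. l \<in> e \<longleftrightarrow> a l \<noteq> 0)"
      using \<open>e \<subseteq> {2..K}\<close> unfolding occurring_sizes_def by blast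
    also have "\<dots> \<longleftrightarrow> (\<forall>l\<in>{2..K}. if l \<in> e then a l \<noteq> 0 else \<not> (a l \<noteq> 0))"
      by (rule ball_cong) auto
    finally show ?thesis ..
  qed
  ultimately show ?thesis by (simp cong: bex_cong)
qed

definition limit_sizes :: "nat \<Rightarrow> nat set pmf" where
  "limit_sizes K = map_pmf (occurring_sizes K) (limit_counts K)"

lemma set_limit_sizes: "set_pmf (limit_sizes K) \<subseteq> Pow {2..K}"
  by (auto simp: limit_sizes_def occurring_sizes_def)

text \<open>By independence an atom is a product over sizes. Each of the \<open>K - 1\<close> sizes
  from 2 on contributes \<open>exp (- 1 / 2)\<close> or \<open>1 - exp (- 1 / 2)\<close>; the former
  is at least \<open>1 / 2\<close>, hence the larger. Size 1 is unconstrained and contributes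
  1.\<close>

lemma pmf_limit_sizes_le: "pmf (limit_sizes K) e \<le> exp (- 1 / 2) ^ (K - 1)"
proof (cases "e \<in> Pow {2..K}")
  case False
  then have "pmf (limit_sizes K) e = 0" using set_limit_sizes[of K] by (auto simp: set_pmf_iff)
  then show ?thesis by simp
next
  case True
  let ?B = "\<lambda>l. if l = 1 then UNIV else if l \<in> e then - {0} else {0 :: nat}"
  have half: "1 - exp (- 1 / 2) \<le> exp (- 1 / 2 :: real)"
    using exp_ge_add_one_self[of "- 1 / 2 :: real"] by simp
  have eq: "occurring_sizes K -` {e} = Pi {1..K} ?B"
  proof (intro equalityI subsetI)
    fix a assume "a \<in> occurring_sizes K -` {e}"
    then have "e = {l\<in>{2..K}. a l \<noteq> 0}" by (auto simp: occurring_sizes_def)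
    then show "a \<in> Pi {1..K} ?B" by (auto simp: Pi_def)
  next
    fix a assume a: "a \<in> Pi {1..K} ?B"
    have "l \<in> e \<longleftrightarrow> a l \<noteq> 0" if "l \<in> {2..K}" for l
      using that Pi_mem[OF a, of l] by (simp split: if_splits)
    then show "a \<in> occurring_sizes K -` {e}" using True by (auto simp: occurring_sizes_def)
  qed
  have "pmf (limit_sizes K) e = (\<Prod>l\<in>{1..K}. measure_pmf.prob (poisson_pmf (path_weight l)) (?B l))"
    unfolding limit_sizes_def pmf_map eq by (rule prob_limit_counts_Pi)
  also have "\<dots> \<le> (\<Prod>l\<in>{1..K}. if l = 1 then 1 else exp (- 1 / 2))"
  proof (rule prod_mono)
    fix l assume "l \<in> {1..K}"
    show "0 \<le> measure_pmf.prob (poisson_pmf (path_weight l)) (?B l) \<and>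
        measure_pmf.prob (poisson_pmf (path_weight l)) (?B l) \<le> (if l = 1 then 1 else exp (- 1 / 2))"
      using half prob_poisson_0[of l] prob_poisson_nonzero[of l] by (auto simp: path_weight_def)
  qed
  also have "\<dots> = exp (- 1 / 2) ^ (K - 1)"
  proof -
    have "{1..K} \<inter> - {l. l = 1} = {2..K}" by auto
    then show ?thesis by (subst prod.If_cases) auto
  qed
  finally show ?thesis .
qed

text \<open>When elements are added one at a time, the partial sums reach \<open>x\<close> at some
  stage; the sum just before misses it by at most one weight.\<close>

lemma subset_sum_dense:
  fixes w :: "'a \<Rightarrow> real"
  assumes "finite X" "\<And>a. a \<in> X \<Longrightarrow> w a \<le> \<epsilon>" "0 \<le> \<epsilon>" "0 \<le> x" "x \<le> sum w X"
  shows "\<exists>Y\<subseteq>X. x - \<epsilon> \<le> sum w Y \<and> sum w Y \<le> x"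
  using assms
proof (induction X)
  case empty
  then show ?case by auto
next
  case (insert a X)
  show ?case
  proof (cases "x \<le> sum w X")
    case True
    then obtain Y where "Y \<subseteq> X" "x - \<epsilon> \<le> sum w Y \<and> sum w Y \<le> x" using insert by auto
    then show ?thesis by blast
  next
    case False
    then have "x - \<epsilon> \<le> sum w X \<and> sum w X \<le> x" using insert.hyps insert.prems(1)[of a] insert.prems(4) by simp
    then show ?thesis by blast
  qed
qed

lemma limit_probability_dense:
  assumes x: "0 \<le> x" "x \<le> 1" and "0 < \<epsilon>"
  shows "\<exists>\<phi>. mso_sentence \<phi> \<and> \<bar>lim (\<lambda>n. prob_models (random_path_forest n) \<phi>) - x\<bar> < \<epsilon>"
proof -
  have "(\<lambda>m. exp (- 1 / 2 :: real) ^ m) \<longlonglongrightarrow> 0"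
    by (rule LIMSEQ_realpow_zero) auto
  then have "\<forall>\<^sub>F m in sequentially. exp (- 1 / 2 :: real) ^ m < \<epsilon>"
    using \<open>0 < \<epsilon>\<close> by (rule order_tendstoD(2))
  then obtain m where m: "exp (- 1 / 2 :: real) ^ m < \<epsilon>" by (auto simp: eventually_sequentially)
  \<comment> \<open>The bound on the atoms has exponent \<open>K - 1\<close>, which is now
    \<open>m\<close>.\<close>
  define K where "K = Suc m"
  let ?w = "pmf (limit_sizes K)"
  have "sum ?w (Pow {2..K}) = 1"
    by (rule sum_pmf_eq_1) (use set_limit_sizes in auto)
  then obtain \<E> where E: "\<E> \<subseteq> Pow {2..K}" "x - exp (- 1 / 2) ^ m \<le> sum ?w \<E>" "sum ?w \<E> \<le> x"
    using subset_sum_dense[of "Pow {2..K}" ?w "exp (- 1 / 2) ^ m" x] pmf_limit_sizes_le[of K] x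
    by (auto simp: K_def)
  obtain \<phi> where \<phi>: "mso_sentence \<phi>"
    "\<And>n G. G \<in> path_forests_on n \<Longrightarrow> models G \<phi> \<longleftrightarrow> occurring_sizes K (count_vector K G) \<in> \<E>"
    using expressible_occurring_sizes[OF E(1)] by (auto simp: expressible_def)
  have "(\<lambda>n. measure_pmf.prob (random_path_forest n) {G. count_vector K G \<in> occurring_sizes K -` \<E>})
      \<longlonglongrightarrow> measure_pmf.prob (limit_counts K) (occurring_sizes K -` \<E>)"
    by (rule prob_count_vector_tendsto)
  moreover have "measure_pmf.prob (random_path_forest n) {G. count_vector K G \<in> occurring_sizes K -` \<E>} =
      prob_models (random_path_forest n) \<phi>" for n
    unfolding prob_models_def
    by (rule measure_eq_AE) (use \<phi>(2) in \<open>auto simp: AE_measure_pmf_iff set_random_path_forest\<close>)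
  moreover have "measure_pmf.prob (limit_counts K) (occurring_sizes K -` \<E>) = sum ?w \<E>"
  proof -
    have "finite \<E>" using E(1) finite_subset by blast
    then show ?thesis by (simp add: limit_sizes_def flip: measure_measure_pmf_finite)
  qed
  ultimately have "lim (\<lambda>n. prob_models (random_path_forest n) \<phi>) = sum ?w \<E>"
    by (simp add: limI)
  then show ?thesis using \<phi>(1) E(2,3) m by (intro exI[of _ \<phi>]) auto
qed

theorem theorem1p10:
  "\<not> mso_convergence_law random_path \<and>
   mso_convergence_law random_path_forest \<and>
   closure {lim (\<lambda>n. prob_models (random_path_forest n) \<phi>) | \<phi>. mso_sentence \<phi>} = {0..1}"
proof (intro conjI)
  show "\<not> mso_convergence_law random_path" by (rule not_convergent_random_path)
  show "mso_convergence_law random_path_forest"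
    unfolding mso_convergence_law_def using path_forest_convergent by blast
  let ?S = "{lim (\<lambda>n. prob_models (random_path_forest n) \<phi>) | \<phi>. mso_sentence \<phi>}"
  show "closure ?S = {0..1}"
  proof
    have "?S \<subseteq> {0..1}"
    proof
      fix y assume "y \<in> ?S"
      then obtain \<phi> where \<phi>: "y = lim (\<lambda>n. prob_models (random_path_forest n) \<phi>)" "mso_sentence \<phi>" by blast
      \<comment> \<open>The convergence law makes \<open>lim\<close> a genuine limit, which inherits
        the bounds 0 and 1.\<close>
      have "(\<lambda>n. prob_models (random_path_forest n) \<phi>) \<longlonglongrightarrow> y"
        using path_forest_convergent[OF \<phi>(2)] unfolding \<phi>(1) convergent_LIMSEQ_iff .
      then show "y \<in> {0..1}"
        using LIMSEQ_le_const[of _ y 0] LIMSEQ_le_const2[of _ y 1] by (auto simp: prob_models_def)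
    qed
    then show "closure ?S \<subseteq> {0..1}" by (rule closure_minimal) simp
    show "{0..1} \<subseteq> closure ?S"
    proof
      fix x :: real assume "x \<in> {0..1}"
      then show "x \<in> closure ?S"
        using limit_probability_dense[of x] unfolding closure_approachable dist_real_def by fastforce
    qed
  qed
qed

end
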